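(* Write $1=B_1$, $2=B_2$ in subscripts of identities ($\mathrm{id}_1,\mathrm{id}_2$). The category $\mathrm{Fund}(\mathfrak{sp}_4\text{-}\mathrm{Crys})$ is isomorphic, as a $\Bbbk$-linear monoidal category, to the $\Bbbk$-linear monoidal category generated by objects $B_1,B_2$ and morphisms $$c_1:B_1\otimes B_1\to\mathbb 1,\quad c_2:B_2\otimes B_2\to\mathbb 1,\quad m:B_1\otimes B_1\to B_2,\quad t:B_1\otimes B_2\to B_1,\quad\beta_{21}:B_2\otimes B_1\to B_1\otimes B_2,\quad d:B_2\otimes B_2\to B_1\otimes B_1,$$ together with their vertical reflections $$u_1:\mathbb 1\to B_1\otimes B_1,\quad u_2:\mathbb 1\to B_2\otimes B_2,\quad s:B_2\to B_1\otimes B_1,\quad\bar t:B_1\to B_1\otimes B_2,\quad\beta_{12}:B_1\otimes B_2\to B_2\otimes B_1,\quad\bar d:B_1\otimes B_1\to B_2\otimes B_2,$$ subject to the following relations and their vertical reflections (where $q:B_2\otimes B_1\to B_1$ is defined by (SP4.0), with vertical reflection $\bar q=\beta_{12}\circ\bar t:B_1\to B_2\otimes B_1$): (SP4.0) $q=t\,\beta_{21}$. (SP4.1) $m(\mathrm{id}_1\otimes t)=(\mathrm{id}_2\otimes c_1)(\beta_{12}\otimes\mathrm{id}_1)(\mathrm{id}_1\otimes\beta_{12})$. (SP4.2) $c_1u_1=1=c_2u_2$. (SP4.3) $m\,s=\mathrm{id}_2$. (SP4.4) $\beta_{21}\beta_{12}=\mathrm{id}$, $\beta_{12}\beta_{21}=\mathrm{id}$.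 (SP4.5) $(\mathrm{id}_1\otimes t)(s\otimes\mathrm{id}_2)=u_1c_2=(q\otimes\mathrm{id}_1)(\mathrm{id}_2\otimes s)$; $(\mathrm{id}_1\otimes m)(s\otimes\mathrm{id}_1)=\bar t\,q$. (SP4.6) $d\,\bar d=\mathrm{id}_1\otimes\mathrm{id}_1-u_1c_1-s\,m$. (SP4.7) The following are all $0$: $(\mathrm{id}_1\otimes c_1)(s\otimes\mathrm{id}_1)$, $(\mathrm{id}_1\otimes c_2)(\bar t\otimes\mathrm{id}_2)$, $(c_1\otimes\mathrm{id}_1)(\mathrm{id}_1\otimes s)$, $(c_2\otimes\mathrm{id}_1)(\mathrm{id}_2\otimes\bar q)$, $(\mathrm{id}_2\otimes c_2)(u_2\otimes\mathrm{id}_2)$, $(\mathrm{id}_1\otimes c_1)(u_1\otimes\mathrm{id}_1)$. (SP4.8) $(\mathrm{id}_2\otimes c_2)(\bar d\otimes\mathrm{id}_2)=0$, $(c_2\otimes\mathrm{id}_2)(\mathrm{id}_2\otimes\bar d)=0$; $(\mathrm{id}_2\otimes q)(\bar d\otimes\mathrm{id}_1)=\bar q\otimes c_1$; $(t\otimes\mathrm{id}_2)(\mathrm{id}_1\otimes\bar d)=c_1\otimes\bar t$. (SP4.9) $c_1s=0$, $c_1d=0$, $d\,u_2=0$. (SP4.10) $(t\otimes\mathrm{id}_1)(\mathrm{id}_1\otimes\beta_{12})=u_1c_2(m\otimes\mathrm{id}_2)+d(m\otimes\mathrm{id}_2)+c_1\otimes s$. (SP4.11) $(m\otimes\mathrm{id}_2)(\mathrm{id}_1\otimes\beta_{21})=(\mathrm{id}_2\otimes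 m)(\beta_{12}\otimes\mathrm{id}_1)-\bar d(\mathrm{id}_1\otimes q)+\bar d(t\otimes\mathrm{id}_1)$. (SP4.12) $(c_1\otimes\mathrm{id}_2)(\mathrm{id}_1\otimes\beta_{21})=m(t\otimes\mathrm{id}_1)$; $m(\mathrm{id}_1\otimes q)=(\mathrm{id}_2\otimes c_1)(\beta_{12}\otimes\mathrm{id}_1)$. (SP4.13) $(c_2\otimes\mathrm{id}_1)(\mathrm{id}_2\otimes\beta_{12})=t(q\otimes\mathrm{id}_2)$. (SP4.14) $(d\otimes\mathrm{id}_1)(\mathrm{id}_2\otimes\beta_{12})=(\mathrm{id}_1\otimes u_1c_2)(\beta_{21}\otimes\mathrm{id}_2)+(s\otimes\mathrm{id}_1)\,\bar q\,(\mathrm{id}_1\otimes c_2)(\beta_{21}\otimes\mathrm{id}_2)-s\otimes t+(\mathrm{id}_1\otimes d)(\beta_{21}\otimes\mathrm{id}_2)+q\otimes s-(s\otimes\mathrm{id}_1)\,\bar q\,t(q\otimes\mathrm{id}_2)-u_1\otimes\big(t(q\otimes\mathrm{id}_2)\big)$. (SP4.15) $(q\otimes\mathrm{id}_2)(\mathrm{id}_2\otimes\beta_{21})=c_2\otimes\bar t+(\mathrm{id}_1\otimes m)(d\otimes\mathrm{id}_1)$. (SP4.16) $(\mathrm{id}_1\otimes c_2)(\beta_{21}\otimes\mathrm{id}_2)(\mathrm{id}_2\otimes\beta_{21})=(\mathrm{id}_1\otimes c_1)(d\otimes\mathrm{id}_1)$. (SP4.17) $(\mathrm{id}_2\otimes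 m)(\beta_{12}\otimes\mathrm{id}_1)(\mathrm{id}_1\otimes\beta_{12})=\bar d(\mathrm{id}_1\otimes t)+m\otimes\mathrm{id}_2-\bar d\,d(m\otimes\mathrm{id}_2)$. (SP4.18) $(\mathrm{id}_1\otimes d)(\beta_{21}\otimes\mathrm{id}_2)(\mathrm{id}_2\otimes\beta_{21})=u_1c_2\otimes\mathrm{id}_1+d\otimes\mathrm{id}_1-(\mathrm{id}_1\otimes s\,m)(d\otimes\mathrm{id}_1)+s\otimes q-(\mathrm{id}_1\otimes u_1c_1)(d\otimes\mathrm{id}_1)-(s\otimes\mathrm{id}_1)\,\bar q\,(\mathrm{id}_1\otimes c_1)(d\otimes\mathrm{id}_1)$. (SP4.19) $t(\mathrm{id}_1\otimes m)=q(m\otimes\mathrm{id}_1)$; $c_1(\mathrm{id}_1\otimes t)=c_2(m\otimes\mathrm{id}_2)$; $c_1(\mathrm{id}_1\otimes q)=c_1(t\otimes\mathrm{id}_1)$; $c_2(\mathrm{id}_2\otimes m)=c_1(q\otimes\mathrm{id}_1)$. (SP4.20) $d(\mathrm{id}_2\otimes m)=(\mathrm{id}_1\otimes q)(\beta_{21}\otimes\mathrm{id}_1)-s\otimes c_1-u_1c_1(q\otimes\mathrm{id}_1)$. (SP4.21) $(c_1\otimes\mathrm{id}_1)(\mathrm{id}_1\otimes d)=t(t\otimes\mathrm{id}_2)$. (SP4.22) $(m\otimes\mathrm{id}_1)(\mathrm{id}_1\otimes d)=(\mathrm{id}_2\otimes t)(\beta_{12}\otimes\mathrm{id}_2)-\bar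 q\otimes c_2$; $(q\otimes\mathrm{id}_1)(\mathrm{id}_2\otimes d)=(\mathrm{id}_1\otimes t)(d\otimes\mathrm{id}_2)$. (SP4.23) $(\mathrm{id}_1\otimes q)(\beta_{21}\otimes\mathrm{id}_1)(\mathrm{id}_2\otimes s)=d+u_1c_2$. (SP4.24) $(\mathrm{id}_1\otimes q)(\beta_{21}\otimes\mathrm{id}_1)(\mathrm{id}_2\otimes d)=0$. (SP4.25) $(\mathrm{id}_2\otimes t)(\beta_{12}\otimes\mathrm{id}_2)(\mathrm{id}_1\otimes\bar d)=m\otimes\mathrm{id}_1-\bar q\,q(m\otimes\mathrm{id}_1)$.
   Context: $\Bbbk$ is a field. $\mathfrak{sp}_4$-Crys is the (strictified) $\Bbbk$-linear monoidal category whose objects are finite direct sums (disjoint unions) of the highest weight crystals $B(\lambda)$ ($\lambda$ dominant) of $\mathfrak{sp}_4$, with morphisms $\Bbbk$-linear combinations of strict crystal morphisms (maps $B\sqcup\{0\}\to C\sqcup\{0\}$ with $0\mapsto0$, preserving weights and commuting with the Kashiwara operators $e_i,f_i$), viewed as linear maps between $\Bbbk$-spans. The tensor product convention is $e_i(b\otimes c)=e_ib\otimes c$ if $\varphi_i(b)\ge\varepsilon_i(c)$, else $b\otimes e_ic$; $f_i(b\otimes c)=f_ib\otimes c$ if $\varphi_i(b)>\varepsilon_i(c)$, else $b\otimes f_ic$, where $\varepsilon_i(b)=\max\{m:e_i^mb\ne0\}$, $\varphi_i(b)=\max\{m:f_i^mb\ne0\}$. $B_1=B(\omega_1)$ and $B_2=B(\omega_2)$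 are the crystals of the four- and five-dimensional fundamental representations. $\mathrm{Fund}(\mathfrak{sp}_4\text{-Crys})$ is the full monoidal subcategory whose objects are the tensor words in $B_1,B_2$, including the empty word $\mathbb 1$. Juxtaposition denotes composition. Vertical reflection reverses composition and exchanges domain and codomain, keeping the left-right order of tensor factors: $c_i\leftrightarrow u_i$, $m\leftrightarrow s$, $t\leftrightarrow\bar t$, $q\leftrightarrow\bar q$, $\beta_{12}\leftrightarrow\beta_{21}$, $d\leftrightarrow\bar d$. Under the isomorphism, $c_1,c_2,m,t,d$ are the crystal morphisms sending, respectively, the component of $B_1\otimes B_1$, $B_2\otimes B_2$, $B_1\otimes B_1$, $B_1\otimes B_2$, $B_2\otimes B_2$ isomorphic to $\mathbb 1$, $\mathbb 1$, $B_2$, $B_1$, $B(2\omega_1)$ isomorphically onto $\mathbb 1$, $\mathbb 1$, $B_2$, $B_1$ and the top component of $B_1\otimes B_1$, and zero on the other components; $\beta_{12},\beta_{21}$ are the unique crystal isomorphisms. *)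

theory Defs
  imports Main "HOL-Library.Product_Plus"
begin

section \<open>Strict linear monoidal categories\<close>

record ('o, 'm, 'k) lin_mon_cat =
  obj :: "'o set"
  hom :: "'o \<Rightarrow> 'o \<Rightarrow> 'm set"
  ident :: "'o \<Rightarrow> 'm"
  compose :: "'m \<Rightarrow> 'm \<Rightarrow> 'm" (infixl "\<cdot>\<index>" 70)
  zero_mor :: "'o \<Rightarrow> 'o \<Rightarrow> 'm"
  add_mor :: "'m \<Rightarrow> 'm \<Rightarrow> 'm" (infixl "\<oplus>\<index>" 65)
  scale_mor :: "'k \<Rightarrow> 'm \<Rightarrow> 'm" (infixr "\<odot>\<index>" 72)
  unit_obj :: "'o"
  tensor_obj :: "'o \<Rightarrow> 'o \<Rightarrow> 'o" (infixr "\<boxtimes>\<index>" 75)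
  tensor_mor :: "'m \<Rightarrow> 'm \<Rightarrow> 'm" (infixr "\<otimes>\<index>" 75)

locale linear_monoidal_category =
  fixes C :: "('o, 'm, 'k::field) lin_mon_cat" (structure)
  assumes hom_obj: "f \<in> hom C a b \<Longrightarrow> a \<in> obj C \<and> b \<in> obj C"
    and hom_disjoint: "f \<in> hom C a b \<Longrightarrow> f \<in> hom C a' b' \<Longrightarrow> a = a' \<and> b = b'"
    and ident_hom: "a \<in> obj C \<Longrightarrow> ident C a \<in> hom C a a"
    and comp_hom: "f \<in> hom C a b \<Longrightarrow> g \<in> hom C b c \<Longrightarrow> g \<cdot> f \<in> hom C a c"
    and comp_ident_left: "f \<in> hom C a b \<Longrightarrow> ident C b \<cdot> f = f"
    and comp_ident_right: "f \<in> hom C a b \<Longrightarrow> f \<cdot> ident C a = f"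
    and comp_assoc: "f \<in> hom C a b \<Longrightarrow> g \<in> hom C b c \<Longrightarrow> h \<in> hom C c d
          \<Longrightarrow> (h \<cdot> g) \<cdot> f = h \<cdot> (g \<cdot> f)"
    and zero_hom: "a \<in> obj C \<Longrightarrow> b \<in> obj C \<Longrightarrow> zero_mor C a b \<in> hom C a b"
    and add_hom: "f \<in> hom C a b \<Longrightarrow> g \<in> hom C a b \<Longrightarrow> f \<oplus> g \<in> hom C a b"
    and scale_hom: "f \<in> hom C a b \<Longrightarrow> r \<odot> f \<in> hom C a b"
    and add_assoc: "f \<in> hom C a b \<Longrightarrow> g \<in> hom C a b \<Longrightarrow> h \<in> hom C a b
          \<Longrightarrow> (f \<oplus> g) \<oplus> h = f \<oplus> (g \<oplus> h)"
    and add_commute: "f \<in> hom C a b \<Longrightarrow> g \<in> hom C a b \<Longrightarrow> f \<oplus> g = g \<oplus> f"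
    and add_zero: "f \<in> hom C a b \<Longrightarrow> f \<oplus> zero_mor C a b = f"
    and add_inverse: "f \<in> hom C a b \<Longrightarrow> f \<oplus> (- 1) \<odot> f = zero_mor C a b"
    and scale_one: "f \<in> hom C a b \<Longrightarrow> 1 \<odot> f = f"
    and scale_scale: "f \<in> hom C a b \<Longrightarrow> r \<odot> (r' \<odot> f) = (r * r') \<odot> f"
    and scale_add_left: "f \<in> hom C a b \<Longrightarrow> (r + r') \<odot> f = r \<odot> f \<oplus> r' \<odot> f"
    and scale_add_right: "f \<in> hom C a b \<Longrightarrow> g \<in> hom C a b
          \<Longrightarrow> r \<odot> (f \<oplus> g) = r \<odot> f \<oplus> r \<odot> g"
    and comp_add_left: "f \<in> hom C a b \<Longrightarrow> g \<in> hom C b c \<Longrightarrow> g' \<in> hom C b c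
          \<Longrightarrow> (g \<oplus> g') \<cdot> f = g \<cdot> f \<oplus> g' \<cdot> f"
    and comp_add_right: "f \<in> hom C a b \<Longrightarrow> f' \<in> hom C a b \<Longrightarrow> g \<in> hom C b c
          \<Longrightarrow> g \<cdot> (f \<oplus> f') = g \<cdot> f \<oplus> g \<cdot> f'"
    and comp_scale_left: "f \<in> hom C a b \<Longrightarrow> g \<in> hom C b c \<Longrightarrow> (r \<odot> g) \<cdot> f = r \<odot> (g \<cdot> f)"
    and comp_scale_right: "f \<in> hom C a b \<Longrightarrow> g \<in> hom C b c \<Longrightarrow> g \<cdot> (r \<odot> f) = r \<odot> (g \<cdot> f)"
    and unit_obj: "unit_obj C \<in> obj C"
    and tensor_obj: "a \<in> obj C \<Longrightarrow> b \<in> obj C \<Longrightarrow> a \<boxtimes> b \<in> obj C"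
    and tensor_obj_assoc: "a \<in> obj C \<Longrightarrow> b \<in> obj C \<Longrightarrow> c \<in> obj C
          \<Longrightarrow> (a \<boxtimes> b) \<boxtimes> c = a \<boxtimes> (b \<boxtimes> c)"
    and tensor_obj_unit_left: "a \<in> obj C \<Longrightarrow> unit_obj C \<boxtimes> a = a"
    and tensor_obj_unit_right: "a \<in> obj C \<Longrightarrow> a \<boxtimes> unit_obj C = a"
    and tensor_hom: "f \<in> hom C a b \<Longrightarrow> g \<in> hom C c d \<Longrightarrow> f \<otimes> g \<in> hom C (a \<boxtimes> c) (b \<boxtimes> d)"
    and tensor_ident: "a \<in> obj C \<Longrightarrow> b \<in> obj C \<Longrightarrow> ident C a \<otimes> ident C b = ident C (a \<boxtimes> b)"
    and interchange: "f \<in> hom C a b \<Longrightarrow> g \<in> hom C b c \<Longrightarrow> f' \<in> hom C a' b' \<Longrightarrow> g' \<in> hom C b' c'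
          \<Longrightarrow> (g \<cdot> f) \<otimes> (g' \<cdot> f') = (g \<otimes> g') \<cdot> (f \<otimes> f')"
    and tensor_assoc: "f \<in> hom C a b \<Longrightarrow> g \<in> hom C c d \<Longrightarrow> h \<in> hom C a' b'
          \<Longrightarrow> (f \<otimes> g) \<otimes> h = f \<otimes> (g \<otimes> h)"
    and tensor_unit_left: "f \<in> hom C a b \<Longrightarrow> ident C (unit_obj C) \<otimes> f = f"
    and tensor_unit_right: "f \<in> hom C a b \<Longrightarrow> f \<otimes> ident C (unit_obj C) = f"
    and tensor_add_left: "f \<in> hom C a b \<Longrightarrow> f' \<in> hom C a b \<Longrightarrow> g \<in> hom C c d
          \<Longrightarrow> (f \<oplus> f') \<otimes> g = (f \<otimes> g) \<oplus> (f' \<otimes> g)"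
    and tensor_add_right: "f \<in> hom C a b \<Longrightarrow> g \<in> hom C c d \<Longrightarrow> g' \<in> hom C c d
          \<Longrightarrow> f \<otimes> (g \<oplus> g') = (f \<otimes> g) \<oplus> (f \<otimes> g')"
    and tensor_scale_left: "f \<in> hom C a b \<Longrightarrow> g \<in> hom C c d
          \<Longrightarrow> (r \<odot> f) \<otimes> g = r \<odot> (f \<otimes> g)"
    and tensor_scale_right: "f \<in> hom C a b \<Longrightarrow> g \<in> hom C c d
          \<Longrightarrow> f \<otimes> (r \<odot> g) = r \<odot> (f \<otimes> g)"

locale linear_monoidal_functor =
  C: linear_monoidal_category C + D: linear_monoidal_category D
  for C :: "('o, 'm, 'k::field) lin_mon_cat" and D :: "('p, 'n, 'k) lin_mon_cat" +
  fixes Fo :: "'o \<Rightarrow> 'p" and Fm :: "'m \<Rightarrow> 'n"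
  assumes Fo_obj: "a \<in> obj C \<Longrightarrow> Fo a \<in> obj D"
    and Fm_hom: "f \<in> hom C a b \<Longrightarrow> Fm f \<in> hom D (Fo a) (Fo b)"
    and Fm_ident: "a \<in> obj C \<Longrightarrow> Fm (ident C a) = ident D (Fo a)"
    and Fm_comp: "f \<in> hom C a b \<Longrightarrow> g \<in> hom C b c \<Longrightarrow> Fm (g \<cdot>\<^bsub>C\<^esub> f) = Fm g \<cdot>\<^bsub>D\<^esub> Fm f"
    and Fm_add: "f \<in> hom C a b \<Longrightarrow> g \<in> hom C a b \<Longrightarrow> Fm (f \<oplus>\<^bsub>C\<^esub> g) = Fm f \<oplus>\<^bsub>D\<^esub> Fm g"
    and Fm_scale: "f \<in> hom C a b \<Longrightarrow> Fm (r \<odot>\<^bsub>C\<^esub> f) = r \<odot>\<^bsub>D\<^esub> Fm f"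
    and Fo_unit: "Fo (unit_obj C) = unit_obj D"
    and Fo_tensor: "a \<in> obj C \<Longrightarrow> b \<in> obj C \<Longrightarrow> Fo (a \<boxtimes>\<^bsub>C\<^esub> b) = Fo a \<boxtimes>\<^bsub>D\<^esub> Fo b"
    and Fm_tensor: "f \<in> hom C a b \<Longrightarrow> g \<in> hom C c d \<Longrightarrow> Fm (f \<otimes>\<^bsub>C\<^esub> g) = Fm f \<otimes>\<^bsub>D\<^esub> Fm g"

locale linear_monoidal_isomorphism = linear_monoidal_functor C D Fo Fm
  for C :: "('o, 'm, 'k::field) lin_mon_cat" and D :: "('p, 'n, 'k) lin_mon_cat"
    and Fo :: "'o \<Rightarrow> 'p" and Fm :: "'m \<Rightarrow> 'n" +
  assumes Fo_bij: "bij_betw Fo (obj C) (obj D)"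
    and Fm_bij: "a \<in> obj C \<Longrightarrow> b \<in> obj C \<Longrightarrow> bij_betw Fm (hom C a b) (hom D (Fo a) (Fo b))"


section \<open>Linear monoidal categories given by generators and relations\<close>

text \<open>Objects are words in the generating objects \<open>'x\<close>; a generating morphism \<open>g\<close> goes from
  \<open>\<sigma> g\<close> to \<open>\<tau> g\<close>.\<close>

datatype (dead 'x, dead 'g, dead 'k) mterm =
    Gen 'g
  | Ide "'x list"
  | Comp "('x, 'g, 'k) mterm" "('x, 'g, 'k) mterm" (infixl "\<bullet>" 70)
  | Tens "('x, 'g, 'k) mterm" "('x, 'g, 'k) mterm" (infixl "\<boxdot>" 75)
  | ZeroT "'x list" "'x list"
  | AddT "('x, 'g, 'k) mterm" "('x, 'g, 'k) mterm" (infixl "\<boxplus>" 65)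
  | ScaleT 'k "('x, 'g, 'k) mterm"

abbreviation SubT :: "('x, 'g, 'k::field) mterm \<Rightarrow> ('x, 'g, 'k) mterm \<Rightarrow> ('x, 'g, 'k) mterm"
    (infixl "\<boxminus>" 65) where
  "s \<boxminus> t \<equiv> s \<boxplus> ScaleT (- 1) t"

fun msrc :: "('g \<Rightarrow> 'x list) \<Rightarrow> ('x, 'g, 'k) mterm \<Rightarrow> 'x list" where
  "msrc \<sigma> (Gen g) = \<sigma> g"
| "msrc \<sigma> (Ide a) = a"
| "msrc \<sigma> (s \<bullet> t) = msrc \<sigma> t"
| "msrc \<sigma> (s \<boxdot> t) = msrc \<sigma> s @ msrc \<sigma> t"
| "msrc \<sigma> (ZeroT a b) = a"
| "msrc \<sigma> (s \<boxplus> t) = msrc \<sigma> s"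
| "msrc \<sigma> (ScaleT r t) = msrc \<sigma> t"

fun mtgt :: "('g \<Rightarrow> 'x list) \<Rightarrow> ('x, 'g, 'k) mterm \<Rightarrow> 'x list" where
  "mtgt \<tau> (Gen g) = \<tau> g"
| "mtgt \<tau> (Ide a) = a"
| "mtgt \<tau> (s \<bullet> t) = mtgt \<tau> s"
| "mtgt \<tau> (s \<boxdot> t) = mtgt \<tau> s @ mtgt \<tau> t"
| "mtgt \<tau> (ZeroT a b) = b"
| "mtgt \<tau> (s \<boxplus> t) = mtgt \<tau> s"
| "mtgt \<tau> (ScaleT r t) = mtgt \<tau> t"

fun well_typed :: "('g \<Rightarrow> 'x list) \<Rightarrow> ('g \<Rightarrow> 'x list) \<Rightarrow> ('x, 'g, 'k) mterm \<Rightarrow> bool" where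
  "well_typed \<sigma> \<tau> (s \<bullet> t) \<longleftrightarrow> well_typed \<sigma> \<tau> s \<and> well_typed \<sigma> \<tau> t \<and> msrc \<sigma> s = mtgt \<tau> t"
| "well_typed \<sigma> \<tau> (s \<boxdot> t) \<longleftrightarrow> well_typed \<sigma> \<tau> s \<and> well_typed \<sigma> \<tau> t"
| "well_typed \<sigma> \<tau> (s \<boxplus> t) \<longleftrightarrow> well_typed \<sigma> \<tau> s \<and> well_typed \<sigma> \<tau> t
      \<and> msrc \<sigma> s = msrc \<sigma> t \<and> mtgt \<tau> s = mtgt \<tau> t"
| "well_typed \<sigma> \<tau> (ScaleT r t) \<longleftrightarrow> well_typed \<sigma> \<tau> t"
| "well_typed \<sigma> \<tau> _ \<longleftrightarrow> True"

definition has_type ::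
    "('g \<Rightarrow> 'x list) \<Rightarrow> ('g \<Rightarrow> 'x list) \<Rightarrow> ('x, 'g, 'k) mterm \<Rightarrow> 'x list \<Rightarrow> 'x list \<Rightarrow> bool" where
  "has_type \<sigma> \<tau> t a b \<longleftrightarrow> well_typed \<sigma> \<tau> t \<and> msrc \<sigma> t = a \<and> mtgt \<tau> t = b"

text \<open>The congruence on terms \<open>a \<rightarrow> b\<close> generated by the relations \<open>R\<close> and the axioms of a strict
  linear monoidal category.\<close>

inductive term_eq ::
    "('g \<Rightarrow> 'x list) \<Rightarrow> ('g \<Rightarrow> 'x list) \<Rightarrow> (('x, 'g, 'k::field) mterm \<times> ('x, 'g, 'k) mterm) set
      \<Rightarrow> 'x list \<Rightarrow> 'x list \<Rightarrow> ('x, 'g, 'k) mterm \<Rightarrow> ('x, 'g, 'k) mterm \<Rightarrow> bool"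
  for \<sigma> \<tau> R where
  rel: "(s, t) \<in> R \<Longrightarrow> has_type \<sigma> \<tau> s a b \<Longrightarrow> has_type \<sigma> \<tau> t a b \<Longrightarrow> term_eq \<sigma> \<tau> R a b s t"
| refl: "has_type \<sigma> \<tau> t a b \<Longrightarrow> term_eq \<sigma> \<tau> R a b t t"
| sym: "term_eq \<sigma> \<tau> R a b s t \<Longrightarrow> term_eq \<sigma> \<tau> R a b t s"
| trans: "term_eq \<sigma> \<tau> R a b s t \<Longrightarrow> term_eq \<sigma> \<tau> R a b t u \<Longrightarrow> term_eq \<sigma> \<tau> R a b s u"
| cong_comp: "term_eq \<sigma> \<tau> R a b f f' \<Longrightarrow> term_eq \<sigma> \<tau> R b c g g' \<Longrightarrow> term_eq \<sigma> \<tau> R a c (g \<bullet> f) (g' \<bullet> f')"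
| cong_tens: "term_eq \<sigma> \<tau> R a b f f' \<Longrightarrow> term_eq \<sigma> \<tau> R c d g g'
    \<Longrightarrow> term_eq \<sigma> \<tau> R (a @ c) (b @ d) (f \<boxdot> g) (f' \<boxdot> g')"
| cong_add: "term_eq \<sigma> \<tau> R a b f f' \<Longrightarrow> term_eq \<sigma> \<tau> R a b g g' \<Longrightarrow> term_eq \<sigma> \<tau> R a b (f \<boxplus> g) (f' \<boxplus> g')"
| cong_scale: "term_eq \<sigma> \<tau> R a b f f' \<Longrightarrow> term_eq \<sigma> \<tau> R a b (ScaleT r f) (ScaleT r f')"
| comp_ide_left: "has_type \<sigma> \<tau> f a b \<Longrightarrow> term_eq \<sigma> \<tau> R a b (Ide b \<bullet> f) f"
| comp_ide_right: "has_type \<sigma> \<tau> f a b \<Longrightarrow> term_eq \<sigma> \<tau> R a b (f \<bullet> Ide a) f"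
| comp_assoc: "has_type \<sigma> \<tau> f a b \<Longrightarrow> has_type \<sigma> \<tau> g b c \<Longrightarrow> has_type \<sigma> \<tau> h c d
    \<Longrightarrow> term_eq \<sigma> \<tau> R a d ((h \<bullet> g) \<bullet> f) (h \<bullet> (g \<bullet> f))"
| add_assoc: "has_type \<sigma> \<tau> f a b \<Longrightarrow> has_type \<sigma> \<tau> g a b \<Longrightarrow> has_type \<sigma> \<tau> h a b
    \<Longrightarrow> term_eq \<sigma> \<tau> R a b ((f \<boxplus> g) \<boxplus> h) (f \<boxplus> (g \<boxplus> h))"
| add_commute: "has_type \<sigma> \<tau> f a b \<Longrightarrow> has_type \<sigma> \<tau> g a b \<Longrightarrow> term_eq \<sigma> \<tau> R a b (f \<boxplus> g) (g \<boxplus> f)"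
| add_zero: "has_type \<sigma> \<tau> f a b \<Longrightarrow> term_eq \<sigma> \<tau> R a b (f \<boxplus> ZeroT a b) f"
| add_inverse: "has_type \<sigma> \<tau> f a b \<Longrightarrow> term_eq \<sigma> \<tau> R a b (f \<boxminus> f) (ZeroT a b)"
| scale_one: "has_type \<sigma> \<tau> f a b \<Longrightarrow> term_eq \<sigma> \<tau> R a b (ScaleT 1 f) f"
| scale_scale: "has_type \<sigma> \<tau> f a b \<Longrightarrow> term_eq \<sigma> \<tau> R a b (ScaleT r (ScaleT r' f)) (ScaleT (r * r') f)"
| scale_add_left: "has_type \<sigma> \<tau> f a b
    \<Longrightarrow> term_eq \<sigma> \<tau> R a b (ScaleT (r + r') f) (ScaleT r f \<boxplus> ScaleT r' f)"
| scale_add_right: "has_type \<sigma> \<tau> f a b \<Longrightarrow> has_type \<sigma> \<tau> g a b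
    \<Longrightarrow> term_eq \<sigma> \<tau> R a b (ScaleT r (f \<boxplus> g)) (ScaleT r f \<boxplus> ScaleT r g)"
| comp_add_left: "has_type \<sigma> \<tau> f a b \<Longrightarrow> has_type \<sigma> \<tau> g b c \<Longrightarrow> has_type \<sigma> \<tau> g' b c
    \<Longrightarrow> term_eq \<sigma> \<tau> R a c ((g \<boxplus> g') \<bullet> f) ((g \<bullet> f) \<boxplus> (g' \<bullet> f))"
| comp_add_right: "has_type \<sigma> \<tau> f a b \<Longrightarrow> has_type \<sigma> \<tau> f' a b \<Longrightarrow> has_type \<sigma> \<tau> g b c
    \<Longrightarrow> term_eq \<sigma> \<tau> R a c (g \<bullet> (f \<boxplus> f')) ((g \<bullet> f) \<boxplus> (g \<bullet> f'))"
| comp_scale_left: "has_type \<sigma> \<tau> f a b \<Longrightarrow> has_type \<sigma> \<tau> g b c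
    \<Longrightarrow> term_eq \<sigma> \<tau> R a c (ScaleT r g \<bullet> f) (ScaleT r (g \<bullet> f))"
| comp_scale_right: "has_type \<sigma> \<tau> f a b \<Longrightarrow> has_type \<sigma> \<tau> g b c
    \<Longrightarrow> term_eq \<sigma> \<tau> R a c (g \<bullet> ScaleT r f) (ScaleT r (g \<bullet> f))"
| tens_ide: "term_eq \<sigma> \<tau> R (a @ b) (a @ b) (Ide a \<boxdot> Ide b) (Ide (a @ b))"
| interchange: "has_type \<sigma> \<tau> f a b \<Longrightarrow> has_type \<sigma> \<tau> g b c
    \<Longrightarrow> has_type \<sigma> \<tau> f' a' b' \<Longrightarrow> has_type \<sigma> \<tau> g' b' c'
    \<Longrightarrow> term_eq \<sigma> \<tau> R (a @ a') (c @ c') ((g \<bullet> f) \<boxdot> (g' \<bullet> f')) ((g \<boxdot> g') \<bullet> (f \<boxdot> f'))"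
| tens_assoc: "has_type \<sigma> \<tau> f a b \<Longrightarrow> has_type \<sigma> \<tau> g c d \<Longrightarrow> has_type \<sigma> \<tau> h a' b'
    \<Longrightarrow> term_eq \<sigma> \<tau> R (a @ c @ a') (b @ d @ b') ((f \<boxdot> g) \<boxdot> h) (f \<boxdot> (g \<boxdot> h))"
| tens_unit_left: "has_type \<sigma> \<tau> f a b \<Longrightarrow> term_eq \<sigma> \<tau> R a b (Ide [] \<boxdot> f) f"
| tens_unit_right: "has_type \<sigma> \<tau> f a b \<Longrightarrow> term_eq \<sigma> \<tau> R a b (f \<boxdot> Ide []) f"
| tens_add_left: "has_type \<sigma> \<tau> f a b \<Longrightarrow> has_type \<sigma> \<tau> f' a b \<Longrightarrow> has_type \<sigma> \<tau> g c d
    \<Longrightarrow> term_eq \<sigma> \<tau> R (a @ c) (b @ d) ((f \<boxplus> f') \<boxdot> g) ((f \<boxdot> g) \<boxplus> (f' \<boxdot> g))"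
| tens_add_right: "has_type \<sigma> \<tau> f a b \<Longrightarrow> has_type \<sigma> \<tau> g c d \<Longrightarrow> has_type \<sigma> \<tau> g' c d
    \<Longrightarrow> term_eq \<sigma> \<tau> R (a @ c) (b @ d) (f \<boxdot> (g \<boxplus> g')) ((f \<boxdot> g) \<boxplus> (f \<boxdot> g'))"
| tens_scale_left: "has_type \<sigma> \<tau> f a b \<Longrightarrow> has_type \<sigma> \<tau> g c d
    \<Longrightarrow> term_eq \<sigma> \<tau> R (a @ c) (b @ d) (ScaleT r f \<boxdot> g) (ScaleT r (f \<boxdot> g))"
| tens_scale_right: "has_type \<sigma> \<tau> f a b \<Longrightarrow> has_type \<sigma> \<tau> g c d
    \<Longrightarrow> term_eq \<sigma> \<tau> R (a @ c) (b @ d) (f \<boxdot> ScaleT r g) (ScaleT r (f \<boxdot> g))"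

definition term_class ::
    "('g \<Rightarrow> 'x list) \<Rightarrow> ('g \<Rightarrow> 'x list) \<Rightarrow> (('x, 'g, 'k::field) mterm \<times> ('x, 'g, 'k) mterm) set
      \<Rightarrow> ('x, 'g, 'k) mterm \<Rightarrow> ('x, 'g, 'k) mterm set" where
  "term_class \<sigma> \<tau> R s = {t. \<exists>a b. term_eq \<sigma> \<tau> R a b s t}"

definition presented_category ::
    "('g \<Rightarrow> 'x list) \<Rightarrow> ('g \<Rightarrow> 'x list) \<Rightarrow> (('x, 'g, 'k::field) mterm \<times> ('x, 'g, 'k) mterm) set
      \<Rightarrow> ('x list, ('x, 'g, 'k) mterm set, 'k) lin_mon_cat" where
  "presented_category \<sigma> \<tau> R =
    \<lparr> obj = UNIV,
      hom = (\<lambda>a b. term_class \<sigma> \<tau> R ` {t. has_type \<sigma> \<tau> t a b}),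
      ident = (\<lambda>a. term_class \<sigma> \<tau> R (Ide a)),
      compose = (\<lambda>X Y. \<Union>g\<in>X. \<Union>f\<in>Y. term_class \<sigma> \<tau> R (g \<bullet> f)),
      zero_mor = (\<lambda>a b. term_class \<sigma> \<tau> R (ZeroT a b)),
      add_mor = (\<lambda>X Y. \<Union>f\<in>X. \<Union>g\<in>Y. term_class \<sigma> \<tau> R (f \<boxplus> g)),
      scale_mor = (\<lambda>r X. \<Union>f\<in>X. term_class \<sigma> \<tau> R (ScaleT r f)),
      unit_obj = [],
      tensor_obj = (@),
      tensor_mor = (\<lambda>X Y. \<Union>f\<in>X. \<Union>g\<in>Y. term_class \<sigma> \<tau> R (f \<boxdot> g)) \<rparr>"

text \<open>Vertical reflection, induced by an involution \<open>\<rho>\<close> of the generating morphisms.\<close>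

primrec mirror :: "('g \<Rightarrow> 'g) \<Rightarrow> ('x, 'g, 'k) mterm \<Rightarrow> ('x, 'g, 'k) mterm" where
  "mirror \<rho> (Gen g) = Gen (\<rho> g)"
| "mirror \<rho> (Ide a) = Ide a"
| "mirror \<rho> (s \<bullet> t) = mirror \<rho> t \<bullet> mirror \<rho> s"
| "mirror \<rho> (s \<boxdot> t) = mirror \<rho> s \<boxdot> mirror \<rho> t"
| "mirror \<rho> (ZeroT a b) = ZeroT b a"
| "mirror \<rho> (s \<boxplus> t) = mirror \<rho> s \<boxplus> mirror \<rho> t"
| "mirror \<rho> (ScaleT r t) = ScaleT r (mirror \<rho> t)"


section \<open>The presentation\<close>

datatype fund = B1 | B2

datatype sp4_gen = Gc1 | Gc2 | Gm | Gt | Gb21 | Gd | Gu1 | Gu2 | Gs | Gtb | Gb12 | Gdb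

fun gsrc :: "sp4_gen \<Rightarrow> fund list" where
  "gsrc Gc1 = [B1, B1]" | "gsrc Gc2 = [B2, B2]" | "gsrc Gm = [B1, B1]"
| "gsrc Gt = [B1, B2]" | "gsrc Gb21 = [B2, B1]" | "gsrc Gd = [B2, B2]"
| "gsrc Gu1 = []" | "gsrc Gu2 = []" | "gsrc Gs = [B2]"
| "gsrc Gtb = [B1]" | "gsrc Gb12 = [B1, B2]" | "gsrc Gdb = [B1, B1]"

fun gtgt :: "sp4_gen \<Rightarrow> fund list" where
  "gtgt Gc1 = []" | "gtgt Gc2 = []" | "gtgt Gm = [B2]"
| "gtgt Gt = [B1]" | "gtgt Gb21 = [B1, B2]" | "gtgt Gd = [B1, B1]"
| "gtgt Gu1 = [B1, B1]" | "gtgt Gu2 = [B2, B2]" | "gtgt Gs = [B1, B1]"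
| "gtgt Gtb = [B1, B2]" | "gtgt Gb12 = [B2, B1]" | "gtgt Gdb = [B2, B2]"

fun greflect :: "sp4_gen \<Rightarrow> sp4_gen" where
  "greflect Gc1 = Gu1" | "greflect Gu1 = Gc1" | "greflect Gc2 = Gu2" | "greflect Gu2 = Gc2"
| "greflect Gm = Gs" | "greflect Gs = Gm" | "greflect Gt = Gtb" | "greflect Gtb = Gt"
| "greflect Gb21 = Gb12" | "greflect Gb12 = Gb21" | "greflect Gd = Gdb" | "greflect Gdb = Gd"

type_synonym 'k sp4_term = "(fund, sp4_gen, 'k) mterm"

abbreviation gc1 :: "'k sp4_term" where "gc1 \<equiv> Gen Gc1"
abbreviation gc2 :: "'k sp4_term" where "gc2 \<equiv> Gen Gc2"
abbreviation gm :: "'k sp4_term" where "gm \<equiv> Gen Gm"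
abbreviation gt :: "'k sp4_term" where "gt \<equiv> Gen Gt"
abbreviation gb21 :: "'k sp4_term" where "gb21 \<equiv> Gen Gb21"
abbreviation gd :: "'k sp4_term" where "gd \<equiv> Gen Gd"
abbreviation gu1 :: "'k sp4_term" where "gu1 \<equiv> Gen Gu1"
abbreviation gu2 :: "'k sp4_term" where "gu2 \<equiv> Gen Gu2"
abbreviation gs :: "'k sp4_term" where "gs \<equiv> Gen Gs"
abbreviation gtb :: "'k sp4_term" where "gtb \<equiv> Gen Gtb"
abbreviation gb12 :: "'k sp4_term" where "gb12 \<equiv> Gen Gb12"
abbreviation gdb :: "'k sp4_term" where "gdb \<equiv> Gen Gdb"
abbreviation gq :: "'k sp4_term" where "gq \<equiv> gt \<bullet> gb21"
abbreviation gqb :: "'k sp4_term" where "gqb \<equiv> gb12 \<bullet> gtb"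
abbreviation i1 :: "'k sp4_term" where "i1 \<equiv> Ide [B1]"
abbreviation i2 :: "'k sp4_term" where "i2 \<equiv> Ide [B2]"

abbreviation relation :: "'k sp4_term \<Rightarrow> 'k sp4_term \<Rightarrow> 'k sp4_term \<times> 'k sp4_term"
    (infix "\<doteq>" 50) where
  "l \<doteq> r \<equiv> (l, r)"

text \<open>The relation \<open>q = t \<beta>\<^sub>2\<^sub>1\<close> is built into the abbreviation \<open>gq\<close>; its mirror image is \<open>gqb\<close>.\<close>

definition sp4_relations :: "('k::field sp4_term \<times> 'k sp4_term) set" where
  "sp4_relations = {
    gm \<bullet> (i1 \<boxdot> gt) \<doteq> (i2 \<boxdot> gc1) \<bullet> (gb12 \<boxdot> i1) \<bullet> (i1 \<boxdot> gb12),
    gc1 \<bullet> gu1 \<doteq> Ide [],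
    gc2 \<bullet> gu2 \<doteq> Ide [],
    gm \<bullet> gs \<doteq> i2,
    gb21 \<bullet> gb12 \<doteq> Ide [B1, B2],
    gb12 \<bullet> gb21 \<doteq> Ide [B2, B1],
    (i1 \<boxdot> gt) \<bullet> (gs \<boxdot> i2) \<doteq> gu1 \<bullet> gc2,
    gu1 \<bullet> gc2 \<doteq> (gq \<boxdot> i1) \<bullet> (i2 \<boxdot> gs),
    (i1 \<boxdot> gm) \<bullet> (gs \<boxdot> i1) \<doteq> gtb \<bullet> gq,
    gd \<bullet> gdb \<doteq> (i1 \<boxdot> i1) \<boxminus> gu1 \<bullet> gc1 \<boxminus> gs \<bullet> gm,
    (i1 \<boxdot> gc1) \<bullet> (gs \<boxdot> i1) \<doteq> ZeroT [B2, B1] [B1],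
    (i1 \<boxdot> gc2) \<bullet> (gtb \<boxdot> i2) \<doteq> ZeroT [B1, B2] [B1],
    (gc1 \<boxdot> i1) \<bullet> (i1 \<boxdot> gs) \<doteq> ZeroT [B1, B2] [B1],
    (gc2 \<boxdot> i1) \<bullet> (i2 \<boxdot> gqb) \<doteq> ZeroT [B2, B1] [B1],
    (i2 \<boxdot> gc2) \<bullet> (gu2 \<boxdot> i2) \<doteq> ZeroT [B2] [B2],
    (i1 \<boxdot> gc1) \<bullet> (gu1 \<boxdot> i1) \<doteq> ZeroT [B1] [B1],
    (i2 \<boxdot> gc2) \<bullet> (gdb \<boxdot> i2) \<doteq> ZeroT [B1, B1, B2] [B2],
    (gc2 \<boxdot> i2) \<bullet> (i2 \<boxdot> gdb) \<doteq> ZeroT [B2, B1, B1] [B2],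
    (i2 \<boxdot> gq) \<bullet> (gdb \<boxdot> i1) \<doteq> gqb \<boxdot> gc1,
    (gt \<boxdot> i2) \<bullet> (i1 \<boxdot> gdb) \<doteq> gc1 \<boxdot> gtb,
    gc1 \<bullet> gs \<doteq> ZeroT [B2] [],
    gc1 \<bullet> gd \<doteq> ZeroT [B2, B2] [],
    gd \<bullet> gu2 \<doteq> ZeroT [] [B1, B1],
    (gt \<boxdot> i1) \<bullet> (i1 \<boxdot> gb12)
      \<doteq> gu1 \<bullet> gc2 \<bullet> (gm \<boxdot> i2) \<boxplus> gd \<bullet> (gm \<boxdot> i2) \<boxplus> gc1 \<boxdot> gs,
    (gm \<boxdot> i2) \<bullet> (i1 \<boxdot> gb21)
      \<doteq> (i2 \<boxdot> gm) \<bullet> (gb12 \<boxdot> i1) \<boxminus> gdb \<bullet> (i1 \<boxdot> gq) \<boxplus> gdb \<bullet> (gt \<boxdot> i1),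
    (gc1 \<boxdot> i2) \<bullet> (i1 \<boxdot> gb21) \<doteq> gm \<bullet> (gt \<boxdot> i1),
    gm \<bullet> (i1 \<boxdot> gq) \<doteq> (i2 \<boxdot> gc1) \<bullet> (gb12 \<boxdot> i1),
    (gc2 \<boxdot> i1) \<bullet> (i2 \<boxdot> gb12) \<doteq> gt \<bullet> (gq \<boxdot> i2),
    (gd \<boxdot> i1) \<bullet> (i2 \<boxdot> gb12)
      \<doteq> (i1 \<boxdot> (gu1 \<bullet> gc2)) \<bullet> (gb21 \<boxdot> i2)
        \<boxplus> (gs \<boxdot> i1) \<bullet> gqb \<bullet> (i1 \<boxdot> gc2) \<bullet> (gb21 \<boxdot> i2)
        \<boxminus> gs \<boxdot> gt
        \<boxplus> (i1 \<boxdot> gd) \<bullet> (gb21 \<boxdot> i2)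
        \<boxplus> gq \<boxdot> gs
        \<boxminus> (gs \<boxdot> i1) \<bullet> gqb \<bullet> gt \<bullet> (gq \<boxdot> i2)
        \<boxminus> gu1 \<boxdot> (gt \<bullet> (gq \<boxdot> i2)),
    (gq \<boxdot> i2) \<bullet> (i2 \<boxdot> gb21) \<doteq> gc2 \<boxdot> gtb \<boxplus> (i1 \<boxdot> gm) \<bullet> (gd \<boxdot> i1),
    (i1 \<boxdot> gc2) \<bullet> (gb21 \<boxdot> i2) \<bullet> (i2 \<boxdot> gb21) \<doteq> (i1 \<boxdot> gc1) \<bullet> (gd \<boxdot> i1),
    (i2 \<boxdot> gm) \<bullet> (gb12 \<boxdot> i1) \<bullet> (i1 \<boxdot> gb12)
      \<doteq> gdb \<bullet> (i1 \<boxdot> gt) \<boxplus> gm \<boxdot> i2 \<boxminus> gdb \<bullet> gd \<bullet> (gm \<boxdot> i2),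
    (i1 \<boxdot> gd) \<bullet> (gb21 \<boxdot> i2) \<bullet> (i2 \<boxdot> gb21)
      \<doteq> (gu1 \<bullet> gc2) \<boxdot> i1
        \<boxplus> gd \<boxdot> i1
        \<boxminus> (i1 \<boxdot> (gs \<bullet> gm)) \<bullet> (gd \<boxdot> i1)
        \<boxplus> gs \<boxdot> gq
        \<boxminus> (i1 \<boxdot> (gu1 \<bullet> gc1)) \<bullet> (gd \<boxdot> i1)
        \<boxminus> (gs \<boxdot> i1) \<bullet> gqb \<bullet> (i1 \<boxdot> gc1) \<bullet> (gd \<boxdot> i1),
    gt \<bullet> (i1 \<boxdot> gm) \<doteq> gq \<bullet> (gm \<boxdot> i1),
    gc1 \<bullet> (i1 \<boxdot> gt) \<doteq> gc2 \<bullet> (gm \<boxdot> i2),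
    gc1 \<bullet> (i1 \<boxdot> gq) \<doteq> gc1 \<bullet> (gt \<boxdot> i1),
    gc2 \<bullet> (i2 \<boxdot> gm) \<doteq> gc1 \<bullet> (gq \<boxdot> i1),
    gd \<bullet> (i2 \<boxdot> gm)
      \<doteq> (i1 \<boxdot> gq) \<bullet> (gb21 \<boxdot> i1) \<boxminus> gs \<boxdot> gc1 \<boxminus> gu1 \<bullet> gc1 \<bullet> (gq \<boxdot> i1),
    (gc1 \<boxdot> i1) \<bullet> (i1 \<boxdot> gd) \<doteq> gt \<bullet> (gt \<boxdot> i2),
    (gm \<boxdot> i1) \<bullet> (i1 \<boxdot> gd) \<doteq> (i2 \<boxdot> gt) \<bullet> (gb12 \<boxdot> i2) \<boxminus> gqb \<boxdot> gc2,
    (gq \<boxdot> i1) \<bullet> (i2 \<boxdot> gd) \<doteq> (i1 \<boxdot> gt) \<bullet> (gd \<boxdot> i2),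
    (i1 \<boxdot> gq) \<bullet> (gb21 \<boxdot> i1) \<bullet> (i2 \<boxdot> gs) \<doteq> gd \<boxplus> gu1 \<bullet> gc2,
    (i1 \<boxdot> gq) \<bullet> (gb21 \<boxdot> i1) \<bullet> (i2 \<boxdot> gd) \<doteq> ZeroT [B2, B2, B2] [B1, B1],
    (i2 \<boxdot> gt) \<bullet> (gb12 \<boxdot> i2) \<bullet> (i1 \<boxdot> gdb) \<doteq> gm \<boxdot> i1 \<boxminus> gqb \<bullet> gq \<bullet> (gm \<boxdot> i1)
  }"

definition sp4_all_relations :: "('k::field sp4_term \<times> 'k sp4_term) set" where
  "sp4_all_relations = sp4_relations \<union> map_prod (mirror greflect) (mirror greflect) ` sp4_relations"

text \<open>No relation is discarded by the typing conditions of \<open>term_eq\<close>.\<close>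

lemma sp4_all_relations_typed:
  "\<forall>(l, r) \<in> sp4_all_relations. \<exists>a b. has_type gsrc gtgt l a b \<and> has_type gsrc gtgt r a b"
  by (simp add: sp4_all_relations_def sp4_relations_def has_type_def)

definition sp4_category :: "(fund list, 'k::field sp4_term set, 'k) lin_mon_cat" where
  "sp4_category = presented_category gsrc gtgt sp4_all_relations"

definition sp4_class :: "'k::field sp4_term \<Rightarrow> 'k sp4_term set" where
  "sp4_class = term_class gsrc gtgt sp4_all_relations"


section \<open>Crystals\<close>

text \<open>The simple root \<open>\<alpha>\<^sub>1\<close> is short and \<open>\<alpha>\<^sub>2\<close> is long. Weights are written in the basis of
  fundamental weights, so \<open>\<alpha>\<^sub>1 = (2, -1)\<close> and \<open>\<alpha>\<^sub>2 = (-2, 2)\<close>. The element \<open>0\<close> adjoined to a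
  crystal is \<open>None\<close>.\<close>

datatype node = N1 | N2

record 'b crystal =
  elts :: "'b set"
  wt :: "'b \<Rightarrow> int \<times> int"
  raise :: "node \<Rightarrow> 'b \<Rightarrow> 'b option"
  lower :: "node \<Rightarrow> 'b \<Rightarrow> 'b option"

definition eps :: "'b crystal \<Rightarrow> node \<Rightarrow> 'b \<Rightarrow> nat" where
  "eps B i b = Max {n. ((\<lambda>x. Option.bind x (raise B i)) ^^ n) (Some b) \<noteq> None}"

definition phi :: "'b crystal \<Rightarrow> node \<Rightarrow> 'b \<Rightarrow> nat" where
  "phi B i b = Max {n. ((\<lambda>x. Option.bind x (lower B i)) ^^ n) (Some b) \<noteq> None}"

definition tensor_crystal :: "'b crystal \<Rightarrow> 'c crystal \<Rightarrow> ('b \<times> 'c) crystal" where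
  "tensor_crystal B C =
    \<lparr> elts = elts B \<times> elts C,
      wt = (\<lambda>(b, c). wt B b + wt C c),
      raise = (\<lambda>i (b, c). if phi B i b \<ge> eps C i c then map_option (\<lambda>b'. (b', c)) (raise B i b)
                          else map_option (\<lambda>c'. (b, c')) (raise C i c)),
      lower = (\<lambda>i (b, c). if phi B i b > eps C i c then map_option (\<lambda>b'. (b', c)) (lower B i b)
                          else map_option (\<lambda>c'. (b, c')) (lower C i c)) \<rparr>"

definition strict_morphism :: "'b crystal \<Rightarrow> 'c crystal \<Rightarrow> ('b \<Rightarrow> 'c option) \<Rightarrow> bool" where
  "strict_morphism B C \<psi> \<longleftrightarrow>
    (\<forall>b \<in> elts B. \<forall>c. \<psi> b = Some c \<longrightarrow> c \<in> elts C \<and> wt C c = wt B b) \<and>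
    (\<forall>b \<in> elts B. \<forall>i. Option.bind (raise B i b) \<psi> = Option.bind (\<psi> b) (raise C i)) \<and>
    (\<forall>b \<in> elts B. \<forall>i. Option.bind (lower B i b) \<psi> = Option.bind (\<psi> b) (lower C i))"

definition crystal_iso :: "'b crystal \<Rightarrow> 'c crystal \<Rightarrow> ('b \<Rightarrow> 'c) \<Rightarrow> bool" where
  "crystal_iso B C g \<longleftrightarrow> bij_betw g (elts B) (elts C) \<and> strict_morphism B C (\<lambda>b. Some (g b))"

definition crystal_edges :: "'b crystal \<Rightarrow> ('b \<times> 'b) set" where
  "crystal_edges B = {(b, c). b \<in> elts B \<and> c \<in> elts B \<and> (\<exists>i. lower B i b = Some c)}"

definition component :: "'b crystal \<Rightarrow> 'b \<Rightarrow> 'b set" where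
  "component B b = (crystal_edges B \<union> (crystal_edges B)\<inverse>)\<^sup>* `` {b}"

abbreviation subcrystal :: "'b crystal \<Rightarrow> 'b set \<Rightarrow> 'b crystal" where
  "subcrystal B K \<equiv> B\<lparr>elts := K\<rparr>"

text \<open>\<open>\<psi>\<close> sends the component of \<open>B\<close> isomorphic to \<open>X\<close> isomorphically onto the union of components
  \<open>L\<close> of \<open>C\<close>, and the other components of \<open>B\<close> to zero.\<close>

definition component_morphism ::
    "'b crystal \<Rightarrow> 'x crystal \<Rightarrow> 'c crystal \<Rightarrow> 'c set \<Rightarrow> ('b \<Rightarrow> 'c option) \<Rightarrow> bool" where
  "component_morphism B X C L \<psi> \<longleftrightarrow>
    strict_morphism B C \<psi> \<and>
    (\<exists>K \<in> component B ` elts B.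
      (\<exists>h. crystal_iso (subcrystal B K) X h) \<and>
      (\<exists>g. crystal_iso (subcrystal B K) (subcrystal C L) g \<and> (\<forall>b \<in> K. \<psi> b = Some (g b))) \<and>
      (\<forall>b \<in> elts B - K. \<psi> b = None))"


section \<open>Tensor words in the fundamental crystals\<close>

text \<open>\<open>B1\<close> is the crystal \<open>x1 \<rightarrow>\<^sub>1 x2 \<rightarrow>\<^sub>2 x3 \<rightarrow>\<^sub>1 x4\<close> and \<open>B2\<close> is the crystal
  \<open>y1 \<rightarrow>\<^sub>2 y2 \<rightarrow>\<^sub>1 y3 \<rightarrow>\<^sub>1 y4 \<rightarrow>\<^sub>2 y5\<close>.\<close>

datatype letter = X1 | X2 | X3 | X4 | Y1 | Y2 | Y3 | Y4 | Y5

fun letter_wt :: "letter \<Rightarrow> int \<times> int" where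
  "letter_wt X1 = (1, 0)" | "letter_wt X2 = (-1, 1)"
| "letter_wt X3 = (1, -1)" | "letter_wt X4 = (-1, 0)"
| "letter_wt Y1 = (0, 1)" | "letter_wt Y2 = (2, -1)" | "letter_wt Y3 = (0, 0)"
| "letter_wt Y4 = (-2, 1)" | "letter_wt Y5 = (0, -1)"

fun letter_lower :: "node \<Rightarrow> letter \<Rightarrow> letter option" where
  "letter_lower N1 X1 = Some X2" | "letter_lower N2 X2 = Some X3" | "letter_lower N1 X3 = Some X4"
| "letter_lower N2 Y1 = Some Y2" | "letter_lower N1 Y2 = Some Y3"
| "letter_lower N1 Y3 = Some Y4" | "letter_lower N2 Y4 = Some Y5"
| "letter_lower _ _ = None"

fun letter_raise :: "node \<Rightarrow> letter \<Rightarrow> letter option" where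
  "letter_raise N1 X2 = Some X1" | "letter_raise N2 X3 = Some X2" | "letter_raise N1 X4 = Some X3"
| "letter_raise N2 Y2 = Some Y1" | "letter_raise N1 Y3 = Some Y2"
| "letter_raise N1 Y4 = Some Y3" | "letter_raise N2 Y5 = Some Y4"
| "letter_raise _ _ = None"

definition fund_crystal :: "fund \<Rightarrow> letter crystal" where
  "fund_crystal x =
    \<lparr> elts = (case x of B1 \<Rightarrow> {X1, X2, X3, X4} | B2 \<Rightarrow> {Y1, Y2, Y3, Y4, Y5}),
      wt = letter_wt, raise = letter_raise, lower = letter_lower \<rparr>"

text \<open>Elements of a tensor product \<open>b\<^sub>1 \<otimes> \<dots> \<otimes> b\<^sub>n\<close> are written as lists, which makes the tensor
  product strictly associative and unital.\<close>

definition cons_crystal :: "('b \<times> 'b list) crystal \<Rightarrow> 'b list crystal" where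
  "cons_crystal T =
    \<lparr> elts = (\<lambda>(b, v). b # v) ` elts T,
      wt = (\<lambda>v. wt T (hd v, tl v)),
      raise = (\<lambda>i v. map_option (\<lambda>(b, v). b # v) (raise T i (hd v, tl v))),
      lower = (\<lambda>i v. map_option (\<lambda>(b, v). b # v) (lower T i (hd v, tl v))) \<rparr>"

primrec word_crystal :: "fund list \<Rightarrow> letter list crystal" where
  "word_crystal [] =
    \<lparr> elts = {[]}, wt = (\<lambda>_. 0), raise = (\<lambda>_ _. None), lower = (\<lambda>_ _. None) \<rparr>"
| "word_crystal (x # w) = cons_crystal (tensor_crystal (fund_crystal x) (word_crystal w))"

text \<open>\<open>B(m\<omega>\<^sub>1 + n\<omega>\<^sub>2)\<close>, realised as the component of the highest weight element of
  \<open>B1\<^sup>m \<otimes> B2\<^sup>n\<close>.\<close>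

definition hw_crystal :: "nat \<Rightarrow> nat \<Rightarrow> letter list crystal" where
  "hw_crystal m n =
    (let W = word_crystal (replicate m B1 @ replicate n B2)
     in subcrystal W (component W (replicate m X1 @ replicate n Y1)))"

type_synonym 'k crystal_arrow =
  "fund list \<times> (letter list \<Rightarrow> letter list \<Rightarrow> 'k) \<times> fund list"

text \<open>A linear map between the spans of two crystals is given by its matrix: \<open>M x y\<close> is the
  coefficient of \<open>y\<close> in the image of \<open>x\<close>, and is zero unless \<open>x\<close> and \<open>y\<close> lie in the crystals.\<close>

definition morphism_matrix :: "'b crystal \<Rightarrow> ('b \<Rightarrow> 'c option) \<Rightarrow> 'b \<Rightarrow> 'c \<Rightarrow> 'k::field" where
  "morphism_matrix B \<psi> x y = (if x \<in> elts B \<and> \<psi> x = Some y then 1 else 0)"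

definition crystal_homs :: "'b crystal \<Rightarrow> 'c crystal \<Rightarrow> ('b \<Rightarrow> 'c \<Rightarrow> 'k::field) set" where
  "crystal_homs B C =
    {(\<lambda>x y. \<Sum>\<psi>\<in>S. r \<psi> * morphism_matrix B \<psi> x y) |S r. finite S \<and> (\<forall>\<psi>\<in>S. strict_morphism B C \<psi>)}"

definition crystal_arrow ::
    "fund list \<Rightarrow> fund list \<Rightarrow> (letter list \<Rightarrow> letter list option) \<Rightarrow> 'k::field crystal_arrow" where
  "crystal_arrow v w \<psi> = (v, morphism_matrix (word_crystal v) \<psi>, w)"

text \<open>The full subcategory on tensor words: a word stands for the tensor product of its letters, and
  the hom spaces are all linear combinations of strict crystal morphisms. Elements of \<open>B\<^sub>v\<close> are lists
  of length \<open>length v\<close>, so the tensor product of matrices splits an index at that position.\<close>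

definition fund_sp4_crys :: "(fund list, 'k::field crystal_arrow, 'k) lin_mon_cat" where
  "fund_sp4_crys =
    \<lparr> obj = UNIV,
      hom = (\<lambda>v w. {(v, M, w) |M. M \<in> crystal_homs (word_crystal v) (word_crystal w)}),
      ident = (\<lambda>v. crystal_arrow v v Some),
      compose = (\<lambda>(v', N, w) (u, M, v).
        (u, \<lambda>x z. \<Sum>y\<in>elts (word_crystal v). M x y * N y z, w)),
      zero_mor = (\<lambda>v w. (v, \<lambda>_ _. 0, w)),
      add_mor = (\<lambda>(v, M, w) (v', N, w'). (v, \<lambda>x y. M x y + N x y, w)),
      scale_mor = (\<lambda>r (v, M, w). (v, \<lambda>x y. r * M x y, w)),
      unit_obj = [],
      tensor_obj = (@),
      tensor_mor = (\<lambda>(v, M, w) (v', N, w').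
        (v @ v',
         \<lambda>x y. M (take (length v) x) (take (length w) y) * N (drop (length v) x) (drop (length w) y),
         w @ w')) \<rparr>"

text \<open>\<open>A\<close> is the morphism \<open>B\<^sub>v \<rightarrow> B\<^sub>w\<close> sending the component isomorphic to \<open>X\<close> onto \<open>L\<close>, respectively
  the isomorphism \<open>B\<^sub>v \<rightarrow> B\<^sub>w\<close>; existence and uniqueness are part of the assertion.\<close>

definition is_component_arrow ::
    "fund list \<Rightarrow> letter list crystal \<Rightarrow> fund list \<Rightarrow> letter list set \<Rightarrow> 'k::field crystal_arrow \<Rightarrow> bool" where
  "is_component_arrow v X w L A \<longleftrightarrow>
    (\<exists>\<psi>. component_morphism (word_crystal v) X (word_crystal w) L \<psi>) \<and>
    (\<forall>\<psi>. component_morphism (word_crystal v) X (word_crystal w) L \<psi> \<longrightarrow> A = crystal_arrow v w \<psi>)"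

definition is_unique_iso_arrow :: "fund list \<Rightarrow> fund list \<Rightarrow> 'k::field crystal_arrow \<Rightarrow> bool" where
  "is_unique_iso_arrow v w A \<longleftrightarrow>
    (\<exists>g. crystal_iso (word_crystal v) (word_crystal w) g) \<and>
    (\<forall>g. crystal_iso (word_crystal v) (word_crystal w) g \<longrightarrow> A = crystal_arrow v w (\<lambda>b. Some (g b)))"

end

theory Submission
  imports Defs
begin

text \<open>Count a letter \<open>B\<^sub>1\<close> as 2 and a letter \<open>B\<^sub>2\<close> as 3, and break ties between words by the number of inversions:
  then every generating morphism goes strictly down or strictly up. The relations rewrite a layer that
  goes up followed by one that goes down, so every morphism of the presented category is a combination of
  morphisms that first go down and then up. A sorted word \<open>B\<^sub>1\<^sup>m B\<^sub>2\<^sup>n\<close> carries an idempotent, the product of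
  the projections of its adjacent pairs to their top components; it is killed by all descents from and
  ascents to that word. Hence a morphism between two sorted words, cut down by their idempotents, is a scalar
  if the words agree and zero otherwise, and all identities lie in the ideal generated by these idempotents.
  In crystals the idempotent of a sorted word is the projection to the component of its highest weight
  element, where Schur's lemma gives the same answer; so the functor sending the generators to the crystal
  morphisms is full and faithful. Crystal morphisms are determined by their values on highest weight
  elements, so checking the relations and identifying the images of the generators are finite computations.\<close>

section \<open>Presented categories and functors out of them\<close>

text \<open>Since each identity is a sum of products through the idempotents of sorted words,
  fullness and faithfulness only have to be tested between two sorted words. There a cut-down
  morphism is one scalar, and in crystals this scalar can be read off, because the idempotent has
  entry 1 at the highest weight element. The labour lies in straightening. A layer going up and a
  layer going down can meet in two letters, in one letter on either side, or not at all, and the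
  given relations do not list all meetings. The missing ones, such as \<open>t_tb\<close>,
  \<open>m_d\<close>, \<open>c1_tb\<close> and above all \<open>d_db\<close>, are derived first, and
  vertical reflection supplies their duals. Sums and products of typed terms are only partial, which
  would burden each such calculation with typing conditions; so terms are made to act on families of
  morphisms, and the calculations take place in a ring of additive maps. On the crystal side
  reflection is transposition of matrices, which settles the reflected relations at once, and the
  others are evaluated symbolically on highest weight words over an arbitrary field.\<close>

lemma term_eq_types:
  assumes "term_eq \<sigma> \<tau> R a b s t"
  shows "has_type \<sigma> \<tau> s a b" "has_type \<sigma> \<tau> t a b"
  using assms by (induction rule: term_eq.induct) (auto simp: has_type_def)

lemma has_type_unique:
  "has_type \<sigma> \<tau> t a b \<Longrightarrow> has_type \<sigma> \<tau> t a' b' \<Longrightarrow> a = a' \<and> b = b'"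
  by (auto simp: has_type_def)

lemma term_class_typed:
  assumes "has_type \<sigma> \<tau> s a b"
  shows "term_class \<sigma> \<tau> R s = {t. term_eq \<sigma> \<tau> R a b s t}"
  using assms term_eq_types(1) has_type_unique unfolding term_class_def by blast

lemma term_class_self: "has_type \<sigma> \<tau> s a b \<Longrightarrow> s \<in> term_class \<sigma> \<tau> R s"
  by (auto simp: term_class_def intro: term_eq.refl)

lemma term_class_eqI:
  assumes "term_eq \<sigma> \<tau> R a b s t"
  shows "term_class \<sigma> \<tau> R s = term_class \<sigma> \<tau> R t"
  using assms term_eq_types[OF assms] term_class_typed
  by (auto intro: term_eq.trans term_eq.sym simp: term_class_typed)

lemma term_class_eq_iff:
  assumes "has_type \<sigma> \<tau> s a b" "has_type \<sigma> \<tau> t a b"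
  shows "term_class \<sigma> \<tau> R s = term_class \<sigma> \<tau> R t \<longleftrightarrow> term_eq \<sigma> \<tau> R a b s t"
  using assms term_class_eqI[of \<sigma> \<tau> R a b s t] term_class_self[of \<sigma> \<tau> t a b R]
  by (auto simp: term_class_typed)

lemma has_typeI: "well_typed \<sigma> \<tau> t \<Longrightarrow> msrc \<sigma> t = a \<Longrightarrow> mtgt \<tau> t = b \<Longrightarrow> has_type \<sigma> \<tau> t a b"
  by (simp add: has_type_def)

lemma UN_eq_const: "A \<noteq> {} \<Longrightarrow> (\<And>x. x \<in> A \<Longrightarrow> f x = c) \<Longrightarrow> (\<Union>x\<in>A. f x) = c"
  by auto

lemma term_class_nonempty: "well_typed \<sigma> \<tau> f \<Longrightarrow> term_class \<sigma> \<tau> R f \<noteq> {}"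
  using term_class_self[of \<sigma> \<tau> f _ _ R] by (fastforce simp: has_type_def)

lemma term_class_member:
  "f' \<in> term_class \<sigma> \<tau> R f \<Longrightarrow> well_typed \<sigma> \<tau> f \<Longrightarrow> term_eq \<sigma> \<tau> R (msrc \<sigma> f) (mtgt \<tau> f) f' f"
  by (auto simp: term_class_typed[OF has_typeI] intro: term_eq.sym)

lemma presented_simps:
  "ident (presented_category \<sigma> \<tau> R) a = term_class \<sigma> \<tau> R (Ide a)"
  "zero_mor (presented_category \<sigma> \<tau> R) a b = term_class \<sigma> \<tau> R (ZeroT a b)"
  "unit_obj (presented_category \<sigma> \<tau> R) = []"
  "tensor_obj (presented_category \<sigma> \<tau> R) = (@)"
  "obj (presented_category \<sigma> \<tau> R) = UNIV"
  "hom (presented_category \<sigma> \<tau> R) a b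
    = term_class \<sigma> \<tau> R ` {t. well_typed \<sigma> \<tau> t \<and> msrc \<sigma> t = a \<and> mtgt \<tau> t = b}"
  by (simp_all add: presented_category_def has_type_def)

text \<open>The operations on classes are unions over all representatives. The congruence rules make
  all classes in such a union equal, and classes of typed terms are nonempty, so the union collapses
  to one class.\<close>

lemma presented_ops:
  fixes R :: "(('x, 'g, 'k::field) mterm \<times> ('x, 'g, 'k) mterm) set"
  shows "well_typed \<sigma> \<tau> f \<Longrightarrow> well_typed \<sigma> \<tau> g \<Longrightarrow> msrc \<sigma> g = mtgt \<tau> f \<Longrightarrow>
      compose (presented_category \<sigma> \<tau> R) (term_class \<sigma> \<tau> R g) (term_class \<sigma> \<tau> R f)
        = term_class \<sigma> \<tau> R (g \<bullet> f)" (is "?f \<Longrightarrow> ?g \<Longrightarrow> ?c \<Longrightarrow> ?C")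
    and "well_typed \<sigma> \<tau> f \<Longrightarrow> well_typed \<sigma> \<tau> g \<Longrightarrow> msrc \<sigma> f = msrc \<sigma> g \<Longrightarrow> mtgt \<tau> f = mtgt \<tau> g \<Longrightarrow>
      add_mor (presented_category \<sigma> \<tau> R) (term_class \<sigma> \<tau> R f) (term_class \<sigma> \<tau> R g)
        = term_class \<sigma> \<tau> R (f \<boxplus> g)" (is "_ \<Longrightarrow> _ \<Longrightarrow> ?s \<Longrightarrow> ?t \<Longrightarrow> ?A")
    and "well_typed \<sigma> \<tau> f \<Longrightarrow>
      scale_mor (presented_category \<sigma> \<tau> R) r (term_class \<sigma> \<tau> R f) = term_class \<sigma> \<tau> R (ScaleT r f)"
      (is "_ \<Longrightarrow> ?S")
    and "well_typed \<sigma> \<tau> f \<Longrightarrow> well_typed \<sigma> \<tau> g \<Longrightarrow>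
      tensor_mor (presented_category \<sigma> \<tau> R) (term_class \<sigma> \<tau> R f) (term_class \<sigma> \<tau> R g)
        = term_class \<sigma> \<tau> R (f \<boxdot> g)" (is "_ \<Longrightarrow> _ \<Longrightarrow> ?T")
proof -
  note ne = term_class_nonempty[of \<sigma> \<tau> _ R] and m = term_class_member[of _ \<sigma> \<tau> R]
  assume f: ?f
  show ?S
    unfolding presented_category_def
    by (simp, intro UN_eq_const ne f term_class_eqI, rule term_eq.cong_scale, rule m[OF _ f])
  assume g: ?g
  show ?T
    unfolding presented_category_def
    by (simp, intro UN_eq_const ne f g term_class_eqI, rule term_eq.cong_tens[OF m m]) (auto simp: f g)
  { assume c: ?c
    show ?C
      unfolding presented_category_def
      by (simp, intro UN_eq_const ne f g term_class_eqI, rule term_eq.cong_comp[OF m])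
         (use c f g m[of _ g] in auto) }
  { assume c: ?s ?t
    show ?A
      unfolding presented_category_def
      by (simp, intro UN_eq_const ne f g term_class_eqI, rule term_eq.cong_add[OF m])
         (use c f g m[of _ g] in auto) }
qed

lemma presented_linear_monoidal_category:
  "linear_monoidal_category (presented_category \<sigma> \<tau> R)"
proof -
  note axs = term_eq.comp_ide_left term_eq.comp_ide_right term_eq.comp_assoc term_eq.add_assoc
    term_eq.add_commute term_eq.add_zero term_eq.add_inverse term_eq.scale_one term_eq.scale_scale
    term_eq.scale_add_left term_eq.scale_add_right term_eq.comp_add_left term_eq.comp_add_right
    term_eq.comp_scale_left term_eq.comp_scale_right term_eq.tens_ide term_eq.interchange
    term_eq.tens_assoc term_eq.tens_unit_left term_eq.tens_unit_right term_eq.tens_add_left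
    term_eq.tens_add_right term_eq.tens_scale_left term_eq.tens_scale_right
  \<comment> \<open>This is what \<open>hom_disjoint\<close> asks for: a class determines its source
    and target, because \<open>term_eq\<close> only relates terms of one type. The other axioms of
    the locale are closure properties or single rules of \<open>term_eq\<close>.\<close>
  have disj: "msrc \<sigma> s = msrc \<sigma> t \<and> mtgt \<tau> s = mtgt \<tau> t"
    if "term_class \<sigma> \<tau> R s = term_class \<sigma> \<tau> R t" "well_typed \<sigma> \<tau> s" "well_typed \<sigma> \<tau> t" for s t
  proof -
    have "t \<in> term_class \<sigma> \<tau> R s"
      using that term_class_self[of \<sigma> \<tau> t _ _ R] by (auto simp: has_type_def)
    from term_eq_types(2)[OF term_class_member[OF this that(2)]] term_eq_types(1)[OF term_class_member[OF this that(2)]]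
    show ?thesis by (simp add: has_type_def)
  qed
  show ?thesis
    by (unfold_locales;
        ((clarsimp simp: presented_simps presented_ops image_iff; fail)
        | (clarsimp simp: presented_simps presented_ops, (rule imageI, simp | (rule term_class_eqI, rule axs; simp add: has_type_def)); fail)
        | (clarsimp simp: presented_simps, drule disj; simp; fail)
        | (auto simp: presented_simps presented_ops intro!: imageI; fail))?)
qed

primrec interp :: "('x list, 'n, 'k::field) lin_mon_cat \<Rightarrow> ('g \<Rightarrow> 'n) \<Rightarrow> ('x, 'g, 'k) mterm \<Rightarrow> 'n" where
  "interp D G (Gen g) = G g"
| "interp D G (Ide a) = ident D a"
| "interp D G (s \<bullet> t) = compose D (interp D G s) (interp D G t)"
| "interp D G (s \<boxdot> t) = tensor_mor D (interp D G s) (interp D G t)"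
| "interp D G (ZeroT a b) = zero_mor D a b"
| "interp D G (s \<boxplus> t) = add_mor D (interp D G s) (interp D G t)"
| "interp D G (ScaleT r t) = scale_mor D r (interp D G t)"

text \<open>The objects of the target are the words themselves under concatenation, so a functor out
  of the presented category can be the identity on objects and is fixed by the images
  \<open>G\<close> of the generators.\<close>

locale word_category_model = linear_monoidal_category D
  for D :: "('x list, 'n, 'k::field) lin_mon_cat" +
  fixes \<sigma> \<tau> :: "'g \<Rightarrow> 'x list" and G :: "'g \<Rightarrow> 'n"
  assumes obj_words: "obj D = UNIV" and unit_word: "unit_obj D = []"
    and tensor_words: "tensor_obj D = (@)" and gen_hom: "G g \<in> hom D (\<sigma> g) (\<tau> g)"
begin

lemma interp_hom: "has_type \<sigma> \<tau> t a b \<Longrightarrow> interp D G t \<in> hom D a b"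
proof (induction t arbitrary: a b)
  case (Tens s t)
  then show ?case
    using tensor_hom[of "interp D G s" "msrc \<sigma> s" "mtgt \<tau> s" "interp D G t" "msrc \<sigma> t" "mtgt \<tau> t"]
    by (auto simp: has_type_def tensor_words)
qed (auto simp: has_type_def gen_hom obj_words intro: ident_hom zero_hom add_hom scale_hom comp_hom)

text \<open>Soundness by rule induction: apart from \<open>rel\<close>, each rule of
  \<open>term_eq\<close> is a law of equality or an axiom that holds in every strict linear monoidal
  category.\<close>

lemma interp_term_eq:
  assumes R: "\<And>s t a b. (s, t) \<in> R \<Longrightarrow> has_type \<sigma> \<tau> s a b \<Longrightarrow> has_type \<sigma> \<tau> t a b \<Longrightarrow> interp D G s = interp D G t"
    and "term_eq \<sigma> \<tau> R a b s t"
  shows "interp D G s = interp D G t"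
  using assms(2)
proof (induction rule: term_eq.induct)
  case (rel s t a b) then show ?case using R by blast
next
  case (tens_ide a b) then show ?case using tensor_ident[of a b] by (simp add: obj_words tensor_words)
next
  case (tens_unit_left f a b) then show ?case using tensor_unit_left[OF interp_hom] by (simp add: unit_word)
next
  case (tens_unit_right f a b) then show ?case using tensor_unit_right[OF interp_hom] by (simp add: unit_word)
qed (auto dest!: interp_hom intro: comp_ident_left comp_ident_right comp_assoc add_assoc add_commute
    add_zero add_inverse scale_one scale_scale scale_add_left scale_add_right comp_add_left
    comp_add_right comp_scale_left comp_scale_right interchange tensor_assoc
    tensor_add_left tensor_add_right tensor_scale_left tensor_scale_right)

end

definition class_map :: "('m \<Rightarrow> 'n) \<Rightarrow> 'm set \<Rightarrow> 'n" where
  "class_map F X = F (SOME t. t \<in> X)"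

lemma class_map_term_class:
  assumes "\<And>a b s t. term_eq \<sigma> \<tau> R a b s t \<Longrightarrow> F s = F t" and "has_type \<sigma> \<tau> t a b"
  shows "class_map F (term_class \<sigma> \<tau> R t) = F t"
proof -
  have "(SOME s. s \<in> term_class \<sigma> \<tau> R t) \<in> term_class \<sigma> \<tau> R t"
    using someI[of "\<lambda>s. s \<in> term_class \<sigma> \<tau> R t"] term_class_self[OF assms(2)] by blast
  then have "term_eq \<sigma> \<tau> R a b t (SOME s. s \<in> term_class \<sigma> \<tau> R t)"
    by (simp only: term_class_typed[OF assms(2)] mem_Collect_eq)
  from assms(1)[OF this] show ?thesis by (simp add: class_map_def)
qed

lemma (in word_category_model) presented_functor:
  assumes R: "\<And>s t a b. (s, t) \<in> R \<Longrightarrow> has_type \<sigma> \<tau> s a b \<Longrightarrow> has_type \<sigma> \<tau> t a b \<Longrightarrow> interp D G s = interp D G t"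
  shows "linear_monoidal_functor (presented_category \<sigma> \<tau> R) D id (class_map (interp D G))"
proof -
  have F: "class_map (interp D G) (term_class \<sigma> \<tau> R t) = interp D G t" if "well_typed \<sigma> \<tau> t" for t
    by (rule class_map_term_class[OF interp_term_eq[OF R] has_typeI[OF that HOL.refl HOL.refl]])
  interpret P: linear_monoidal_category "presented_category \<sigma> \<tau> R"
    by (rule presented_linear_monoidal_category)
  show ?thesis
    by unfold_locales
      (auto simp: presented_simps presented_ops F obj_words unit_word tensor_words intro!: interp_hom has_typeI)
qed

section \<open>Words in the fundamental crystals\<close>

fun letter_fund :: "letter \<Rightarrow> fund" where
  "letter_fund X1 = B1" | "letter_fund X2 = B1" | "letter_fund X3 = B1" | "letter_fund X4 = B1"
| "letter_fund Y1 = B2" | "letter_fund Y2 = B2" | "letter_fund Y3 = B2" | "letter_fund Y4 = B2"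
| "letter_fund Y5 = B2"

fun letter_eps :: "node \<Rightarrow> letter \<Rightarrow> nat" where
  "letter_eps N1 X2 = 1" | "letter_eps N2 X3 = 1" | "letter_eps N1 X4 = 1"
| "letter_eps N2 Y2 = 1" | "letter_eps N1 Y3 = 1" | "letter_eps N1 Y4 = 2" | "letter_eps N2 Y5 = 1"
| "letter_eps _ _ = 0"

fun letter_phi :: "node \<Rightarrow> letter \<Rightarrow> nat" where
  "letter_phi N1 X1 = 1" | "letter_phi N2 X2 = 1" | "letter_phi N1 X3 = 1"
| "letter_phi N2 Y1 = 1" | "letter_phi N1 Y2 = 2" | "letter_phi N1 Y3 = 1" | "letter_phi N2 Y4 = 1"
| "letter_phi _ _ = 0"

text \<open>In a tensor product the raising depth is eps(b) + max(0, eps(c) - phi(b)), and dually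
  for lowering; truncated subtraction of natural numbers supplies the maximum.\<close>

fun word_eps :: "node \<Rightarrow> letter list \<Rightarrow> nat" where
  "word_eps i [] = 0"
| "word_eps i (x # v) = letter_eps i x + (word_eps i v - letter_phi i x)"

fun word_phi :: "node \<Rightarrow> letter list \<Rightarrow> nat" where
  "word_phi i [] = 0"
| "word_phi i (x # v) = word_phi i v + (letter_phi i x - word_eps i v)"

fun word_raise :: "node \<Rightarrow> letter list \<Rightarrow> letter list option" where
  "word_raise i [] = None"
| "word_raise i (x # v) = (if letter_phi i x \<ge> word_eps i v
     then map_option (\<lambda>y. y # v) (letter_raise i x) else map_option ((#) x) (word_raise i v))"

fun word_lower :: "node \<Rightarrow> letter list \<Rightarrow> letter list option" where
  "word_lower i [] = None"
| "word_lower i (x # v) = (if letter_phi i x > word_eps i v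
     then map_option (\<lambda>y. y # v) (letter_lower i x) else map_option ((#) x) (word_lower i v))"

primrec word_wt :: "letter list \<Rightarrow> int \<times> int" where
  "word_wt [] = 0"
| "word_wt (x # v) = letter_wt x + word_wt v"

lemma letter_raise_facts:
  "letter_raise i x = None \<longleftrightarrow> letter_eps i x = 0"
  "letter_raise i x = Some y \<longleftrightarrow> letter_lower i y = Some x"
  "letter_raise i x = Some y \<Longrightarrow> letter_eps i x = Suc (letter_eps i y)"
  "letter_raise i x = Some y \<Longrightarrow> letter_phi i y = Suc (letter_phi i x)"
  "letter_raise i x = Some y \<Longrightarrow> letter_fund y = letter_fund x"
  "letter_lower i x = None \<longleftrightarrow> letter_phi i x = 0"
  by (cases i; cases x; cases y; simp)+

text \<open>Raising the first letter adds one to its \<open>letter_phi\<close>, raising the tail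
  takes one from its \<open>word_eps\<close>. In both cases the inequality that selected the place
  to raise becomes the one that selects the same place to lower, so lowering undoes the
  step.\<close>

lemma word_raise_Some:
  "word_raise i v = Some w \<Longrightarrow> word_eps i v = Suc (word_eps i w) \<and> word_phi i w = Suc (word_phi i v)
    \<and> word_lower i w = Some v \<and> map letter_fund w = map letter_fund v"
proof (induction v arbitrary: w)
  case (Cons x v)
  show ?case
  proof (cases "letter_phi i x \<ge> word_eps i v")
    case True
    then obtain y where "letter_raise i x = Some y" "w = y # v" using Cons.prems by auto
    with True letter_raise_facts(2-5)[of i x y] show ?thesis by auto
  next
    case False
    then obtain u where "word_raise i v = Some u" "w = x # u" using Cons.prems by auto
    with False Cons.IH[of u] show ?thesis by auto
  qed
qed simp

lemma word_lower_Some: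
  "word_lower i v = Some w \<Longrightarrow> word_raise i w = Some v"
proof (induction v arbitrary: w)
  case (Cons x v)
  show ?case
  proof (cases "letter_phi i x > word_eps i v")
    case True
    then obtain y where "letter_lower i x = Some y" "w = y # v" using Cons.prems by auto
    with True letter_raise_facts(2-5)[of i y x] show ?thesis by auto
  next
    case False
    then obtain u where u: "word_lower i v = Some u" "w = x # u" using Cons.prems by auto
    from word_raise_Some[OF Cons.IH[OF u(1)]] False u Cons.IH[OF u(1)] show ?thesis by auto
  qed
qed simp

lemma word_raise_lower_iff: "word_raise i v = Some w \<longleftrightarrow> word_lower i w = Some v"
  using word_raise_Some word_lower_Some by blast

lemma word_raise_None: "word_raise i v = None \<longleftrightarrow> word_eps i v = 0"
proof (induction v)
  case (Cons x v)
  then show ?case by (auto simp: letter_raise_facts)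
qed simp

lemma word_lower_None: "word_lower i v = None \<longleftrightarrow> word_phi i v = 0"
proof (induction v)
  case (Cons x v)
  then show ?case by (auto simp: letter_raise_facts)
qed simp

lemma word_eps_append: "word_eps i (a @ b) = word_eps i a + (word_eps i b - word_phi i a)"
  and word_phi_append: "word_phi i (a @ b) = word_phi i b + (word_phi i a - word_eps i b)"
  by (induction a) auto

text \<open>Associativity of the tensor product in list form: a word may be cut at any place, and
  the rule for two factors gives the same operator as the recursion letter by letter.\<close>

lemma word_raise_append: "word_raise i (a @ b) = (if word_phi i a \<ge> word_eps i b
     then map_option (\<lambda>a'. a' @ b) (word_raise i a) else map_option (\<lambda>b'. a @ b') (word_raise i b))"
proof (induction a)
  case Nil
  then show ?case by (cases "word_raise i b") (auto simp: word_raise_None dest: word_raise_Some)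
next
  case (Cons x a)
  then show ?case by (auto simp: word_eps_append option.map_comp comp_def)
qed

lemma word_lower_append: "word_lower i (a @ b) = (if word_phi i a > word_eps i b
     then map_option (\<lambda>a'. a' @ b) (word_lower i a) else map_option (\<lambda>b'. a @ b') (word_lower i b))"
proof (induction a)
  case Nil
  then show ?case by (cases "word_lower i b") auto
next
  case (Cons x a)
  then show ?case by (auto simp: word_eps_append option.map_comp comp_def)
qed

lemma word_wt_append: "word_wt (a @ b) = word_wt a + word_wt b"
  by (induction a) (auto simp: add.assoc)

text \<open>Each application of \<open>R\<close> lowers \<open>E\<close> by one, and
  \<open>R\<close> can fail only where \<open>E\<close> is 0; so exactly the iterates up to
  \<open>E b\<close> survive, and the maximum in \<open>eps\<close> and \<open>phi\<close> is
  \<open>E b\<close>. The set \<open>A\<close> is there because the operators of a word crystal are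
  only known on its elements.\<close>

lemma string_iterate:
  fixes R :: "'b \<Rightarrow> 'b option" and E :: "'b \<Rightarrow> nat"
  assumes "\<And>b. b \<in> A \<Longrightarrow> R b = None \<Longrightarrow> E b = 0"
    and "\<And>b c. b \<in> A \<Longrightarrow> R b = Some c \<Longrightarrow> c \<in> A \<and> E b = Suc (E c)"
    and "b \<in> A"
  shows "Max {n. ((\<lambda>x. Option.bind x R) ^^ n) (Some b) \<noteq> None} = E b"
proof -
  have none: "((\<lambda>x. Option.bind x R) ^^ n) None = None" for n by (induction n) auto
  have "((\<lambda>x. Option.bind x R) ^^ n) (Some b) \<noteq> None \<longleftrightarrow> n \<le> E b" if "b \<in> A" for n b
    using that
  proof (induction n arbitrary: b)
    case (Suc n)
    show ?case
    proof (cases "R b")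
      case None
      then show ?thesis using assms(1) Suc.prems none by (simp add: funpow_Suc_right del: funpow.simps)
    next
      case (Some c)
      then show ?thesis using assms(2) Suc by (simp add: funpow_Suc_right del: funpow.simps)
    qed
  qed simp
  then have "{n. ((\<lambda>x. Option.bind x R) ^^ n) (Some b) \<noteq> None} = {..E b}" using assms(3) by auto
  then show ?thesis by (simp add: Max_eq_iff)
qed

lemma letter_lower_Some: "letter_lower i x = Some y \<Longrightarrow> letter_phi i x = Suc (letter_phi i y)"
  by (simp add: letter_raise_facts(2)[symmetric] letter_raise_facts(4))

lemma fund_crystal_phi: "phi (fund_crystal a) i x = letter_phi i x"
  unfolding phi_def
  by (rule string_iterate[where A = UNIV]) (auto simp: fund_crystal_def letter_raise_facts(6) letter_lower_Some)

lemma fund_crystal_simps: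
  "wt (fund_crystal a) = letter_wt" "raise (fund_crystal a) = letter_raise"
  "lower (fund_crystal a) = letter_lower"
  by (simp_all add: fund_crystal_def)

lemma fund_crystal_elts: "elts (fund_crystal a) = {x. letter_fund x = a}"
  by (rule set_eqI; cases a; rename_tac x; case_tac x) (auto simp: fund_crystal_def)

lemma word_crystal_simps:
  "elts (word_crystal w) = {v. map letter_fund v = w}"
  "v \<in> elts (word_crystal w) \<Longrightarrow> wt (word_crystal w) v = word_wt v"
  "v \<in> elts (word_crystal w) \<Longrightarrow> raise (word_crystal w) i v = word_raise i v"
  "v \<in> elts (word_crystal w) \<Longrightarrow> lower (word_crystal w) i v = word_lower i v"
proof (induction w arbitrary: v i)
  case (Cons a w)
  have el: "elts (word_crystal (a # w)) = {v. map letter_fund v = a # w}"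
    by (auto simp: cons_crystal_def tensor_crystal_def Cons.IH fund_crystal_elts image_iff)
  \<comment> \<open>The \<open>eps\<close> of the tail depends on the raising operators of the tail,
    which is why all four claims are proved in one induction.\<close>
  have eps: "eps (word_crystal w) i v = word_eps i v" if "v \<in> elts (word_crystal w)" for v i
    unfolding eps_def
    by (rule string_iterate[where A = "elts (word_crystal w)"])
      (use that in \<open>auto simp: Cons.IH word_raise_None dest: word_raise_Some\<close>)
  { case 1 show ?case by (rule el) }
  have split: "\<exists>x u. v = x # u \<and> letter_fund x = a \<and> u \<in> elts (word_crystal w)"
    if "v \<in> elts (word_crystal (a # w))" for v
    using that by (auto simp del: word_crystal.simps simp: el Cons.IH map_eq_Cons_conv)
  { case 2
    from split[OF this] obtain x u where x: "v = x # u" "letter_fund x = a" "u \<in> elts (word_crystal w)"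
      by blast
    show ?case
      by (simp add: x cons_crystal_def tensor_crystal_def Cons.IH(2) fund_crystal_simps) }
  { case 3
    from split[OF this] obtain x u where x: "v = x # u" "letter_fund x = a" "u \<in> elts (word_crystal w)"
      by blast
    show ?case
      by (simp add: x cons_crystal_def tensor_crystal_def Cons.IH(3) eps fund_crystal_phi
          option.map_comp comp_def fund_crystal_simps) }
  { case 4
    from split[OF this] obtain x u where x: "v = x # u" "letter_fund x = a" "u \<in> elts (word_crystal w)"
      by blast
    show ?case
      by (simp add: x cons_crystal_def tensor_crystal_def Cons.IH(4) eps fund_crystal_phi
          option.map_comp comp_def fund_crystal_simps) }
qed auto

lemma word_crystal_at:
  assumes "map letter_fund v = w"
  shows "wt (word_crystal w) v = word_wt v" "raise (word_crystal w) i v = word_raise i v"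
    "lower (word_crystal w) i v = word_lower i v"
  using assms by (simp_all add: word_crystal_simps)

lemma finite_word_crystal: "finite (elts (word_crystal w))"
proof (induction w)
  case (Cons a w)
  have "finite (elts (fund_crystal a))" by (cases a) (simp_all add: fund_crystal_def)
  with Cons show ?case by (simp add: cons_crystal_def tensor_crystal_def)
qed simp

section \<open>Strict morphisms between tensor words\<close>

definition word_morphism :: "fund list \<Rightarrow> fund list \<Rightarrow> (letter list \<Rightarrow> letter list option) \<Rightarrow> bool" where
  "word_morphism v w \<psi> \<longleftrightarrow> (\<forall>x. map letter_fund x = v \<longrightarrow>
     (\<forall>y. \<psi> x = Some y \<longrightarrow> map letter_fund y = w \<and> word_wt y = word_wt x) \<and>
     (\<forall>i. Option.bind (word_raise i x) \<psi> = Option.bind (\<psi> x) (word_raise i)) \<and>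
     (\<forall>i. Option.bind (word_lower i x) \<psi> = Option.bind (\<psi> x) (word_lower i)))"

lemma word_morphismD:
  assumes "word_morphism v w \<psi>" "map letter_fund x = v"
  shows "\<psi> x = Some y \<Longrightarrow> map letter_fund y = w" "\<psi> x = Some y \<Longrightarrow> word_wt y = word_wt x"
    "Option.bind (word_raise i x) \<psi> = Option.bind (\<psi> x) (word_raise i)"
    "Option.bind (word_lower i x) \<psi> = Option.bind (\<psi> x) (word_lower i)"
  using assms unfolding word_morphism_def by blast+

lemma strict_morphism_word:
  "strict_morphism (word_crystal v) (word_crystal w) \<psi> \<longleftrightarrow> word_morphism v w \<psi>"
proof -
  let ?E = "elts (word_crystal v)"
  have b: "Option.bind (\<psi> x) (raise (word_crystal w) i) = Option.bind (\<psi> x) (word_raise i)"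
       "Option.bind (\<psi> x) (lower (word_crystal w) i) = Option.bind (\<psi> x) (word_lower i)"
    if "\<forall>y. \<psi> x = Some y \<longrightarrow> map letter_fund y = w \<and> word_wt y = word_wt x" for x i
    using that word_crystal_at[of _ w] by (auto intro!: bind_option_cong)
  have "(\<forall>y. \<psi> x = Some y \<longrightarrow> y \<in> elts (word_crystal w) \<and> wt (word_crystal w) y = wt (word_crystal v) x) \<longleftrightarrow>
    (\<forall>y. \<psi> x = Some y \<longrightarrow> map letter_fund y = w \<and> word_wt y = word_wt x)" if "x \<in> ?E" for x
    using that by (simp add: word_crystal_simps(1) word_crystal_at cong: conj_cong)
  note a = this
  have "strict_morphism (word_crystal v) (word_crystal w) \<psi> \<longleftrightarrow>
    (\<forall>x\<in>?E. (\<forall>y. \<psi> x = Some y \<longrightarrow> y \<in> elts (word_crystal w) \<and> wt (word_crystal w) y = wt (word_crystal v) x)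
      \<and> (\<forall>i. Option.bind (raise (word_crystal v) i x) \<psi> = Option.bind (\<psi> x) (raise (word_crystal w) i))
      \<and> (\<forall>i. Option.bind (lower (word_crystal v) i x) \<psi> = Option.bind (\<psi> x) (lower (word_crystal w) i)))"
    by (simp only: strict_morphism_def ball_conj_distrib all_simps ball_simps)
  also have "\<dots> \<longleftrightarrow> (\<forall>x\<in>?E. (\<forall>y. \<psi> x = Some y \<longrightarrow> map letter_fund y = w \<and> word_wt y = word_wt x)
      \<and> (\<forall>i. Option.bind (word_raise i x) \<psi> = Option.bind (\<psi> x) (word_raise i))
      \<and> (\<forall>i. Option.bind (word_lower i x) \<psi> = Option.bind (\<psi> x) (word_lower i)))"
    by (intro ball_cong[OF HOL.refl])
       (use a in \<open>simp add: b word_crystal_simps(3,4) cong: conj_cong\<close>)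
  also have "\<dots> \<longleftrightarrow> word_morphism v w \<psi>"
    by (simp add: word_morphism_def word_crystal_simps(1))
  finally show ?thesis .
qed

text \<open>If x can be raised to x', then x is x' lowered, so a morphism that is nonzero at x is
  nonzero at x'. Thus the raising string of x is mapped to a string of the same length and is never
  cut short.\<close>

lemma word_morphism_eps:
  assumes "word_morphism v w \<psi>" "map letter_fund x = v" "\<psi> x = Some y"
  shows "word_eps i y = word_eps i x"
  using assms(2,3)
proof (induction "word_eps i x" arbitrary: x y)
  case 0
  then have "word_raise i x = None" by (simp add: word_raise_None)
  moreover have "Option.bind (word_raise i x) \<psi> = Option.bind (\<psi> x) (word_raise i)"
    using word_morphismD(3-4)[OF assms(1) 0(2)] by blast
  ultimately have "word_raise i y = None" using 0 by simp
  then show ?case using 0 by (simp add: word_raise_None)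
next
  case (Suc n)
  then obtain x' where x': "word_raise i x = Some x'" by (metis word_raise_None nat.distinct(1) not_None_eq)
  note f = word_raise_Some[OF x']
  have "Option.bind (word_lower i x') \<psi> = Option.bind (\<psi> x') (word_lower i)"
    by (rule word_morphismD[OF assms(1)]) (use f Suc.prems in simp)
  then obtain y' where y': "\<psi> x' = Some y'" "word_lower i y' = Some y"
    using f Suc.prems by (cases "\<psi> x'") auto
  have "word_eps i y' = word_eps i x'" using Suc.hyps(1)[of x' y'] Suc.hyps(2) f y' Suc.prems(1) by simp
  moreover have "word_raise i y = Some y'" using y' by (simp add: word_raise_lower_iff)
  ultimately show ?case using word_raise_Some[of i y y'] f by simp
qed

lemma word_morphism_phi:
  assumes "word_morphism v w \<psi>" "map letter_fund x = v" "\<psi> x = Some y"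
  shows "word_phi i y = word_phi i x"
  using assms(2,3)
proof (induction "word_phi i x" arbitrary: x y)
  case 0
  then have "word_lower i x = None" by (simp add: word_lower_None)
  moreover have "Option.bind (word_lower i x) \<psi> = Option.bind (\<psi> x) (word_lower i)"
    using word_morphismD(3-4)[OF assms(1) 0(2)] by blast
  ultimately have "word_lower i y = None" using 0 by simp
  then show ?case using 0 by (simp add: word_lower_None)
next
  case (Suc n)
  then obtain x' where x': "word_lower i x = Some x'" by (metis word_lower_None nat.distinct(1) not_None_eq)
  then have r: "word_raise i x' = Some x" by (simp add: word_raise_lower_iff)
  note f = word_raise_Some[OF r]
  have "Option.bind (word_raise i x') \<psi> = Option.bind (\<psi> x') (word_raise i)"
    by (rule word_morphismD[OF assms(1)]) (use f Suc.prems in simp)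
  then obtain y' where y': "\<psi> x' = Some y'" "word_raise i y' = Some y"
    using r Suc.prems by (cases "\<psi> x'") auto
  have "word_phi i y' = word_phi i x'" using Suc.hyps(1)[of x' y'] Suc.hyps(2) f y' Suc.prems(1) by simp
  then show ?case using word_raise_Some[OF y'(2)] f by simp
qed

definition tensor_map ::
    "nat \<Rightarrow> (letter list \<Rightarrow> letter list option) \<Rightarrow> (letter list \<Rightarrow> letter list option) \<Rightarrow> letter list \<Rightarrow> letter list option" where
  "tensor_map n \<psi> \<chi> x = (case (\<psi> (take n x), \<chi> (drop n x)) of (Some a, Some b) \<Rightarrow> Some (a @ b) | _ \<Rightarrow> None)"

lemma tensor_map_append:
  "length a = n \<Longrightarrow> tensor_map n \<psi> \<chi> (a @ b)
     = Option.bind (\<psi> a) (\<lambda>a'. map_option (\<lambda>b'. a' @ b') (\<chi> b))"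
  by (auto simp: tensor_map_def split: option.splits)

lemma bind_Some_comp: "Option.bind y (\<lambda>a. Some (f a)) = map_option f y"
  by (cases y) auto

text \<open>The tensor product rule compares \<open>word_phi\<close> of the left factor with
  \<open>word_eps\<close> of the right one. Morphisms preserve both where they are nonzero, so an
  element and its image are raised or lowered in the same factor.\<close>

lemma word_morphism_tensor:
  assumes f: "word_morphism v w \<psi>" and g: "word_morphism v' w' \<chi>"
  shows "word_morphism (v @ v') (w @ w') (tensor_map (length v) \<psi> \<chi>)"
  unfolding word_morphism_def
proof (intro allI impI)
  fix x assume "map letter_fund x = v @ v'"
  then obtain a b where x: "x = a @ b" and a: "map letter_fund a = v" and b: "map letter_fund b = v'"
    by (auto simp: map_eq_append_conv)
  let ?T = "tensor_map (length v) \<psi> \<chi>"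
  have la: "length a = length v" using a by auto
  have la': "length a' = length v" if "word_raise i a = Some a' \<or> word_lower i a = Some a'" for a' i
    using that word_raise_Some[of i a a'] word_raise_Some[of i a' a] la
    by (metis length_map word_raise_lower_iff)
  have fa: "Option.bind (word_raise i a) \<psi> = Option.bind (\<psi> a) (word_raise i)"
      "Option.bind (word_lower i a) \<psi> = Option.bind (\<psi> a) (word_lower i)"
      "\<psi> a = Some a' \<Longrightarrow> map letter_fund a' = w \<and> word_wt a' = word_wt a" for i a'
    using word_morphismD[OF f a] by blast+
  have gb: "Option.bind (word_raise i b) \<chi> = Option.bind (\<chi> b) (word_raise i)"
      "Option.bind (word_lower i b) \<chi> = Option.bind (\<chi> b) (word_lower i)"
      "\<chi> b = Some b' \<Longrightarrow> map letter_fund b' = w' \<and> word_wt b' = word_wt b" for i b'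
    using word_morphismD[OF g b] by blast+
  have ea: "\<psi> a = Some a' \<Longrightarrow> word_phi i a' = word_phi i a" for a' i using word_morphism_phi[OF f a] .
  have eb: "\<chi> b = Some b' \<Longrightarrow> word_eps i b' = word_eps i b" for b' i using word_morphism_eps[OF g b] .
  have R: "Option.bind (word_raise i x) ?T = Option.bind (?T x) (word_raise i)" for i
  proof (cases "\<psi> a")
    case None
    then show ?thesis using fa(1)[of i] la'[of i]
      by (cases "word_raise i a"; cases "word_raise i b"; simp add: x word_raise_append tensor_map_append la)
  next
    case p: (Some p)
    show ?thesis
    proof (cases "\<chi> b")
      case None
      then show ?thesis using p fa(1)[of i] gb(1)[of i] la'[of i]
        by (cases "word_raise i a"; cases "word_raise i b"; simp add: x word_raise_append tensor_map_append la)
    next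
      case (Some q)
      then show ?thesis using p fa(1)[of i] gb(1)[of i] la'[of i] ea[OF p, of i] eb[OF Some, of i]
        by (cases "word_raise i a"; cases "word_raise i b"; simp add: x word_raise_append tensor_map_append la bind_Some_comp)
    qed
  qed
  have L: "Option.bind (word_lower i x) ?T = Option.bind (?T x) (word_lower i)" for i
  proof (cases "\<psi> a")
    case None
    then show ?thesis using fa(2)[of i] la'[of i]
      by (cases "word_lower i a"; cases "word_lower i b"; simp add: x word_lower_append tensor_map_append la)
  next
    case p: (Some p)
    show ?thesis
    proof (cases "\<chi> b")
      case None
      then show ?thesis using p fa(2)[of i] gb(2)[of i] la'[of i]
        by (cases "word_lower i a"; cases "word_lower i b"; simp add: x word_lower_append tensor_map_append la)
    next
      case (Some q)
      then show ?thesis using p fa(2)[of i] gb(2)[of i] la'[of i] ea[OF p, of i] eb[OF Some, of i]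
        by (cases "word_lower i a"; cases "word_lower i b"; simp add: x word_lower_append tensor_map_append la bind_Some_comp)
    qed
  qed
  show "(\<forall>y. ?T x = Some y \<longrightarrow> map letter_fund y = w @ w' \<and> word_wt y = word_wt x) \<and>
     (\<forall>i. Option.bind (word_raise i x) ?T = Option.bind (?T x) (word_raise i)) \<and>
     (\<forall>i. Option.bind (word_lower i x) ?T = Option.bind (?T x) (word_lower i))"
    using R L fa(3) gb(3)
    by (auto simp: x tensor_map_append la word_wt_append Option.bind_eq_Some_conv)
qed

lemma word_morphism_comp:
  assumes f: "word_morphism u v \<psi>" and g: "word_morphism v w \<chi>"
  shows "word_morphism u w (\<lambda>x. Option.bind (\<psi> x) \<chi>)"
  unfolding word_morphism_def
proof (intro allI impI)
  fix x assume x: "map letter_fund x = u"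
  note fx = word_morphismD[OF f x] and gy = word_morphismD[OF g]
  have r: "Option.bind (word_raise i x) (\<lambda>x. Option.bind (\<psi> x) \<chi>)
      = Option.bind (Option.bind (word_raise i x) \<psi>) \<chi>"
    "Option.bind (word_lower i x) (\<lambda>x. Option.bind (\<psi> x) \<chi>)
      = Option.bind (Option.bind (word_lower i x) \<psi>) \<chi>" for i
    by (simp_all add: Option.bind_assoc)
  show "(\<forall>y. Option.bind (\<psi> x) \<chi> = Some y \<longrightarrow> map letter_fund y = w \<and> word_wt y = word_wt x) \<and>
     (\<forall>i. Option.bind (word_raise i x) (\<lambda>x. Option.bind (\<psi> x) \<chi>) = Option.bind (Option.bind (\<psi> x) \<chi>) (word_raise i)) \<and>
     (\<forall>i. Option.bind (word_lower i x) (\<lambda>x. Option.bind (\<psi> x) \<chi>) = Option.bind (Option.bind (\<psi> x) \<chi>) (word_lower i))"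
  proof (cases "\<psi> x")
    case None
    then show ?thesis unfolding r fx(3,4) by simp
  next
    case (Some y)
    then show ?thesis unfolding r fx(3,4) using fx(1,2)[OF Some] gy[OF fx(1)[OF Some]] by simp
  qed
qed

lemma word_morphism_id: "word_morphism v v Some"
  by (auto simp: word_morphism_def)

section \<open>The linear monoidal category of tensor words\<close>

abbreviation word_elts :: "fund list \<Rightarrow> letter list set" where
  "word_elts w \<equiv> {x. map letter_fund x = w}"

abbreviation word_homs :: "fund list \<Rightarrow> fund list \<Rightarrow> (letter list \<Rightarrow> letter list \<Rightarrow> 'k::field) set" where
  "word_homs v w \<equiv> crystal_homs (word_crystal v) (word_crystal w)"

abbreviation word_matrix ::
    "fund list \<Rightarrow> (letter list \<Rightarrow> letter list option) \<Rightarrow> letter list \<Rightarrow> letter list \<Rightarrow> 'k::field" where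
  "word_matrix v \<equiv> morphism_matrix (word_crystal v)"

lemma finite_word_elts: "finite (word_elts w)"
  using finite_word_crystal[of w] by (simp add: word_crystal_simps)

lemma word_matrix_eq: "word_matrix v \<psi> = (\<lambda>x y. if map letter_fund x = v \<and> \<psi> x = Some y then 1 else 0)"
  by (simp add: morphism_matrix_def word_crystal_simps fun_eq_iff)

text \<open>Hom spaces are defined by finite sums; this induction reduces a linear statement to a
  single strict morphism with a coefficient.\<close>

lemma word_homs_induct [consumes 1, case_names zero add]:
  assumes "M \<in> word_homs v w"
    and "P (\<lambda>x y. 0)"
    and "\<And>M \<psi> c. M \<in> word_homs v w \<Longrightarrow> P M \<Longrightarrow> word_morphism v w \<psi> \<Longrightarrow> P (\<lambda>x y. M x y + c * word_matrix v \<psi> x y)"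
  shows "P M"
proof -
  obtain S r where S: "finite S" "\<forall>\<psi>\<in>S. word_morphism v w \<psi>"
    and M: "M = (\<lambda>x y. \<Sum>\<psi>\<in>S. r \<psi> * word_matrix v \<psi> x y)"
    using assms(1) by (auto simp: crystal_homs_def strict_morphism_word)
  from S have "P (\<lambda>x y. \<Sum>\<psi>\<in>S. r \<psi> * word_matrix v \<psi> x y)"
  proof (induction S)
    case empty then show ?case using assms(2) by simp
  next
    case (insert \<psi> S)
    have "(\<lambda>x y. \<Sum>\<psi>\<in>S. r \<psi> * word_matrix v \<psi> x y) \<in> word_homs v w"
      using insert by (auto simp: crystal_homs_def strict_morphism_word)
    from assms(3)[OF this] insert show ?case by (simp add: add.commute)
  qed
  then show ?thesis by (simp add: M)
qed

lemma word_homs_zero: "(\<lambda>x y. 0) \<in> word_homs v w"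
  unfolding crystal_homs_def by (auto intro!: exI[of _ "{}"])

lemma word_homs_scale: "M \<in> word_homs v w \<Longrightarrow> (\<lambda>x y. c * M x y) \<in> word_homs v w"
proof -
  assume "M \<in> word_homs v w"
  then obtain S r where S: "finite S" "\<forall>\<psi>\<in>S. strict_morphism (word_crystal v) (word_crystal w) \<psi>"
    and M: "M = (\<lambda>x y. \<Sum>\<psi>\<in>S. r \<psi> * word_matrix v \<psi> x y)"
    by (auto simp: crystal_homs_def)
  show ?thesis unfolding crystal_homs_def
    using S by (auto intro!: exI[of _ S] exI[of _ "\<lambda>\<psi>. c * r \<psi>"] simp: M sum_distrib_left mult.assoc)
qed

lemma word_homs_add:
  assumes "M \<in> word_homs v w" "N \<in> word_homs v w"
  shows "(\<lambda>x y. M x y + N x y) \<in> word_homs v w"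
proof -
  obtain S r where S: "finite S" "\<forall>\<psi>\<in>S. strict_morphism (word_crystal v) (word_crystal w) \<psi>"
    and M: "M = (\<lambda>x y. \<Sum>\<psi>\<in>S. r \<psi> * word_matrix v \<psi> x y)"
    using assms(1) by (auto simp: crystal_homs_def)
  obtain T s where T: "finite T" "\<forall>\<psi>\<in>T. strict_morphism (word_crystal v) (word_crystal w) \<psi>"
    and N: "N = (\<lambda>x y. \<Sum>\<psi>\<in>T. s \<psi> * word_matrix v \<psi> x y)"
    using assms(2) by (auto simp: crystal_homs_def)
  \<comment> \<open>Both sums are extended by zero coefficients to the common index set
    \<open>S \<union> T\<close>.\<close>
  define q where "q \<psi> = (if \<psi> \<in> S then r \<psi> else 0) + (if \<psi> \<in> T then s \<psi> else 0)" for \<psi>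
  have "(\<Sum>\<psi>\<in>S \<union> T. q \<psi> * word_matrix v \<psi> x y) = M x y + N x y" for x y
  proof -
    have "(\<Sum>\<psi>\<in>S \<union> T. q \<psi> * word_matrix v \<psi> x y)
      = (\<Sum>\<psi>\<in>S \<union> T. if \<psi> \<in> S then r \<psi> * word_matrix v \<psi> x y else 0)
      + (\<Sum>\<psi>\<in>S \<union> T. if \<psi> \<in> T then s \<psi> * word_matrix v \<psi> x y else 0)"
      by (simp add: q_def distrib_right sum.distrib[symmetric] if_distrib[of "\<lambda>z. z * _"] cong: if_cong)
    also have "(\<Sum>\<psi>\<in>S \<union> T. if \<psi> \<in> S then r \<psi> * word_matrix v \<psi> x y else 0) = M x y"
      using S(1) T(1) by (simp add: M sum.If_cases Int_absorb2 Int_commute)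
    also have "(\<Sum>\<psi>\<in>S \<union> T. if \<psi> \<in> T then s \<psi> * word_matrix v \<psi> x y else 0) = N x y"
      using S(1) T(1) by (simp add: N sum.If_cases Int_absorb2 Int_commute)
    finally show ?thesis .
  qed
  then show ?thesis unfolding crystal_homs_def
    using S T by (auto intro!: exI[of _ "S \<union> T"] exI[of _ q] simp: fun_eq_iff)
qed

lemma word_homs_matrix:
  assumes "word_morphism v w \<psi>"
  shows "word_matrix v \<psi> \<in> word_homs v w"
  unfolding crystal_homs_def
  using assms by (auto intro!: exI[of _ "{\<psi>}"] exI[of _ "\<lambda>_. 1"] simp: strict_morphism_word)

lemma word_homs_support:
  assumes "M \<in> word_homs v w"
  shows "map letter_fund x \<noteq> v \<Longrightarrow> M x y = 0" "map letter_fund y \<noteq> w \<Longrightarrow> M x y = 0"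
  using assms by (induction rule: word_homs_induct) (auto simp: word_matrix_eq dest: word_morphismD)

text \<open>Matrices act on rows, so the morphism applied first is the first argument;
  \<open>compose\<close> lists the two in the other order.\<close>

definition matrix_comp :: "fund list \<Rightarrow> (letter list \<Rightarrow> letter list \<Rightarrow> 'k::field) \<Rightarrow>
    (letter list \<Rightarrow> letter list \<Rightarrow> 'k) \<Rightarrow> letter list \<Rightarrow> letter list \<Rightarrow> 'k" where
  "matrix_comp v M N = (\<lambda>x z. \<Sum>y\<in>word_elts v. M x y * N y z)"

definition matrix_tensor :: "fund list \<Rightarrow> fund list \<Rightarrow> (letter list \<Rightarrow> letter list \<Rightarrow> 'k::field) \<Rightarrow>
    (letter list \<Rightarrow> letter list \<Rightarrow> 'k) \<Rightarrow> letter list \<Rightarrow> letter list \<Rightarrow> 'k" where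
  "matrix_tensor v w M N = (\<lambda>x y. M (take (length v) x) (take (length w) y) * N (drop (length v) x) (drop (length w) y))"

lemma matrix_comp_word_matrix:
  assumes "word_morphism u v \<psi>"
  shows "matrix_comp v (word_matrix u \<psi>) (word_matrix v \<chi>) = word_matrix u (\<lambda>x. Option.bind (\<psi> x) \<chi>)"
proof (intro ext)
  fix x z
  show "matrix_comp v (word_matrix u \<psi>) (word_matrix v \<chi>) x z = word_matrix u (\<lambda>x. Option.bind (\<psi> x) \<chi>) x z"
  proof (cases "map letter_fund x = u \<and> \<psi> x \<noteq> None")
    case True
    then obtain y where y: "\<psi> x = Some y" "map letter_fund y = v" using word_morphismD(1)[OF assms] by blast
    have "matrix_comp v (word_matrix u \<psi>) (word_matrix v \<chi>) x z
       = (\<Sum>y'\<in>word_elts v. if y' = y then word_matrix v \<chi> y z else 0)"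
      unfolding matrix_comp_def by (intro sum.cong) (use True y in \<open>auto simp: word_matrix_eq\<close>)
    also have "\<dots> = word_matrix v \<chi> y z" using y by (simp add: finite_word_elts)
    finally show ?thesis using True y by (simp add: word_matrix_eq)
  qed (auto simp: matrix_comp_def word_matrix_eq)
qed

lemma word_homs_comp:
  assumes "M \<in> word_homs u v" "N \<in> word_homs v w"
  shows "matrix_comp v M N \<in> word_homs u w"
  using assms(1)
proof (induction rule: word_homs_induct)
  case zero
  then show ?case by (simp add: matrix_comp_def word_homs_zero)
next
  case (add M \<psi> c)
  have "matrix_comp v (word_matrix u \<psi>) N \<in> word_homs u w"
    using assms(2)
  proof (induction rule: word_homs_induct)
    case zero
    then show ?case by (simp add: matrix_comp_def word_homs_zero)
  next
    case (add N \<chi> c)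
    have "matrix_comp v (word_matrix u \<psi>) (\<lambda>x y. N x y + c * word_matrix v \<chi> x y)
       = (\<lambda>x y. matrix_comp v (word_matrix u \<psi>) N x y + c * matrix_comp v (word_matrix u \<psi>) (word_matrix v \<chi>) x y)"
      by (simp add: matrix_comp_def algebra_simps sum.distrib sum_distrib_left)
    moreover have "matrix_comp v (word_matrix u \<psi>) (word_matrix v \<chi>) \<in> word_homs u w"
      unfolding matrix_comp_word_matrix[OF \<open>word_morphism u v \<psi>\<close>]
      by (intro word_homs_matrix word_morphism_comp[OF \<open>word_morphism u v \<psi>\<close> add.hyps(2)])
    ultimately show ?case using word_homs_add[OF add.IH word_homs_scale] by simp
  qed
  moreover have "matrix_comp v (\<lambda>x y. M x y + c * word_matrix u \<psi> x y) N
       = (\<lambda>x y. matrix_comp v M N x y + c * matrix_comp v (word_matrix u \<psi>) N x y)"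
    by (simp add: matrix_comp_def algebra_simps sum.distrib sum_distrib_left)
  ultimately show ?case using word_homs_add[OF add.IH word_homs_scale] by simp
qed

lemma map_eq_append_iff_take_drop:
  "map f x = v @ v' \<longleftrightarrow> map f (take (length v) x) = v \<and> map f (drop (length v) x) = v'"
  by (metis append_eq_conv_conj append_take_drop_id map_append take_map drop_map)

lemma matrix_tensor_word_matrix:
  assumes "word_morphism v w \<psi>"
  shows "matrix_tensor v w (word_matrix v \<psi>) (word_matrix v' \<chi>)
    = word_matrix (v @ v') (tensor_map (length v) \<psi> \<chi>)"
proof (intro ext)
  fix x y :: "letter list"
  let ?a = "take (length v) x" and ?b = "drop (length v) x"
  show "matrix_tensor v w (word_matrix v \<psi>) (word_matrix v' \<chi>) x y
    = word_matrix (v @ v') (tensor_map (length v) \<psi> \<chi>) x y"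
  proof (cases "map letter_fund ?a = v \<and> map letter_fund ?b = v' \<and> \<psi> ?a \<noteq> None \<and> \<chi> ?b \<noteq> None")
    case True
    then obtain a b where ab: "\<psi> ?a = Some a" "\<chi> ?b = Some b" by blast
    have "map letter_fund a = w" using word_morphismD(1)[OF assms _ ab(1)] True by blast
    then have "length a = length w" by auto
    then have "a @ b = y \<longleftrightarrow> a = take (length w) y \<and> b = drop (length w) y"
      using append_eq_conv_conj[of a b y] by simp
    then show ?thesis using True ab
      by (simp add: matrix_tensor_def word_matrix_eq tensor_map_def map_eq_append_iff_take_drop)
  next
    case False
    then show ?thesis
      by (auto simp: matrix_tensor_def word_matrix_eq tensor_map_def map_eq_append_iff_take_drop split: option.splits)
  qed
qed

lemma word_homs_tensor:
  assumes "M \<in> word_homs v w" "N \<in> word_homs v' w'"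
  shows "matrix_tensor v w M N \<in> word_homs (v @ v') (w @ w')"
  using assms(1)
proof (induction rule: word_homs_induct)
  case zero
  then show ?case by (simp add: matrix_tensor_def word_homs_zero)
next
  case (add M \<psi> c)
  have "matrix_tensor v w (word_matrix v \<psi>) N \<in> word_homs (v @ v') (w @ w')"
    using assms(2)
  proof (induction rule: word_homs_induct)
    case zero
    then show ?case by (simp add: matrix_tensor_def word_homs_zero)
  next
    case (add N \<chi> c)
    have "matrix_tensor v w (word_matrix v \<psi>) (\<lambda>x y. N x y + c * word_matrix v' \<chi> x y)
       = (\<lambda>x y. matrix_tensor v w (word_matrix v \<psi>) N x y
           + c * matrix_tensor v w (word_matrix v \<psi>) (word_matrix v' \<chi>) x y)"
      by (simp add: matrix_tensor_def algebra_simps)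
    moreover have "matrix_tensor v w (word_matrix v \<psi>) (word_matrix v' \<chi>) \<in> word_homs (v @ v') (w @ w')"
      unfolding matrix_tensor_word_matrix[OF \<open>word_morphism v w \<psi>\<close>]
      by (intro word_homs_matrix word_morphism_tensor[OF \<open>word_morphism v w \<psi>\<close> add.hyps(2)])
    ultimately show ?case using word_homs_add[OF add.IH word_homs_scale] by simp
  qed
  moreover have "matrix_tensor v w (\<lambda>x y. M x y + c * word_matrix v \<psi> x y) N
       = (\<lambda>x y. matrix_tensor v w M N x y + c * matrix_tensor v w (word_matrix v \<psi>) N x y)"
    by (simp add: matrix_tensor_def algebra_simps)
  ultimately show ?case using word_homs_add[OF add.IH word_homs_scale] by simp
qed

lemma fund_sp4_crys_simps:
  "obj fund_sp4_crys = UNIV"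
  "hom (fund_sp4_crys :: (_, 'k::field crystal_arrow, _) lin_mon_cat) v w = {(v, M, w) |M. M \<in> word_homs v w}"
  "ident (fund_sp4_crys :: (_, 'k::field crystal_arrow, _) lin_mon_cat) v = (v, word_matrix v Some, v)"
  "compose fund_sp4_crys (v', N, w) (u, M, v) = (u, matrix_comp v M N, w)"
  "zero_mor fund_sp4_crys v w = (v, \<lambda>x y. 0, w)"
  "add_mor fund_sp4_crys (v, M, w) (v', N, w') = (v, \<lambda>x y. M x y + N x y, w)"
  "scale_mor fund_sp4_crys r (v, M, w) = (v, \<lambda>x y. r * M x y, w)"
  "unit_obj fund_sp4_crys = []" "tensor_obj fund_sp4_crys = (@)"
  "tensor_mor fund_sp4_crys (v, M, w) (v', N, w') = (v @ v', matrix_tensor v w M N, w @ w')"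
  by (simp_all add: fund_sp4_crys_def crystal_arrow_def matrix_comp_def matrix_tensor_def word_crystal_simps)

lemma matrix_comp_id_right:
  assumes "M \<in> word_homs v w"
  shows "matrix_comp w M (word_matrix w Some) = M"
proof (intro ext)
  fix x z
  have "matrix_comp w M (word_matrix w Some) x z = (\<Sum>y\<in>word_elts w. if y = z then M x z else 0)"
    unfolding matrix_comp_def by (intro sum.cong) (auto simp: word_matrix_eq)
  also have "\<dots> = M x z" using word_homs_support(2)[OF assms] by (auto simp: finite_word_elts)
  finally show "matrix_comp w M (word_matrix w Some) x z = M x z" .
qed

lemma matrix_comp_id_left:
  assumes "M \<in> word_homs v w"
  shows "matrix_comp v (word_matrix v Some) M = M"
proof (intro ext)
  fix x z
  have "matrix_comp v (word_matrix v Some) M x z = (\<Sum>y\<in>word_elts v. if y = x then M x z else 0)"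
    unfolding matrix_comp_def by (intro sum.cong) (auto simp: word_matrix_eq)
  also have "\<dots> = M x z" using word_homs_support(1)[OF assms] by (auto simp: finite_word_elts)
  finally show "matrix_comp v (word_matrix v Some) M x z = M x z" .
qed

lemma matrix_comp_assoc: "matrix_comp v M (matrix_comp w N L) = matrix_comp w (matrix_comp v M N) L"
proof (intro ext)
  fix x z
  have "matrix_comp v M (matrix_comp w N L) x z = (\<Sum>y\<in>word_elts v. \<Sum>u\<in>word_elts w. M x y * N y u * L u z)"
    by (simp add: matrix_comp_def sum_distrib_left mult.assoc)
  also have "\<dots> = (\<Sum>u\<in>word_elts w. \<Sum>y\<in>word_elts v. M x y * N y u * L u z)" by (rule sum.swap)
  also have "\<dots> = matrix_comp w (matrix_comp v M N) L x z"
    by (simp add: matrix_comp_def sum_distrib_right)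
  finally show "matrix_comp v M (matrix_comp w N L) x z = matrix_comp w (matrix_comp v M N) L x z" .
qed

text \<open>Cutting a list at \<open>length v\<close> identifies the basis of a tensor product with
  pairs of basis elements. The interchange law is this fact together with the product of two
  sums.\<close>

lemma sum_word_elts_append:
  "(\<Sum>y\<in>word_elts (v @ v'). f (take (length v) y) (drop (length v) y)) = (\<Sum>a\<in>word_elts v. \<Sum>b\<in>word_elts v'. f a b)"
proof -
  have "bij_betw (\<lambda>y. (take (length v) y, drop (length v) y)) (word_elts (v @ v')) (word_elts v \<times> word_elts v')"
    by (rule bij_betw_byWitness[where f' = "\<lambda>(a, b). a @ b"])
       (auto simp: map_eq_append_iff_take_drop)
  from sum.reindex_bij_betw[OF this, of "\<lambda>(a, b). f a b"] show ?thesis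
    by (simp add: sum.cartesian_product)
qed

lemma matrix_interchange:
  "matrix_tensor u w (matrix_comp v M N) (matrix_comp v' M' N')
    = matrix_comp (v @ v') (matrix_tensor u v M M') (matrix_tensor v w N N')"
proof (intro ext)
  fix x z
  have "matrix_comp (v @ v') (matrix_tensor u v M M') (matrix_tensor v w N N') x z
    = (\<Sum>a\<in>word_elts v. \<Sum>b\<in>word_elts v'. M (take (length u) x) a * M' (drop (length u) x) b
        * (N a (take (length w) z) * N' b (drop (length w) z)))"
    unfolding matrix_comp_def matrix_tensor_def
    by (rule sum_word_elts_append[where v = v and v' = v' and f = "\<lambda>a b. M (take (length u) x) a * M' (drop (length u) x) b
        * (N a (take (length w) z) * N' b (drop (length w) z))"])
  also have "\<dots> = matrix_tensor u w (matrix_comp v M N) (matrix_comp v' M' N') x z"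
    by (simp add: matrix_comp_def matrix_tensor_def sum_product mult_ac)
  finally show "matrix_tensor u w (matrix_comp v M N) (matrix_comp v' M' N') x z
    = matrix_comp (v @ v') (matrix_tensor u v M M') (matrix_tensor v w N N') x z" by (rule HOL.sym)
qed

lemma tensor_map_id: "tensor_map n Some Some = Some"
  by (simp add: tensor_map_def fun_eq_iff)

lemma matrix_tensor_id: "matrix_tensor v v (word_matrix v Some) (word_matrix v' Some) = word_matrix (v @ v') Some"
  by (simp add: matrix_tensor_word_matrix[OF word_morphism_id] tensor_map_id)

lemma matrix_tensor_assoc:
  "matrix_tensor (v @ v') (w @ w') (matrix_tensor v w M M') M'' = matrix_tensor v w M (matrix_tensor v' w' M' M'')"
  by (simp add: matrix_tensor_def fun_eq_iff take_drop add.commute mult.assoc min_absorb1)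

lemma matrix_tensor_unit_right:
  assumes "M \<in> word_homs v w"
  shows "matrix_tensor v w M (word_matrix [] Some) = M"
proof (intro ext)
  fix x y
  show "matrix_tensor v w M (word_matrix [] Some) x y = M x y"
  \<comment> \<open>A list that is too long leaves a nonempty tail for the unit factor, and there
    both sides vanish; otherwise \<open>take\<close> returns the whole list and \<open>drop\<close>
    the empty one.\<close>
  proof (cases "length x > length v \<or> length y > length w")
    case True
    then have "map letter_fund x \<noteq> v \<or> map letter_fund y \<noteq> w" by auto
    then have "M x y = 0" using word_homs_support[OF assms] by blast
    then show ?thesis using True by (auto simp: matrix_tensor_def word_matrix_eq simp del: word_crystal.simps)
  qed (auto simp: matrix_tensor_def word_matrix_eq simp del: word_crystal.simps)
qed

lemma matrix_tensor_unit_left: "matrix_tensor [] [] (word_matrix [] Some) M = M"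
  by (simp add: matrix_tensor_def word_matrix_eq del: word_crystal.simps)

lemma fund_sp4_crys_category: "linear_monoidal_category (fund_sp4_crys :: (_, 'k::field crystal_arrow, _) lin_mon_cat)"
proof -
  note [simp del] = word_crystal.simps
  show ?thesis
    apply (unfold_locales; (clarsimp simp: fund_sp4_crys_simps; fail)?)
    apply ((clarsimp simp: fund_sp4_crys_simps, (rule word_homs_matrix word_homs_zero matrix_comp_id_left matrix_comp_id_right
        matrix_tensor_unit_right matrix_tensor_unit_left word_homs_comp word_homs_add word_homs_scale word_homs_tensor word_morphism_id, ((assumption | rule word_morphism_id)+)?; fail)
       | (clarsimp simp: fund_sp4_crys_simps matrix_comp_assoc matrix_interchange matrix_tensor_id matrix_tensor_assoc; fail)
       | (clarsimp simp: fund_sp4_crys_simps fun_eq_iff matrix_comp_def matrix_tensor_def algebra_simps sum.distrib sum_distrib_left; fail))[1])+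
    done
qed

declare word_crystal.simps [simp del]

section \<open>The functor to crystals\<close>

text \<open>Each table arises by starting from the highest weight element of the wanted component,
  such as \<open>[X1, X4]\<close> of weight zero for \<open>Gc1\<close> or \<open>[Y1, Y2]\<close>
  of weight (2, 0) for \<open>Gd\<close>, and following the lowering operators on both sides.
  Arguments that are absent go to zero.\<close>

fun down_table :: "sp4_gen \<Rightarrow> (letter list \<times> letter list) list" where
  "down_table Gc1 = [([X1, X4], [])]"
| "down_table Gc2 = [([Y1, Y5], [])]"
| "down_table Gm = [([X1, X2], [Y1]), ([X1, X3], [Y2]), ([X2, X3], [Y3]), ([X2, X4], [Y4]),
     ([X3, X4], [Y5])]"
| "down_table Gt = [([X1, Y3], [X1]), ([X1, Y4], [X2]), ([X1, Y5], [X3]), ([X2, Y5], [X4])]"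
| "down_table Gb21 = [([Y1, X1], [X1, Y1]), ([Y1, X2], [X2, Y1]), ([Y1, X3], [X1, Y3]), ([Y1, X4], [X1, Y4]),
     ([Y2, X1], [X1, Y2]), ([Y2, X2], [X3, Y1]), ([Y2, X3], [X3, Y2]), ([Y2, X4], [X1, Y5]),
     ([Y3, X1], [X2, Y2]), ([Y3, X2], [X4, Y1]), ([Y3, X3], [X4, Y2]), ([Y3, X4], [X2, Y5]),
     ([Y4, X1], [X2, Y3]), ([Y4, X2], [X2, Y4]), ([Y4, X3], [X4, Y3]), ([Y4, X4], [X4, Y4]),
     ([Y5, X1], [X3, Y3]), ([Y5, X2], [X3, Y4]), ([Y5, X3], [X3, Y5]), ([Y5, X4], [X4, Y5])]"
| "down_table Gd = [([Y1, Y2], [X1, X1]), ([Y1, Y3], [X2, X1]), ([Y1, Y4], [X2, X2]), ([Y2, Y3], [X3, X1]),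
     ([Y2, Y4], [X3, X2]), ([Y2, Y5], [X3, X3]), ([Y3, Y3], [X4, X1]), ([Y3, Y4], [X4, X2]),
     ([Y3, Y5], [X4, X3]), ([Y4, Y5], [X4, X4])]"
| "down_table _ = []"

fun gen_table :: "sp4_gen \<Rightarrow> (letter list \<times> letter list) list" where
  "gen_table Gu1 = map prod.swap (down_table (greflect Gu1))"
| "gen_table Gu2 = map prod.swap (down_table (greflect Gu2))"
| "gen_table Gs = map prod.swap (down_table (greflect Gs))"
| "gen_table Gtb = map prod.swap (down_table (greflect Gtb))"
| "gen_table Gb12 = map prod.swap (down_table (greflect Gb12))"
| "gen_table Gdb = map prod.swap (down_table (greflect Gdb))"
| "gen_table g = down_table g"

definition gen_map :: "sp4_gen \<Rightarrow> letter list \<Rightarrow> letter list option" where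
  "gen_map g = map_of (gen_table g)"

primrec word_list :: "fund list \<Rightarrow> letter list list" where
  "word_list [] = [[]]"
| "word_list (a # w) = concat (map (\<lambda>x. map ((#) x) (word_list w))
     (case a of B1 \<Rightarrow> [X1, X2, X3, X4] | B2 \<Rightarrow> [Y1, Y2, Y3, Y4, Y5]))"

lemma set_word_list: "set (word_list w) = word_elts w"
proof (induction w)
  case (Cons a w)
  have "letter_fund x = a \<longleftrightarrow> x \<in> set (case a of B1 \<Rightarrow> [X1, X2, X3, X4] | B2 \<Rightarrow> [Y1, Y2, Y3, Y4, Y5])" for x
    by (cases a; cases x) auto
  with Cons show ?case by (auto simp: map_eq_Cons_conv)
qed simp

definition check_morphism :: "fund list \<Rightarrow> fund list \<Rightarrow> (letter list \<Rightarrow> letter list option) \<Rightarrow> bool" where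
  "check_morphism v w \<psi> \<longleftrightarrow> list_all (\<lambda>x.
     (case \<psi> x of None \<Rightarrow> True | Some y \<Rightarrow> map letter_fund y = w \<and> word_wt y = word_wt x) \<and>
     list_all (\<lambda>i. Option.bind (word_raise i x) \<psi> = Option.bind (\<psi> x) (word_raise i) \<and>
       Option.bind (word_lower i x) \<psi> = Option.bind (\<psi> x) (word_lower i)) [N1, N2]) (word_list v)"

lemma check_morphism:
  assumes "check_morphism v w \<psi>"
  shows "word_morphism v w \<psi>"
  unfolding word_morphism_def
proof (rule allI, rule impI)
  fix x assume "map letter_fund x = v"
  then have x: "x \<in> set (word_list v)" by (simp add: set_word_list)
  have "i \<in> set [N1, N2]" for i by (cases i) simp_all
  with x assms have a: "case \<psi> x of None \<Rightarrow> True | Some y \<Rightarrow> map letter_fund y = w \<and> word_wt y = word_wt x"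
    and b: "Option.bind (word_raise i x) \<psi> = Option.bind (\<psi> x) (word_raise i)"
      "Option.bind (word_lower i x) \<psi> = Option.bind (\<psi> x) (word_lower i)" for i
    unfolding check_morphism_def list_all_iff by blast+
  from a have "\<forall>y. \<psi> x = Some y \<longrightarrow> map letter_fund y = w \<and> word_wt y = word_wt x"
    by (simp split: option.splits)
  with b show "(\<forall>y. \<psi> x = Some y \<longrightarrow> map letter_fund y = w \<and> word_wt y = word_wt x) \<and>
     (\<forall>i. Option.bind (word_raise i x) \<psi> = Option.bind (\<psi> x) (word_raise i)) \<and>
     (\<forall>i. Option.bind (word_lower i x) \<psi> = Option.bind (\<psi> x) (word_lower i))"
    by blast
qed

lemma gen_map_morphism: "word_morphism (gsrc g) (gtgt g) (gen_map g)"
proof -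
  have "check_morphism (gsrc g) (gtgt g) (gen_map g)"
    if "g \<in> set [Gc1, Gc2, Gm, Gt, Gb21, Gd, Gu1, Gu2, Gs, Gtb, Gb12, Gdb]"
  proof -
    have "list_all (\<lambda>g. check_morphism (gsrc g) (gtgt g) (gen_map g))
      [Gc1, Gc2, Gm, Gt, Gb21, Gd, Gu1, Gu2, Gs, Gtb, Gb12, Gdb]" by code_simp
    then show ?thesis using that unfolding list_all_iff by blast
  qed
  moreover have "g \<in> set [Gc1, Gc2, Gm, Gt, Gb21, Gd, Gu1, Gu2, Gs, Gtb, Gb12, Gdb]" by (cases g) simp_all
  ultimately show ?thesis by (blast intro: check_morphism)
qed

text \<open>No table repeats a left or a right entry, so exchanging its columns gives the inverse
  partial map. This makes vertical reflection act as transposition on the generators.\<close>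

lemma gen_map_reflect: "gen_map (greflect g) y = Some x \<longleftrightarrow> gen_map g x = Some y"
proof -
  have swap: "map_of (map prod.swap l) y = Some x \<longleftrightarrow> map_of l x = Some y"
    if "distinct (map fst l) \<and> distinct (map snd l)" for l :: "(letter list \<times> letter list) list" and x y
  proof -
    have "distinct (map fst (map prod.swap l))" using that by (simp add: comp_def)
    then show ?thesis using that by (auto simp: map_of_eq_Some_iff)
  qed
  have "list_all (\<lambda>g. distinct (map fst (down_table g)) \<and> distinct (map snd (down_table g)))
      [Gc1, Gc2, Gm, Gt, Gb21, Gd]" by code_simp
  then show ?thesis unfolding gen_map_def
    using swap[of "down_table _"] by (cases g) (simp_all del: down_table.simps)
qed

definition gen_arrow :: "sp4_gen \<Rightarrow> 'k::field crystal_arrow" where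
  "gen_arrow g = crystal_arrow (gsrc g) (gtgt g) (gen_map g)"

abbreviation crys :: "'k::field sp4_term \<Rightarrow> 'k crystal_arrow" where
  "crys \<equiv> interp fund_sp4_crys gen_arrow"

interpretation crys: word_category_model "fund_sp4_crys :: (_, 'k::field crystal_arrow, _) lin_mon_cat" gsrc gtgt gen_arrow
proof -
  interpret linear_monoidal_category "fund_sp4_crys :: (_, 'k::field crystal_arrow, _) lin_mon_cat"
    by (rule fund_sp4_crys_category)
  show "word_category_model (fund_sp4_crys :: (_, 'k::field crystal_arrow, _) lin_mon_cat) gsrc gtgt gen_arrow"
    by unfold_locales
      (simp_all add: fund_sp4_crys_simps gen_arrow_def crystal_arrow_def word_homs_matrix gen_map_morphism)
qed

definition matrix_of :: "'k::field sp4_term \<Rightarrow> letter list \<Rightarrow> letter list \<Rightarrow> 'k" where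
  "matrix_of t = fst (snd (crys t))"

lemma crys_matrix_of: "has_type gsrc gtgt t a b \<Longrightarrow> crys t = (a, matrix_of t, b)"
  using crys.interp_hom[of t a b] by (auto simp: fund_sp4_crys_simps matrix_of_def)

lemma matrix_of_hom: "has_type gsrc gtgt t a b \<Longrightarrow> matrix_of t \<in> word_homs a b"
  using crys.interp_hom[of t a b] by (auto simp: fund_sp4_crys_simps matrix_of_def)

lemma matrix_of_simps:
  fixes s t :: "'k::field sp4_term"
  shows "matrix_of (Gen g :: 'k sp4_term) = word_matrix (gsrc g) (gen_map g)"
  "matrix_of (Ide a :: 'k sp4_term) = word_matrix a Some"
  "matrix_of (ZeroT a b :: 'k sp4_term) = (\<lambda>x y. 0)"
  "well_typed gsrc gtgt s \<Longrightarrow> well_typed gsrc gtgt t \<Longrightarrow> msrc gsrc s = mtgt gtgt t \<Longrightarrow>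
     matrix_of (s \<bullet> t) = matrix_comp (mtgt gtgt t) (matrix_of t) (matrix_of s)"
  "well_typed gsrc gtgt s \<Longrightarrow> well_typed gsrc gtgt t \<Longrightarrow>
     matrix_of (s \<boxdot> t) = matrix_tensor (msrc gsrc s) (mtgt gtgt s) (matrix_of s) (matrix_of t)"
  "well_typed gsrc gtgt s \<Longrightarrow> well_typed gsrc gtgt t \<Longrightarrow> matrix_of (s \<boxplus> t) = (\<lambda>x y. matrix_of s x y + matrix_of t x y)"
  "well_typed gsrc gtgt t \<Longrightarrow> matrix_of (ScaleT r t) = (\<lambda>x y. r * matrix_of t x y)"
proof -
  have ty: "crys u = (msrc gsrc u, matrix_of u, mtgt gtgt u)" if "well_typed gsrc gtgt u" for u :: "'k sp4_term"
    by (rule crys_matrix_of) (use that in \<open>simp add: has_type_def\<close>)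
  have m: "matrix_of u = M" if "crys u = (a, M, b)" for u :: "'k sp4_term" and a b M
    using that by (simp add: matrix_of_def)
  show "matrix_of (Gen g :: 'k sp4_term) = word_matrix (gsrc g) (gen_map g)" "matrix_of (Ide a :: 'k sp4_term) = word_matrix a Some"
    "matrix_of (ZeroT a b :: 'k sp4_term) = (\<lambda>x y. 0)"
    by (simp_all add: matrix_of_def fund_sp4_crys_simps gen_arrow_def crystal_arrow_def)
  show "matrix_of (ScaleT r t) = (\<lambda>x y. r * matrix_of t x y)" if "well_typed gsrc gtgt t"
    by (rule m) (use that in \<open>simp add: ty fund_sp4_crys_simps\<close>)
  assume s: "well_typed gsrc gtgt s" and t: "well_typed gsrc gtgt t"
  show "matrix_of (s \<boxdot> t) = matrix_tensor (msrc gsrc s) (mtgt gtgt s) (matrix_of s) (matrix_of t)"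
    by (rule m) (use s t in \<open>simp add: ty fund_sp4_crys_simps\<close>)
  show "matrix_of (s \<boxplus> t) = (\<lambda>x y. matrix_of s x y + matrix_of t x y)"
    by (rule m) (use s t in \<open>simp add: ty fund_sp4_crys_simps\<close>)
  show "matrix_of (s \<bullet> t) = matrix_comp (mtgt gtgt t) (matrix_of t) (matrix_of s)"
    if "msrc gsrc s = mtgt gtgt t"
    by (rule m) (use s t that in \<open>simp add: ty fund_sp4_crys_simps\<close>)
qed

lemma mirror_typed:
  assumes "well_typed gsrc gtgt t"
  shows "well_typed gsrc gtgt (mirror greflect t)" "msrc gsrc (mirror greflect t) = mtgt gtgt t"
    "mtgt gtgt (mirror greflect t) = msrc gsrc t"
proof -
  have "well_typed gsrc gtgt (mirror greflect t) \<and> msrc gsrc (mirror greflect t) = mtgt gtgt t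
    \<and> mtgt gtgt (mirror greflect t) = msrc gsrc t" using assms
  proof (induction t)
    case (Gen g)
    then show ?case by (cases g) auto
  qed auto
  then show "well_typed gsrc gtgt (mirror greflect t)" "msrc gsrc (mirror greflect t) = mtgt gtgt t"
    "mtgt gtgt (mirror greflect t) = msrc gsrc t" by auto
qed

text \<open>Transposition reverses matrix products and keeps the order of tensor factors, just as
  \<open>mirror\<close> does on terms. Hence a relation that holds in crystals brings its reflection
  with it.\<close>

lemma matrix_of_mirror:
  "well_typed gsrc gtgt t \<Longrightarrow> matrix_of (mirror greflect t) x y = matrix_of t y x"
proof (induction t arbitrary: x y)
  case (Gen g)
  have r: "gsrc (greflect g) = gtgt g" "gtgt (greflect g) = gsrc g" by (cases g; simp)+
  have "map letter_fund x = gtgt g \<and> gen_map g y = Some x \<longleftrightarrow> map letter_fund y = gsrc g \<and> gen_map g y = Some x"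
    using word_morphismD(1)[OF gen_map_morphism[of g], of y x]
      word_morphismD(1)[OF gen_map_morphism[of "greflect g"], of x y] by (auto simp: r gen_map_reflect)
  then show ?case by (simp add: matrix_of_simps word_matrix_eq r gen_map_reflect)
next
  case (Tens s t)
  then show ?case by (simp add: matrix_of_simps mirror_typed matrix_tensor_def)
next
  case (Comp s t)
  then show ?case by (simp add: matrix_of_simps mirror_typed matrix_comp_def mult.commute)
qed (auto simp: matrix_of_simps mirror_typed word_matrix_eq)

subsection \<open>Morphisms are determined on highest weight elements\<close>

primrec letter_rank :: "letter \<Rightarrow> nat" where
  "letter_rank X1 = 0" | "letter_rank X2 = 1" | "letter_rank X3 = 2" | "letter_rank X4 = 3"
| "letter_rank Y1 = 0" | "letter_rank Y2 = 1" | "letter_rank Y3 = 2" | "letter_rank Y4 = 3" | "letter_rank Y5 = 4"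

lemma word_raise_rank:
  "word_raise i x = Some y \<Longrightarrow> sum_list (map letter_rank y) < sum_list (map letter_rank x)"
proof (induction x arbitrary: y)
  case (Cons a x)
  have "letter_raise i a = Some b \<Longrightarrow> letter_rank b < letter_rank a" for b
    by (cases i; cases a) auto
  with Cons show ?case by (auto split: if_splits)
qed simp

definition highest_weight :: "letter list \<Rightarrow> bool" where
  "highest_weight x \<longleftrightarrow> (\<forall>i. word_raise i x = None)"

text \<open>A strict morphism sends x' to the lowered image of x, so y occurs there only if it can
  be raised, and then with the coefficient of the raised word. The formula is linear and passes to
  combinations.\<close>

lemma word_homs_lower:
  fixes M :: "letter list \<Rightarrow> letter list \<Rightarrow> 'k::field"
  assumes "M \<in> word_homs v w" "map letter_fund x = v" "word_lower i x = Some x'"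
  shows "M x' y = (case word_raise i y of None \<Rightarrow> 0 | Some z \<Rightarrow> M x z)"
  using assms(1)
proof (induction rule: word_homs_induct)
  case zero
  then show ?case by (simp split: option.splits)
next
  case (add M \<psi> c)
  have "word_raise i x' = Some x" using assms(3) by (simp add: word_raise_lower_iff)
  with word_raise_Some[OF this] assms(2) have x': "map letter_fund x' = v" by simp
  have "\<psi> x' = Option.bind (\<psi> x) (word_lower i)"
    using word_morphismD(4)[OF add.hyps(2) assms(2), of i] assms(3) by simp
  then have "\<psi> x' = Some y \<longleftrightarrow> (\<exists>z. \<psi> x = Some z \<and> word_raise i y = Some z)"
    by (simp add: bind_eq_Some_conv word_raise_lower_iff)
  then have "(word_matrix v \<psi> x' y :: 'k) = (case word_raise i y of None \<Rightarrow> 0 | Some z \<Rightarrow> word_matrix v \<psi> x z)"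
    using x' assms(2) by (auto simp: word_matrix_eq split: option.splits)
  with add.IH show ?case by (simp split: option.splits)
qed

text \<open>A word that is not of highest weight arises by lowering from one of smaller rank, so
  \<open>word_homs_lower\<close> carries the vanishing down from the highest weight words.\<close>

lemma word_homs_zeroI:
  assumes "M \<in> word_homs v w"
    and "\<And>x y. map letter_fund x = v \<Longrightarrow> highest_weight x \<Longrightarrow> M x y = 0"
  shows "M = (\<lambda>x y. 0)"
proof -
  have "M x y = 0" if "map letter_fund x = v" for x y
    using that
  proof (induction "sum_list (map letter_rank x)" arbitrary: x y rule: less_induct)
    case less
    show ?case
    proof (cases "highest_weight x")
      case False
      then obtain i x' where x': "word_raise i x = Some x'" by (auto simp: highest_weight_def)
      have l: "word_lower i x' = Some x" "map letter_fund x' = v"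
        using word_raise_Some[OF x'] less.prems by auto
      show ?thesis
        using word_homs_lower[OF assms(1) l(2,1)] less.hyps[OF word_raise_rank[OF x'] l(2)]
        by (simp split: option.splits)
    qed (use assms less.prems in auto)
  qed
  then show ?thesis using word_homs_support(1)[OF assms(1)] by (intro ext) blast
qed

lemma word_homs_eqI:
  assumes M: "M \<in> word_homs v w" and N: "N \<in> word_homs v w"
    and "\<And>x y. map letter_fund x = v \<Longrightarrow> highest_weight x \<Longrightarrow> M x y = N x y"
  shows "M = N"
proof -
  have "(\<lambda>x y. M x y + (- 1) * N x y) \<in> word_homs v w"
    by (intro word_homs_add M word_homs_scale N)
  from word_homs_zeroI[OF this] assms(3) have "M x y + (- 1) * N x y = 0" for x y
    by (simp add: fun_eq_iff)
  then show ?thesis by (intro ext) simp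
qed

definition highest_weight_words :: "fund list \<Rightarrow> letter list list" where
  "highest_weight_words w = filter (\<lambda>x. word_raise N1 x = None \<and> word_raise N2 x = None) (word_list w)"

lemma highest_weight_words: "set (highest_weight_words w) = {x. map letter_fund x = w \<and> highest_weight x}"
proof -
  have "highest_weight x \<longleftrightarrow> word_raise N1 x = None \<and> word_raise N2 x = None" for x
    unfolding highest_weight_def by (metis node.exhaust)
  then show ?thesis by (auto simp: highest_weight_words_def set_word_list)
qed

lemma highest_weight_words_simps:
  "highest_weight_words [] = [[]]"
  "highest_weight_words [B1] = [[X1]]"
  "highest_weight_words [B2] = [[Y1]]"
  "highest_weight_words [B1, B1] = [[X1, X1], [X1, X2], [X1, X4]]"
  "highest_weight_words [B1, B2] = [[X1, Y1], [X1, Y3]]"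
  "highest_weight_words [B2, B1] = [[Y1, X1], [Y1, X3]]"
  "highest_weight_words [B2, B2] = [[Y1, Y1], [Y1, Y2], [Y1, Y5]]"
  "highest_weight_words [B1, B1, B1] = [[X1, X1, X1], [X1, X1, X2], [X1, X1, X4], [X1, X2, X1], [X1, X2, X3], [X1, X4, X1]]"
  "highest_weight_words [B1, B1, B2] = [[X1, X1, Y1], [X1, X1, Y3], [X1, X1, Y4], [X1, X2, Y1], [X1, X2, Y2], [X1, X2, Y5], [X1, X4, Y1]]"
  "highest_weight_words [B1, B2, B1] = [[X1, Y1, X1], [X1, Y1, X2], [X1, Y1, X3], [X1, Y1, X4], [X1, Y3, X1], [X1, Y3, X2], [X1, Y3, X4]]"
  "highest_weight_words [B1, B2, B2] = [[X1, Y1, Y1], [X1, Y1, Y2], [X1, Y1, Y3], [X1, Y1, Y5], [X1, Y3, Y1], [X1, Y3, Y3]]"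
  "highest_weight_words [B2, B1, B1] = [[Y1, X1, X1], [Y1, X1, X2], [Y1, X1, X3], [Y1, X1, X4], [Y1, X3, X1], [Y1, X3, X2], [Y1, X3, X4]]"
  "highest_weight_words [B2, B1, B2] = [[Y1, X1, Y1], [Y1, X1, Y2], [Y1, X1, Y3], [Y1, X1, Y5], [Y1, X3, Y1], [Y1, X3, Y3]]"
  "highest_weight_words [B2, B2, B1] = [[Y1, Y1, X1], [Y1, Y1, X3], [Y1, Y2, X1], [Y1, Y2, X2], [Y1, Y2, X4], [Y1, Y5, X1]]"
  "highest_weight_words [B2, B2, B2] = [[Y1, Y1, Y1], [Y1, Y1, Y2], [Y1, Y1, Y5], [Y1, Y2, Y1], [Y1, Y2, Y3], [Y1, Y2, Y4], [Y1, Y5, Y1]]"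
  by code_simp+

subsection \<open>The relations hold in crystals\<close>

primrec coefficient :: "('k::field \<times> letter list) list \<Rightarrow> letter list \<Rightarrow> 'k" where
  "coefficient [] y = 0"
| "coefficient (p # l) y = (if snd p = y then fst p else 0) + coefficient l y"

text \<open>A symbolic evaluation of terms: linear combinations are lists of coefficients and words,
  repetitions allowed, and \<open>coefficient\<close> collects them. In contrast to sums over all
  words of a crystal, such lists can be computed by rewriting over an arbitrary field.\<close>

fun apply_term :: "'k::field sp4_term \<Rightarrow> letter list \<Rightarrow> ('k \<times> letter list) list" where
  "apply_term (Gen g) x = (case gen_map g x of None \<Rightarrow> [] | Some y \<Rightarrow> [(1, y)])"
| "apply_term (Ide a) x = [(1, x)]"
| "apply_term (s \<bullet> t) x = concat (map (\<lambda>p. map (\<lambda>q. (fst p * fst q, snd q)) (apply_term s (snd p))) (apply_term t x))"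
| "apply_term (s \<boxdot> t) x = concat (map (\<lambda>p. map (\<lambda>q. (fst p * fst q, snd p @ snd q))
     (apply_term t (drop (length (msrc gsrc s)) x))) (apply_term s (take (length (msrc gsrc s)) x)))"
| "apply_term (ZeroT a b) x = []"
| "apply_term (s \<boxplus> t) x = apply_term s x @ apply_term t x"
| "apply_term (ScaleT r t) x = map (\<lambda>p. (r * fst p, snd p)) (apply_term t x)"

lemma coefficient_append: "coefficient (l @ l') y = coefficient l y + coefficient l' y"
  by (induction l) (auto simp: add.assoc)

lemma coefficient_scale: "coefficient (map (\<lambda>p. (c * fst p, snd p)) l) y = c * coefficient l y"
  by (induction l) (auto simp: algebra_simps)

lemma coefficient_concat:
  assumes "snd ` set l \<subseteq> A" "finite A"
  shows "coefficient (concat (map (\<lambda>p. map (\<lambda>q. (fst p * fst q, snd q)) (f (snd p)))  l)) y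
    = (\<Sum>z\<in>A. coefficient l z * coefficient (f z) y)"
  using assms(1)
proof (induction l)
  case (Cons p l)
  have "(\<Sum>z\<in>A. (if snd p = z then fst p else 0) * coefficient (f z) y) = fst p * coefficient (f (snd p)) y"
    using Cons.prems assms(2) by (simp add: if_distrib[of "\<lambda>c. c * _"] cong: if_cong)
  with Cons show ?case by (simp add: coefficient_append coefficient_scale distrib_right sum.distrib)
qed simp

lemma coefficient_tensor:
  assumes "\<forall>p\<in>set l. length (snd p) = n"
  shows "coefficient (concat (map (\<lambda>p. map (\<lambda>q. (fst p * fst q, snd p @ snd q)) l') l)) y
    = coefficient l (take n y) * coefficient l' (drop n y)"
  using assms
proof (induction l)
  case (Cons p l)
  have "coefficient (map (\<lambda>q. (fst p * fst q, snd p @ snd q)) l') y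
    = (if snd p = take n y then fst p else 0) * coefficient l' (drop n y)"
  proof (induction l')
    case (Cons q l')
    have "snd p @ snd q = y \<longleftrightarrow> snd p = take n y \<and> snd q = drop n y"
      using \<open>\<forall>p\<in>set (p # l). length (snd p) = n\<close> by (auto simp: append_eq_conv_conj)
    with Cons show ?case by (simp add: algebra_simps)
  qed simp
  with Cons show ?case by (simp add: coefficient_append algebra_simps)
qed simp

lemma apply_term_range:
  "well_typed gsrc gtgt t \<Longrightarrow> map letter_fund x = msrc gsrc t \<Longrightarrow> p \<in> set (apply_term t x)
    \<Longrightarrow> map letter_fund (snd p) = mtgt gtgt t"
proof (induction t arbitrary: x p)
  case (Gen g)
  from Gen.prems(3) obtain y where y: "gen_map g x = Some y" "p = (1, y)"
    by (cases "gen_map g x") simp_all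
  from word_morphismD(1)[OF gen_map_morphism _ y(1)] Gen.prems(2) y(2) show ?case by simp
next
  case (Comp s t)
  from Comp.prems(3) obtain q r where q: "q \<in> set (apply_term t x)" and r: "r \<in> set (apply_term s (snd q))"
    and p: "snd p = snd r" by auto
  have "map letter_fund (snd q) = mtgt gtgt t" by (rule Comp.IH(2)[OF _ _ q]) (use Comp.prems in simp_all)
  then have "map letter_fund (snd r) = mtgt gtgt s" by (intro Comp.IH(1)[OF _ _ r]) (use Comp.prems in simp_all)
  then show ?case by (simp add: p)
next
  case (Tens s t)
  have "map letter_fund (take (length (msrc gsrc s)) x) = msrc gsrc s"
    "map letter_fund (drop (length (msrc gsrc s)) x) = msrc gsrc t"
    using Tens.prems(2) by (simp_all only: msrc.simps map_eq_append_iff_take_drop)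
  note x = this
  from Tens.prems(3) obtain q r where q: "q \<in> set (apply_term s (take (length (msrc gsrc s)) x))"
    and r: "r \<in> set (apply_term t (drop (length (msrc gsrc s)) x))" and p: "snd p = snd q @ snd r" by auto
  have "map letter_fund (snd q) = mtgt gtgt s" by (rule Tens.IH(1)[OF _ x(1) q]) (use Tens.prems in simp)
  moreover have "map letter_fund (snd r) = mtgt gtgt t" by (rule Tens.IH(2)[OF _ x(2) r]) (use Tens.prems in simp)
  ultimately show ?case by (simp add: p)
next
  case (AddT s t)
  from AddT.prems(3) consider "p \<in> set (apply_term s x)" | "p \<in> set (apply_term t x)" by auto
  then show ?case
  proof cases
    case 1
    from AddT.IH(1)[OF _ _ 1] AddT.prems(1,2) show ?thesis by simp
  next
    case 2
    from AddT.IH(2)[OF _ _ 2] AddT.prems(1,2) show ?thesis by simp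
  qed
next
  case (ScaleT r t)
  from ScaleT.prems(3) obtain q where q: "q \<in> set (apply_term t x)" "snd p = snd q" by auto
  from ScaleT.IH[OF _ _ q(1)] ScaleT.prems(1,2) q(2) show ?case by simp
qed simp_all

lemma matrix_of_apply_term:
  "well_typed gsrc gtgt t \<Longrightarrow> map letter_fund x = msrc gsrc t \<Longrightarrow> matrix_of t x y = coefficient (apply_term t x) y"
proof (induction t arbitrary: x y)
  case (Gen g)
  then show ?case by (auto simp: matrix_of_simps word_matrix_eq split: option.splits)
next
  case (Comp s t)
  have "snd ` set (apply_term t x) \<subseteq> word_elts (mtgt gtgt t)"
    using apply_term_range[of t x] Comp.prems by auto
  note c = coefficient_concat[OF this finite_word_elts]
  show ?case using Comp
    by (simp add: matrix_of_simps matrix_comp_def c)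
next
  case (Tens s t)
  have x: "map letter_fund (take (length (msrc gsrc s)) x) = msrc gsrc s"
    "map letter_fund (drop (length (msrc gsrc s)) x) = msrc gsrc t"
    using Tens.prems(2) by (simp_all only: msrc.simps map_eq_append_iff_take_drop)
  have "length (snd p) = length (mtgt gtgt s)" if "p \<in> set (apply_term s (take (length (msrc gsrc s)) x))" for p
    using apply_term_range[OF _ x(1) that] Tens.prems(1) by (metis length_map well_typed.simps(2))
  then have l: "\<forall>p\<in>set (apply_term s (take (length (msrc gsrc s)) x)). length (snd p) = length (mtgt gtgt s)" by blast
  show ?case using Tens x
    by (simp add: matrix_of_simps matrix_tensor_def coefficient_tensor[OF l])
qed (auto simp: matrix_of_simps word_matrix_eq coefficient_append coefficient_scale)

text \<open>Only the highest weight words of the source are tested, which suffices by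
  \<open>word_homs_eqI\<close> and leaves at most seven evaluations for each of the defining
  relations.\<close>

definition crystal_relation :: "'k::field sp4_term \<Rightarrow> 'k sp4_term \<Rightarrow> bool" where
  "crystal_relation l r \<longleftrightarrow> well_typed gsrc gtgt l \<and> well_typed gsrc gtgt r \<and> msrc gsrc l = msrc gsrc r \<and>
     mtgt gtgt l = mtgt gtgt r \<and>
     (\<forall>x\<in>set (highest_weight_words (msrc gsrc l)). \<forall>y. coefficient (apply_term l x) y = coefficient (apply_term r x) y)"

lemma crystal_relation_matrix:
  assumes "crystal_relation l r"
  shows "matrix_of l = matrix_of r"
proof (rule word_homs_eqI)
  have *: "well_typed gsrc gtgt l" "well_typed gsrc gtgt r" "msrc gsrc l = msrc gsrc r" "mtgt gtgt l = mtgt gtgt r"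
    using assms by (auto simp: crystal_relation_def)
  show "matrix_of l \<in> word_homs (msrc gsrc l) (mtgt gtgt l)" "matrix_of r \<in> word_homs (msrc gsrc l) (mtgt gtgt l)"
    using * by (simp_all add: matrix_of_hom has_type_def)
  show "matrix_of l x y = matrix_of r x y" if "map letter_fund x = msrc gsrc l" "highest_weight x" for x y
    using assms that by (simp add: crystal_relation_def matrix_of_apply_term highest_weight_words)
qed

lemma gen_map_simps:
  "gen_map g x = map_of (gen_table g) x"
  by (simp add: gen_map_def)

lemma sp4_relations_crystal: "\<forall>(l, r) \<in> sp4_relations. crystal_relation l r"
  unfolding sp4_relations_def
  apply (simp only: ball_simps prod.case)
  apply (intro conjI TrueI)
  apply (simp add: crystal_relation_def highest_weight_words_simps gen_map_simps; fail)+
  done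

lemma crys_relations:
  assumes "(s, t) \<in> sp4_all_relations" "has_type gsrc gtgt s a b" "has_type gsrc gtgt t a b"
  shows "crys s = crys t"
proof -
  have "matrix_of s = matrix_of t"
  proof (cases "(s, t) \<in> sp4_relations")
    case True
    then show ?thesis using sp4_relations_crystal crystal_relation_matrix by blast
  next
    case False
    then obtain l r where lr: "(l, r) \<in> sp4_relations" "s = mirror greflect l" "t = mirror greflect r"
      using assms(1) by (auto simp: sp4_all_relations_def)
    then have c: "crystal_relation l r" using sp4_relations_crystal by blast
    then have "well_typed gsrc gtgt l" "well_typed gsrc gtgt r" by (simp_all add: crystal_relation_def)
    then show ?thesis
      using crystal_relation_matrix[OF c] by (simp add: fun_eq_iff lr matrix_of_mirror)
  qed
  then show ?thesis using assms(2,3) by (simp add: crys_matrix_of)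
qed

section \<open>A ring containing the presented category\<close>

context linear_monoidal_category
begin

definition whisker :: "'o \<Rightarrow> 'm \<Rightarrow> 'o \<Rightarrow> 'm" where
  "whisker u f v = (ident C u \<otimes> f) \<otimes> ident C v"

context
  fixes u v
  assumes u: "u \<in> obj C" and v: "v \<in> obj C"
begin

lemma whisker_comp:
  assumes "f \<in> hom C a b" "g \<in> hom C b c"
  shows "whisker u (g \<cdot> f) v = whisker u g v \<cdot> whisker u f v"
proof -
  have iu: "ident C u \<in> hom C u u" and iv: "ident C v \<in> hom C v v" using u v ident_hom by auto
  have "whisker u (g \<cdot> f) v = ((ident C u \<cdot> ident C u) \<otimes> (g \<cdot> f)) \<otimes> (ident C v \<cdot> ident C v)"
    by (simp add: whisker_def comp_ident_left[OF iu] comp_ident_left[OF iv])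
  also have "\<dots> = whisker u g v \<cdot> whisker u f v"
    unfolding whisker_def interchange[OF iu iu assms]
    by (rule interchange[OF tensor_hom[OF iu assms(1)] tensor_hom[OF iu assms(2)] iv iv])
  finally show ?thesis .
qed

lemma whisker_add:
  assumes "f \<in> hom C a b" "g \<in> hom C a b"
  shows "whisker u (f \<oplus> g) v = whisker u f v \<oplus> whisker u g v"
proof -
  have iu: "ident C u \<in> hom C u u" and iv: "ident C v \<in> hom C v v" using u v ident_hom by auto
  show ?thesis unfolding whisker_def tensor_add_right[OF iu assms]
    by (rule tensor_add_left[OF tensor_hom[OF iu assms(1)] tensor_hom[OF iu assms(2)] iv])
qed

lemma whisker_scale:
  assumes "f \<in> hom C a b"
  shows "whisker u (r \<odot> f) v = r \<odot> whisker u f v"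
proof -
  have iu: "ident C u \<in> hom C u u" and iv: "ident C v \<in> hom C v v" using u v ident_hom by auto
  show ?thesis unfolding whisker_def tensor_scale_right[OF iu assms]
    by (rule tensor_scale_left[OF tensor_hom[OF iu assms] iv])
qed

lemma whisker_ident: "w \<in> obj C \<Longrightarrow> whisker u (ident C w) v = ident C (u \<boxtimes> w \<boxtimes> v)"
  using u v by (simp add: whisker_def tensor_ident tensor_obj tensor_obj_assoc)

lemma whisker_ident_tensor:
  assumes "f \<in> hom C a b" "w \<in> obj C"
  shows "whisker u (ident C w \<otimes> f) v = whisker (u \<boxtimes> w) f v"
    and "whisker u (f \<otimes> ident C w) v = whisker u f (w \<boxtimes> v)"
proof -
  have iu: "ident C u \<in> hom C u u" and iv: "ident C v \<in> hom C v v" and iw: "ident C w \<in> hom C w w"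
    using u v assms ident_hom by auto
  show "whisker u (ident C w \<otimes> f) v = whisker (u \<boxtimes> w) f v"
    unfolding whisker_def tensor_ident[OF u assms(2), symmetric] tensor_assoc[OF iu iw assms(1)] by simp
  show "whisker u (f \<otimes> ident C w) v = whisker u f (w \<boxtimes> v)"
    unfolding whisker_def tensor_ident[OF assms(2) v, symmetric]
      tensor_assoc[OF iu assms(1) iw, symmetric] tensor_assoc[OF tensor_hom[OF iu assms(1)] iw iv] by simp
qed

text \<open>Either factor may be applied first: this is the interchange law with identities inserted
  on one side or the other.\<close>

lemma whisker_tensor:
  assumes f: "f \<in> hom C a b" and g: "g \<in> hom C c d"
  shows "whisker u (f \<otimes> g) v = whisker u f (d \<boxtimes> v) \<cdot> whisker (u \<boxtimes> a) g v"
    and "whisker u (f \<otimes> g) v = whisker (u \<boxtimes> b) g v \<cdot> whisker u f (c \<boxtimes> v)"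
proof -
  have o: "a \<in> obj C" "b \<in> obj C" "c \<in> obj C" "d \<in> obj C" using hom_obj f g by auto
  note i = o[THEN ident_hom]
  have "f \<otimes> g = (f \<cdot> ident C a) \<otimes> (ident C d \<cdot> g)"
    by (simp add: comp_ident_right[OF f] comp_ident_left[OF g])
  also have "\<dots> = (f \<otimes> ident C d) \<cdot> (ident C a \<otimes> g)"
    by (rule interchange[OF i(1) f g i(4)])
  finally have "whisker u (f \<otimes> g) v = whisker u ((f \<otimes> ident C d) \<cdot> (ident C a \<otimes> g)) v" by simp
  also have "\<dots> = whisker u f (d \<boxtimes> v) \<cdot> whisker (u \<boxtimes> a) g v"
    by (simp add: whisker_comp[OF tensor_hom[OF i(1) g] tensor_hom[OF f i(4)]]
        whisker_ident_tensor[OF f o(4)] whisker_ident_tensor[OF g o(1)])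
  finally show "whisker u (f \<otimes> g) v = whisker u f (d \<boxtimes> v) \<cdot> whisker (u \<boxtimes> a) g v" .
  have "f \<otimes> g = (ident C b \<cdot> f) \<otimes> (g \<cdot> ident C c)"
    by (simp add: comp_ident_left[OF f] comp_ident_right[OF g])
  also have "\<dots> = (ident C b \<otimes> g) \<cdot> (f \<otimes> ident C c)"
    by (rule interchange[OF f i(2) i(3) g])
  finally have "whisker u (f \<otimes> g) v = whisker u ((ident C b \<otimes> g) \<cdot> (f \<otimes> ident C c)) v" by simp
  also have "\<dots> = whisker (u \<boxtimes> b) g v \<cdot> whisker u f (c \<boxtimes> v)"
    by (simp add: whisker_comp[OF tensor_hom[OF f i(3)] tensor_hom[OF i(2) g]]
        whisker_ident_tensor[OF f o(3)] whisker_ident_tensor[OF g o(2)])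
  finally show "whisker u (f \<otimes> g) v = whisker (u \<boxtimes> b) g v \<cdot> whisker u f (c \<boxtimes> v)" .
qed

end

end

context linear_monoidal_category
begin

text \<open>The axioms of the locale say nothing about composites, multiples and whiskers of
  \<open>zero_mor\<close>. Additivity makes each of them equal to twice itself, and this lemma then
  identifies it with zero.\<close>

lemma add_self_zero:
  assumes "f \<in> hom C a b" "f \<oplus> f = f"
  shows "f = zero_mor C a b"
proof -
  have n: "(- 1) \<odot> f \<in> hom C a b" by (rule scale_hom[OF assms(1)])
  have "f = f \<oplus> (f \<oplus> (- 1) \<odot> f)" by (simp add: add_inverse[OF assms(1)] add_zero[OF assms(1)])
  also have "\<dots> = (f \<oplus> f) \<oplus> (- 1) \<odot> f" by (rule add_assoc[OF assms(1,1) n, THEN HOL.sym])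
  also have "\<dots> = zero_mor C a b" by (simp add: assms(2) add_inverse[OF assms(1)])
  finally show ?thesis .
qed

lemma zero_add_zero: "a \<in> obj C \<Longrightarrow> b \<in> obj C \<Longrightarrow> zero_mor C a b \<oplus> zero_mor C a b = zero_mor C a b"
  by (rule add_zero[OF zero_hom])

lemma comp_zero_right: "g \<in> hom C b c \<Longrightarrow> a \<in> obj C \<Longrightarrow> g \<cdot> zero_mor C a b = zero_mor C a c"
  using hom_obj[of g b c] comp_add_right[OF zero_hom zero_hom, of a b g c]
  by (intro add_self_zero comp_hom[OF zero_hom]) (auto simp: zero_add_zero)

lemma scale_zero: "a \<in> obj C \<Longrightarrow> b \<in> obj C \<Longrightarrow> r \<odot> zero_mor C a b = zero_mor C a b"
  using scale_add_right[OF zero_hom zero_hom, of a b r]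
  by (intro add_self_zero scale_hom[OF zero_hom]) (auto simp: zero_add_zero)

lemma whisker_zero:
  assumes "u \<in> obj C" "v \<in> obj C" "a \<in> obj C" "b \<in> obj C"
  shows "whisker u (zero_mor C a b) v = zero_mor C (u \<boxtimes> a \<boxtimes> v) (u \<boxtimes> b \<boxtimes> v)"
proof (rule add_self_zero)
  have "whisker u (zero_mor C a b) v \<in> hom C ((u \<boxtimes> a) \<boxtimes> v) ((u \<boxtimes> b) \<boxtimes> v)"
    unfolding whisker_def using assms by (intro tensor_hom ident_hom zero_hom)
  then show "whisker u (zero_mor C a b) v \<in> hom C (u \<boxtimes> a \<boxtimes> v) (u \<boxtimes> b \<boxtimes> v)"
    using assms by (simp add: tensor_obj_assoc)
  show "whisker u (zero_mor C a b) v \<oplus> whisker u (zero_mor C a b) v = whisker u (zero_mor C a b) v"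
    using whisker_add[OF assms(1,2) zero_hom zero_hom, of a b] assms by (simp add: zero_add_zero)
qed

end

section \<open>Morphisms as additive maps on families\<close>

abbreviation sp4_eq :: "fund list \<Rightarrow> fund list \<Rightarrow> 'k::field sp4_term \<Rightarrow> 'k sp4_term \<Rightarrow> bool" where
  "sp4_eq \<equiv> term_eq gsrc gtgt sp4_all_relations"

abbreviation sp4_typed :: "'k::field sp4_term \<Rightarrow> fund list \<Rightarrow> fund list \<Rightarrow> bool" where
  "sp4_typed \<equiv> has_type gsrc gtgt"

abbreviation "sp4_wt \<equiv> well_typed gsrc gtgt"
abbreviation "sp4_src \<equiv> msrc gsrc"
abbreviation "sp4_tgt \<equiv> mtgt gtgt"

interpretation sp4: linear_monoidal_category "sp4_category :: (_, 'k::field sp4_term set, _) lin_mon_cat"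
  unfolding sp4_category_def by (rule presented_linear_monoidal_category)

lemma sp4_eq_self: "sp4_eq a b t t \<longleftrightarrow> sp4_typed t a b"
  by (auto intro: term_eq.refl dest: term_eq_types)

lemma sp4_typedI: "sp4_wt t \<Longrightarrow> sp4_typed t (sp4_src t) (sp4_tgt t)"
  by (simp add: has_type_def)

lemma sp4_typed_zero: "sp4_typed (ZeroT a b) a b"
  by (simp add: has_type_def)

text \<open>A family contains one morphism \<open>a \<rightarrow> b\<close> for each pair of words; terms act on families by
  composition, so that morphisms of all types become elements of one ring.\<close>

definition family_eq :: "(fund list \<Rightarrow> fund list \<Rightarrow> 'k::field sp4_term) \<Rightarrow> (fund list \<Rightarrow> fund list \<Rightarrow> 'k sp4_term) \<Rightarrow> bool" where
  "family_eq f g \<longleftrightarrow> (\<forall>a b. sp4_eq a b (f a b) (g a b))"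

\<comment> \<open>The quotient is partial because \<open>family_eq f f\<close> expresses that each
  entry \<open>f a b\<close> is typed from a to b; ill-typed families are left out.\<close>
quotient_type (overloaded) 'k family = "fund list \<Rightarrow> fund list \<Rightarrow> 'k::field sp4_term" / partial: family_eq
proof (rule part_equivpI)
  show "\<exists>f :: fund list \<Rightarrow> fund list \<Rightarrow> 'k sp4_term. family_eq f f"
    by (rule exI[of _ ZeroT]) (simp add: family_eq_def term_eq.refl has_type_def)
  show "symp (family_eq :: (fund list \<Rightarrow> fund list \<Rightarrow> 'k sp4_term) \<Rightarrow> _)"
    by (auto simp: symp_def family_eq_def intro: term_eq.sym)
  show "transp (family_eq :: (fund list \<Rightarrow> fund list \<Rightarrow> 'k sp4_term) \<Rightarrow> _)"
    unfolding transp_def family_eq_def by (blast intro: term_eq.trans)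
qed

instantiation family :: (field) ab_group_add
begin

lift_definition zero_family :: "'a family" is ZeroT
  by (simp add: family_eq_def term_eq.refl has_type_def)

lift_definition plus_family :: "'a family \<Rightarrow> 'a family \<Rightarrow> 'a family" is "\<lambda>f g a b. f a b \<boxplus> g a b"
  by (simp add: family_eq_def term_eq.cong_add)

lift_definition uminus_family :: "'a family \<Rightarrow> 'a family" is "\<lambda>f a b. ScaleT (- 1) (f a b)"
  by (simp add: family_eq_def term_eq.cong_scale)

definition minus_family :: "'a family \<Rightarrow> 'a family \<Rightarrow> 'a family" where
  "minus_family x y = x + - y"

instance
proof
  fix x y z :: "'a family"
  show "x + y + z = x + (y + z)"
    by transfer (auto simp: family_eq_def sp4_eq_self intro!: term_eq.add_assoc)
  show c: "x + y = y + x" for x y :: "'a family"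
    by transfer (auto simp: family_eq_def sp4_eq_self intro!: term_eq.add_commute)
  have "x + 0 = x"
    by transfer (auto simp: family_eq_def sp4_eq_self intro!: term_eq.add_zero)
  then show "0 + x = x" by (simp add: c)
  have "x + - x = 0"
    by transfer (auto simp: family_eq_def sp4_eq_self intro!: term_eq.add_inverse)
  then show "- x + x = 0" by (simp add: c)
  show "x - y = x + - y" by (rule minus_family_def)
qed

end

text \<open>With composition as product these maps form a ring, so associativity and distributivity
  hold without conditions on types and ordinary ring simplification becomes available.\<close>

typedef (overloaded) 'g endo = "{f :: 'g::ab_group_add \<Rightarrow> 'g. \<forall>x y. f (x + y) = f x + f y}"
  by (rule exI[of _ id]) simp

setup_lifting type_definition_endo

instantiation endo :: (ab_group_add) ring
begin

lift_definition zero_endo :: "'a endo" is "\<lambda>x. 0" by simp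
lift_definition plus_endo :: "'a endo \<Rightarrow> 'a endo \<Rightarrow> 'a endo" is "\<lambda>f g x. f x + g x" by (simp add: algebra_simps)
lift_definition minus_endo :: "'a endo \<Rightarrow> 'a endo \<Rightarrow> 'a endo" is "\<lambda>f g x. f x - g x" by (simp add: algebra_simps)
lift_definition uminus_endo :: "'a endo \<Rightarrow> 'a endo" is "\<lambda>f x. - f x" by simp
lift_definition times_endo :: "'a endo \<Rightarrow> 'a endo \<Rightarrow> 'a endo" is "\<lambda>f g x. f (g x)" by simp

instance
  by (standard; transfer; auto simp: algebra_simps)

end

text \<open>Entries whose target is not that of \<open>t\<close> are sent to zero, as for matrix
  units. A product of terms that do not compose is therefore zero instead of undefined.\<close>

definition act_family :: "'k::field sp4_term \<Rightarrow> (fund list \<Rightarrow> fund list \<Rightarrow> 'k sp4_term) \<Rightarrow> fund list \<Rightarrow> fund list \<Rightarrow> 'k sp4_term" where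
  "act_family t f a b = (if sp4_wt t \<and> b = sp4_tgt t then t \<bullet> f a (sp4_src t) else ZeroT a b)"

lift_definition apply_family :: "'k::field sp4_term \<Rightarrow> 'k family \<Rightarrow> 'k family" is act_family
  by (auto simp: family_eq_def act_family_def sp4_eq_self sp4_typed_zero sp4_typedI intro!: term_eq.cong_comp)

lift_definition scale_family :: "'k::field \<Rightarrow> 'k family \<Rightarrow> 'k family" is "\<lambda>r f a b. ScaleT r (f a b)"
  by (simp add: family_eq_def term_eq.cong_scale)

lemma sp4_class_ops:
  "sp4_wt f \<Longrightarrow> sp4_wt g \<Longrightarrow> sp4_src g = sp4_tgt f \<Longrightarrow>
    sp4_class (g \<bullet> f) = compose sp4_category (sp4_class g) (sp4_class f)"
  "sp4_wt f \<Longrightarrow> sp4_wt g \<Longrightarrow> sp4_src f = sp4_src g \<Longrightarrow> sp4_tgt f = sp4_tgt g \<Longrightarrow>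
    sp4_class (f \<boxplus> g) = add_mor sp4_category (sp4_class f) (sp4_class g)"
  "sp4_wt f \<Longrightarrow> sp4_class (ScaleT r f) = scale_mor sp4_category r (sp4_class f)"
  "sp4_wt f \<Longrightarrow> sp4_wt g \<Longrightarrow> sp4_class (f \<boxdot> g) = tensor_mor sp4_category (sp4_class f) (sp4_class g)"
  "sp4_class (Ide a) = ident sp4_category a"
  "sp4_class (ZeroT a b) = zero_mor sp4_category a b"
  by (simp_all add: sp4_class_def sp4_category_def presented_ops presented_simps)

lemma sp4_class_hom: "sp4_wt f \<Longrightarrow> sp4_class f \<in> hom sp4_category (sp4_src f) (sp4_tgt f)"
  by (auto simp: sp4_class_def sp4_category_def presented_simps)

lemma sp4_obj: "obj sp4_category = UNIV" "tensor_obj sp4_category = (@)"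
  by (simp_all add: sp4_category_def presented_simps)

lemma sp4_eq_class:
  "sp4_typed s a b \<Longrightarrow> sp4_typed t a b \<Longrightarrow> sp4_eq a b s t \<longleftrightarrow> sp4_class s = sp4_class t"
  by (simp add: sp4_class_def term_class_eq_iff)

lemma sp4_zero_eq:
  "sp4_typed t b c \<Longrightarrow> sp4_eq a c (t \<bullet> ZeroT a b) (ZeroT a c)"
  "sp4_eq a b (ZeroT a b \<boxplus> ZeroT a b) (ZeroT a b)"
  "sp4_eq a b (ScaleT r (ZeroT a b)) (ZeroT a b)"
  by ((subst sp4_eq_class; auto simp: has_type_def sp4_class_ops sp4.zero_add_zero sp4.scale_zero sp4_obj
      intro!: sp4.comp_zero_right sp4_class_hom)[1])+

lemma apply_family_add:
  fixes t :: "'k::field sp4_term"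
  shows "apply_family t (x + y) = apply_family t x + apply_family t y"
proof (transfer, unfold family_eq_def, intro allI)
  fix t :: "'k sp4_term" and x y :: "fund list \<Rightarrow> fund list \<Rightarrow> 'k sp4_term" and a b
  assume "\<forall>a b. sp4_eq a b (x a b) (x a b)" "\<forall>a b. sp4_eq a b (y a b) (y a b)"
  then show "sp4_eq a b (act_family t (\<lambda>a b. x a b \<boxplus> y a b) a b) (act_family t x a b \<boxplus> act_family t y a b)"
    by (auto simp: act_family_def sp4_eq_self sp4_typedI intro!: term_eq.comp_add_right term_eq.sym[OF sp4_zero_eq(2)])
qed

lemma scale_family_add: "scale_family r (x + y) = scale_family r x + scale_family r y"
  by transfer (auto simp: family_eq_def sp4_eq_self intro!: term_eq.scale_add_right)

lift_definition act :: "'k::field sp4_term \<Rightarrow> 'k family endo" is apply_family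
  by (simp add: apply_family_add)

lift_definition scalar :: "'k::field \<Rightarrow> 'k family endo" is scale_family
  by (simp add: scale_family_add)

lemma act_eq_iff:
  assumes "sp4_typed s a b" "sp4_typed t a b"
  shows "act s = act t \<longleftrightarrow> sp4_eq a b s t"
proof
  assume eq: "sp4_eq a b s t"
  have "apply_family s x = apply_family t x" for x
    using assms eq by transfer
      (auto simp: family_eq_def act_family_def has_type_def sp4_eq_self sp4_typed_zero intro!: term_eq.cong_comp)
  then show "act s = act t" by transfer auto
next
  assume "act s = act t"
  then have e: "apply_family s = apply_family t" by (metis act.rep_eq)
  \<comment> \<open>The family with identities on the diagonal: applying \<open>s\<close> to it
    recovers \<open>s\<close> as the entry from a to b, so the action loses no information.\<close>
  define f :: "fund list \<Rightarrow> fund list \<Rightarrow> 'a sp4_term" where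
    "f = (\<lambda>a' b'. if a' = b' then Ide a' else ZeroT a' b')"
  have f: "family_eq f f" by (auto simp: f_def family_eq_def sp4_eq_self has_type_def)
  have a: "apply_family s (abs_family f) = abs_family (act_family s f)"
    "apply_family t (abs_family f) = abs_family (act_family t f)"
    using f by (simp_all add: apply_family.abs_eq)
  have "family_eq (act_family s f) (act_family s f)" "family_eq (act_family t f) (act_family t f)"
    using apply_family.rsp f by (auto simp: rel_fun_def)
  then have "family_eq (act_family s f) (act_family t f)"
    using Quotient_rel[OF Quotient_family] a e by metis
  then have "sp4_eq a b (act_family s f a b) (act_family t f a b)" by (simp add: family_eq_def)
  then have "sp4_eq a b (s \<bullet> Ide a) (t \<bullet> Ide a)"
    using assms by (simp add: act_family_def f_def has_type_def)
  then show "sp4_eq a b s t"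
    using assms by (meson term_eq.comp_ide_right term_eq.sym term_eq.trans)
qed

lemma (in linear_monoidal_category) comp_zero_left:
  "f \<in> hom C a b \<Longrightarrow> c \<in> obj C \<Longrightarrow> zero_mor C b c \<cdot> f = zero_mor C a c"
  using hom_obj[of f a b] comp_add_left[OF _ zero_hom zero_hom, of f a b c]
  by (intro add_self_zero comp_hom[OF _ zero_hom]) (auto simp: zero_add_zero)

lemma (in linear_monoidal_category) whisker_unit:
  "f \<in> hom C a b \<Longrightarrow> whisker (unit_obj C) f (unit_obj C) = f"
  using tensor_unit_left[of f a b] tensor_unit_right[of f a b] by (simp add: whisker_def)

lemma act_class:
  "sp4_typed s a b \<Longrightarrow> sp4_typed t a b \<Longrightarrow> sp4_class s = sp4_class t \<Longrightarrow> act s = act t"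
  by (simp add: act_eq_iff sp4_eq_class)

lemma endo_family_eqI: "(\<And>x. Rep_endo f x = Rep_endo g x) \<Longrightarrow> f = g"
  by (metis Rep_endo_inject ext)

lemma act_comp:
  fixes s t :: "'k::field sp4_term"
  assumes "sp4_wt s" "sp4_wt t" "sp4_src s = sp4_tgt t"
  shows "act (s \<bullet> t) = act s * act t"
proof (rule endo_family_eqI, simp add: act.rep_eq times_endo.rep_eq, transfer fixing: s t)
  fix f :: "fund list \<Rightarrow> fund list \<Rightarrow> 'k sp4_term" assume "family_eq f f"
  then have "sp4_typed (f a b) a b" for a b by (simp add: family_eq_def sp4_eq_self)
  then have "sp4_wt (f a b)" "sp4_src (f a b) = a" "sp4_tgt (f a b) = b" for a b
    by (simp_all add: has_type_def)
  then show "family_eq (act_family (s \<bullet> t) f) (act_family s (act_family t f))"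
    using assms by (auto simp: family_eq_def act_family_def sp4_eq_self sp4_typed_zero
      intro!: term_eq.comp_assoc has_typeI)
qed

lemma act_add:
  fixes s t :: "'k::field sp4_term"
  assumes "sp4_wt s" "sp4_wt t" "sp4_src s = sp4_src t" "sp4_tgt s = sp4_tgt t"
  shows "act (s \<boxplus> t) = act s + act t"
proof (rule endo_family_eqI, simp add: act.rep_eq plus_endo.rep_eq, transfer fixing: s t)
  fix f :: "fund list \<Rightarrow> fund list \<Rightarrow> 'k sp4_term" assume "family_eq f f"
  then have "sp4_typed (f a b) a b" for a b by (simp add: family_eq_def sp4_eq_self)
  then have "sp4_wt (f a b)" "sp4_src (f a b) = a" "sp4_tgt (f a b) = b" for a b
    by (simp_all add: has_type_def)
  then show "family_eq (act_family (s \<boxplus> t) f) (\<lambda>a b. act_family s f a b \<boxplus> act_family t f a b)"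
    using assms by (auto simp: family_eq_def act_family_def
      intro!: term_eq.comp_add_left has_typeI term_eq.sym[OF sp4_zero_eq(2)])
qed

lemma act_scale:
  fixes t :: "'k::field sp4_term"
  assumes "sp4_wt t"
  shows "act (ScaleT r t) = scalar r * act t"
proof (rule endo_family_eqI, simp add: act.rep_eq times_endo.rep_eq scalar.rep_eq, transfer fixing: t r)
  fix f :: "fund list \<Rightarrow> fund list \<Rightarrow> 'k sp4_term" assume "family_eq f f"
  then have "sp4_typed (f a b) a b" for a b by (simp add: family_eq_def sp4_eq_self)
  then have "sp4_wt (f a b)" "sp4_src (f a b) = a" "sp4_tgt (f a b) = b" for a b
    by (simp_all add: has_type_def)
  then show "family_eq (act_family (ScaleT r t) f) (\<lambda>a b. ScaleT r (act_family t f a b))"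
    using assms by (auto simp: family_eq_def act_family_def
      intro!: term_eq.comp_scale_left has_typeI term_eq.sym[OF sp4_zero_eq(3)])
qed

lemma scalar_commute:
  fixes t :: "'k::field sp4_term"
  shows "scalar r * act t = act t * scalar r"
proof (rule endo_family_eqI, simp add: act.rep_eq times_endo.rep_eq scalar.rep_eq, transfer fixing: t r)
  fix f :: "fund list \<Rightarrow> fund list \<Rightarrow> 'k sp4_term" assume "family_eq f f"
  then have "sp4_typed (f a b) a b" for a b by (simp add: family_eq_def sp4_eq_self)
  then have "sp4_wt (f a b)" "sp4_src (f a b) = a" "sp4_tgt (f a b) = b" for a b
    by (simp_all add: has_type_def)
  then show "family_eq (\<lambda>a b. ScaleT r (act_family t f a b)) (act_family t (\<lambda>a b. ScaleT r (f a b)))"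
    by (auto simp: family_eq_def act_family_def
      intro!: term_eq.sym[OF term_eq.comp_scale_right] has_typeI sp4_zero_eq(3))
qed

lemma act_zero: "act (ZeroT a b :: 'k::field sp4_term) = 0"
proof (rule endo_family_eqI, simp add: act.rep_eq zero_endo.rep_eq, transfer fixing: a b)
  fix f :: "fund list \<Rightarrow> fund list \<Rightarrow> 'k sp4_term" assume "family_eq f f"
  then have f: "sp4_typed (f a b) a b" for a b by (simp add: family_eq_def sp4_eq_self)
  have "sp4_eq c b (ZeroT a b \<bullet> f c a) (ZeroT c b)" for c
  proof -
    have "sp4_wt (f c a)" "sp4_src (f c a) = c" "sp4_tgt (f c a) = a" using f[of c a] by (auto simp: has_type_def)
    then show ?thesis
      using sp4.comp_zero_left[OF sp4_class_hom[of "f c a"], of b]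
      by (subst sp4_eq_class) (auto simp: has_type_def sp4_class_ops sp4_obj)
  qed
  then show "family_eq (act_family (ZeroT a b) f) ZeroT"
    by (auto simp: family_eq_def act_family_def sp4_eq_self sp4_typed_zero)
qed

lemma scalar_simps:
  fixes r r' :: "'k::field" and x :: "'k family endo"
  shows "scalar r * (scalar r' * x) = scalar (r * r') * x"
  "scalar (r + r') * x = scalar r * x + scalar r' * x"
  "scalar 1 * x = x"
  "scalar (- 1) * x = - x"
proof -
  { fix y :: "'k family"
    have "scale_family r (scale_family r' y) = scale_family (r * r') y"
      by transfer (auto simp: family_eq_def sp4_eq_self intro!: term_eq.scale_scale)
    moreover have "scale_family (r + r') y = scale_family r y + scale_family r' y"
      by transfer (auto simp: family_eq_def sp4_eq_self intro!: term_eq.scale_add_left)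
    moreover have "scale_family 1 y = y"
      by transfer (auto simp: family_eq_def sp4_eq_self intro!: term_eq.scale_one)
    moreover have "scale_family (- 1) y = - y"
      by transfer (auto simp: family_eq_def sp4_eq_self has_type_def)
    ultimately have "scale_family r (scale_family r' y) = scale_family (r * r') y \<and>
      scale_family (r + r') y = scale_family r y + scale_family r' y \<and> scale_family 1 y = y \<and>
      scale_family (- 1) y = - y" by blast }
  note y = this
  show "scalar r * (scalar r' * x) = scalar (r * r') * x"
    "scalar (r + r') * x = scalar r * x + scalar r' * x"
    "scalar 1 * x = x" "scalar (- 1) * x = - x"
    by (rule endo_family_eqI; simp add: times_endo.rep_eq scalar.rep_eq plus_endo.rep_eq uminus_endo.rep_eq y)+
qed

section \<open>Terms in context and layers\<close>

definition "W a t b = act ((Ide a \<boxdot> t) \<boxdot> Ide b)"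

definition "E w = act (Ide w)"

lemma W_class: "sp4_wt t \<Longrightarrow> sp4_class ((Ide a \<boxdot> t) \<boxdot> Ide b) = sp4.whisker a (sp4_class t) b"
  by (simp add: sp4_class_ops sp4.whisker_def)

lemma W_eqI:
  assumes "sp4_wt s" "sp4_wt t" "a @ sp4_src s @ b = c @ sp4_src t @ d" "a @ sp4_tgt s @ b = c @ sp4_tgt t @ d"
    and "sp4.whisker a (sp4_class s) b = sp4.whisker c (sp4_class t) d"
  shows "W a s b = W c t d"
  unfolding W_def
  by (rule act_class[where a = "a @ sp4_src s @ b" and b = "a @ sp4_tgt s @ b"])
    (use assms in \<open>simp_all add: has_type_def W_class\<close>)

lemma W_eq_prodI:
  assumes "sp4_wt s" "sp4_wt t" "sp4_wt t'" "c @ sp4_src t @ d = c' @ sp4_tgt t' @ d'"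
    and "a @ sp4_src s @ b = c' @ sp4_src t' @ d'" "a @ sp4_tgt s @ b = c @ sp4_tgt t @ d"
    and eq: "sp4.whisker a (sp4_class s) b
      = compose sp4_category (sp4.whisker c (sp4_class t) d) (sp4.whisker c' (sp4_class t') d')"
  shows "W a s b = W c t d * W c' t' d'"
proof -
  have "W c t d * W c' t' d' = act (((Ide c \<boxdot> t) \<boxdot> Ide d) \<bullet> ((Ide c' \<boxdot> t') \<boxdot> Ide d'))"
    unfolding W_def by (rule act_comp[THEN HOL.sym]) (use assms in simp_all)
  moreover have "W a s b = \<dots>" unfolding W_def
    by (rule act_class[where a = "a @ sp4_src s @ b" and b = "a @ sp4_tgt s @ b"])
      (use assms(1-6) eq in \<open>simp_all add: has_type_def W_class sp4_class_ops(1)\<close>)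
  ultimately show ?thesis by simp
qed

lemma W_comp:
  assumes "sp4_wt s" "sp4_wt t" "sp4_src s = sp4_tgt t"
  shows "W a (s \<bullet> t) b = W a s b * W a t b"
  unfolding W_def
  by (subst act_comp[symmetric], (use assms in simp)+, rule act_class, (rule has_typeI; use assms in simp),
      (rule has_typeI; use assms in simp))
    (use assms sp4_class_hom[of s] sp4_class_hom[of t] in \<open>simp add: W_class sp4_class_ops(1) sp4.whisker_comp sp4_obj\<close>)

lemma W_add:
  assumes "sp4_wt s" "sp4_wt t" "sp4_src s = sp4_src t" "sp4_tgt s = sp4_tgt t"
  shows "W a (s \<boxplus> t) b = W a s b + W a t b"
  unfolding W_def
  by (subst act_add[symmetric], (use assms in simp)+, rule act_class, (rule has_typeI; use assms in simp),
      (rule has_typeI; use assms in simp))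
    (use assms sp4_class_hom[of s] sp4_class_hom[of t] in \<open>simp add: W_class sp4_class_ops(2) sp4.whisker_add sp4_obj\<close>)

lemma W_scale:
  assumes "sp4_wt t"
  shows "W a (ScaleT r t) b = scalar r * W a t b"
  unfolding W_def
  by (subst act_scale[symmetric], (use assms in simp), rule act_class, (rule has_typeI; use assms in simp),
      (rule has_typeI; use assms in simp))
    (use assms sp4_class_hom[of t] in \<open>simp add: W_class sp4_class_ops(3) sp4.whisker_scale sp4_obj\<close>)

lemma W_zero: "W a (ZeroT u v) b = 0"
proof -
  have "W a (ZeroT u v) b = act (ZeroT (a @ u @ b) (a @ v @ b))"
    unfolding W_def
    by (rule act_class[where a = "a @ u @ b" and b = "a @ v @ b"])
      (auto simp: has_type_def W_class sp4_class_ops(6) sp4.whisker_zero sp4_obj)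
  then show ?thesis by (simp add: act_zero)
qed

lemma W_ide: "W a (Ide w) b = E (a @ w @ b)"
  unfolding W_def E_def
  by (rule act_class[where a = "a @ w @ b" and b = "a @ w @ b"])
    (auto simp: has_type_def W_class sp4_class_ops(5) sp4.whisker_ident sp4_obj)

lemma W_ide_tensor:
  assumes "sp4_wt t"
  shows "W a (Ide w \<boxdot> t) b = W (a @ w) t b" "W a (t \<boxdot> Ide w) b = W a t (w @ b)"
proof -
  note h = sp4.whisker_ident_tensor[OF _ _ sp4_class_hom[OF assms], of a b w, simplified sp4_obj, simplified]
  show "W a (Ide w \<boxdot> t) b = W (a @ w) t b"
    by (rule W_eqI) (use assms h(1) in \<open>simp_all add: sp4_class_ops(4,5)\<close>)
  show "W a (t \<boxdot> Ide w) b = W a t (w @ b)"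
    by (rule W_eqI) (use assms h(2) in \<open>simp_all add: sp4_class_ops(4,5)\<close>)
qed

lemma W_tensor:
  assumes "sp4_wt s" "sp4_wt t"
  shows "W a (s \<boxdot> t) b = W a s (sp4_tgt t @ b) * W (a @ sp4_src s) t b"
    and "W a (s \<boxdot> t) b = W (a @ sp4_tgt s) t b * W a s (sp4_src t @ b)"
proof -
  note h = sp4.whisker_tensor[OF _ _ sp4_class_hom[OF assms(1)] sp4_class_hom[OF assms(2)], of a b, simplified sp4_obj, simplified]
  show "W a (s \<boxdot> t) b = W a s (sp4_tgt t @ b) * W (a @ sp4_src s) t b"
    by (rule W_eq_prodI) (use assms h(1) in \<open>simp_all add: sp4_class_ops(4)\<close>)
  show "W a (s \<boxdot> t) b = W (a @ sp4_tgt s) t b * W a s (sp4_src t @ b)"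
    by (rule W_eq_prodI) (use assms h(2) in \<open>simp_all add: sp4_class_ops(4)\<close>)
qed

lemma E_W:
  assumes "sp4_wt t" "c = a @ sp4_tgt t @ b" 
  shows "E c * W a t b = W a t b" 
proof -
  have "W a (Ide (sp4_tgt t) \<bullet> t) b = W a t b" unfolding W_def
    by (rule act_class[where a = "a @ sp4_src t @ b" and b = "a @ sp4_tgt t @ b"])
      (use assms sp4.comp_ident_left[OF sp4_class_hom[of t]] in \<open>auto simp: has_type_def W_class sp4_class_ops(1,5)\<close>)
  then show ?thesis using assms by (simp add: W_comp W_ide)
qed

lemma W_E:
  assumes "sp4_wt t" "c = a @ sp4_src t @ b" 
  shows "W a t b * E c = W a t b" 
proof -
  have "W a (t \<bullet> Ide (sp4_src t)) b = W a t b" unfolding W_def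
    by (rule act_class[where a = "a @ sp4_src t @ b" and b = "a @ sp4_tgt t @ b"])
      (use assms sp4.comp_ident_right[OF sp4_class_hom[of t]] in \<open>auto simp: has_type_def W_class sp4_class_ops(1,5)\<close>)
  then show ?thesis using assms by (simp add: W_comp W_ide)
qed

lemma W_congruence: "sp4_eq c d s t \<Longrightarrow> W a s b = W a t b"
  unfolding W_def
  by (subst act_eq_iff[where a = "a @ c @ b" and b = "a @ d @ b"];
      (auto dest: term_eq_types simp: has_type_def; fail)?)
    (use term_eq.cong_tens[OF term_eq.cong_tens[OF term_eq.refl[of gsrc gtgt "Ide a" a a] _] term_eq.refl[of gsrc gtgt "Ide b" b b]] in
      \<open>fastforce simp: has_type_def\<close>)

lemma W_empty:
  assumes "sp4_wt t"
  shows "W [] t [] = act t"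
  unfolding W_def
  by (rule act_class[OF has_typeI has_typeI[OF assms HOL.refl HOL.refl]])
    (use assms sp4.whisker_unit[OF sp4_class_hom[OF assms]] in \<open>auto simp: W_class sp4_category_def presented_simps\<close>)

lemma mirror_mirror: "mirror greflect (mirror greflect t) = (t :: 'k sp4_term)"
proof (induction t)
  case (Gen g)
  then show ?case by (cases g) auto
qed auto

lemma mirror_has_type: "sp4_typed t a b \<Longrightarrow> sp4_typed (mirror greflect t) b a"
  by (simp add: has_type_def mirror_typed)

text \<open>The relations are closed under reflection because reflecting twice restores a term, and
  every axiom of the congruence reflects to an axiom, the left and right rules for composition being
  exchanged.\<close>

lemma sp4_eq_mirror: "sp4_eq a b s t \<Longrightarrow> sp4_eq b a (mirror greflect s) (mirror greflect t)"
proof (induction rule: term_eq.induct)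
  case (rel s t a b)
  have "(mirror greflect s, mirror greflect t) \<in> sp4_all_relations"
    using rel(1) by (force simp: sp4_all_relations_def mirror_mirror)
  then show ?case using rel by (intro term_eq.rel mirror_has_type)
next
  case sym from sym.IH show ?case by (rule term_eq.sym)
next
  case trans from trans.IH show ?case by (rule term_eq.trans)
qed (simp_all only: mirror.simps, (rule term_eq.refl term_eq.cong_comp term_eq.cong_tens term_eq.cong_add term_eq.cong_scale
    term_eq.comp_ide_left term_eq.comp_ide_right term_eq.sym[OF term_eq.comp_assoc] term_eq.add_assoc
    term_eq.add_commute term_eq.add_zero term_eq.add_inverse term_eq.scale_one term_eq.scale_scale
    term_eq.scale_add_left term_eq.scale_add_right term_eq.comp_add_left term_eq.comp_add_right
    term_eq.comp_scale_left term_eq.comp_scale_right term_eq.tens_ide term_eq.interchange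
    term_eq.tens_assoc term_eq.tens_unit_left term_eq.tens_unit_right term_eq.tens_add_left
    term_eq.tens_add_right term_eq.tens_scale_left term_eq.tens_scale_right;
    (assumption | erule mirror_has_type))+)

text \<open>An identity known in the ring for the empty context is pulled back to terms, reflected
  there and put into any context. Dual identities such as \<open>db_s\<close> and
  \<open>db_d\<close> are obtained in this way.\<close>

lemma W_mirror:
  assumes "sp4_typed s c d" "sp4_typed t c d" "W [] s [] = W [] t []"
  shows "W a (mirror greflect s) b = W a (mirror greflect t) b"
proof -
  have "act s = act t" using assms by (simp add: W_empty has_type_def)
  then have "sp4_eq c d s t" using act_eq_iff[OF assms(1,2)] by simp
  from W_congruence[OF sp4_eq_mirror[OF this]] show ?thesis .
qed

type_synonym 'k sp4_ring = "'k family endo"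

text \<open>A layer \<open>id \<otimes> g \<otimes> id\<close>, with the word on the left of \<open>g\<close> reversed so that adding a letter next to
  \<open>g\<close> is a \<open>Cons\<close> on either side.\<close>

definition K :: "fund list \<Rightarrow> sp4_gen \<Rightarrow> fund list \<Rightarrow> 'k::field sp4_ring" where
  "K p g b = W (rev p) (Gen g) b"

text \<open>Products are kept nested to the right; these two lemmas turn a rule for two or three
  adjacent factors into a rule for the beginning of a longer product.\<close>

lemma left_assoc: "x * y = z \<Longrightarrow> x * (y * w) = z * w" for x y z w :: "'r::ring"
  by (simp add: mult.assoc[symmetric])

lemma left_assoc2: "x * (y * z) = v \<Longrightarrow> x * (y * (z * w)) = v * w" for x y z w v :: "'r::ring"
  by (simp add: mult.assoc[symmetric])

lemma E_E: "E c * E c = E c"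
  using E_W[of "Ide c" c "[]" "[]"] by (simp add: W_ide)

lemmas W_simps = W_comp W_add W_scale W_zero W_ide W_ide_tensor W_tensor(1) E_W W_E scalar_simps(4)
  E_W[THEN left_assoc] W_E[THEN left_assoc] E_E

section \<open>The relations as ring identities\<close>

lemma relations_W:
  "\<forall>(l, r) \<in> sp4_relations. W a l b = W a r b \<and> W a (mirror greflect l) b = W a (mirror greflect r) b"
proof (clarify, intro conjI)
  fix l r :: "'a sp4_term" assume "(l, r) \<in> sp4_relations"
  then have m: "(l, r) \<in> sp4_all_relations" by (simp add: sp4_all_relations_def)
  then obtain c d where "sp4_typed l c d" "sp4_typed r c d" using sp4_all_relations_typed by blast
  then have e: "sp4_eq c d l r" by (intro term_eq.rel m)
  show "W a l b = W a r b" by (rule W_congruence[OF e])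
  show "W a (mirror greflect l) b = W a (mirror greflect r) b" by (rule W_congruence[OF sp4_eq_mirror[OF e]])
qed

context
  notes W_simps[simp] mult.assoc[simp]
begin
lemmas relations_ring = relations_W[unfolded sp4_relations_def ball_simps prod.case, simplified, of a b for a b]
end

text \<open>The relations in every context. The two layers that meet share both letters in \<open>sp4_rel_full\<close>, and mostly
  one letter in \<open>sp4_rel_peak\<close>.\<close>

lemma sp4_rel_full:
  "(K p Gc1 b * K p Gu1 b :: 'k::field sp4_ring) = E (rev p @ b)"
  "(K p Gc2 b * K p Gu2 b :: 'k::field sp4_ring) = E (rev p @ b)"
  "(K p Gm b * K p Gs b :: 'k::field sp4_ring) = E (rev p @ B2 # b)"
  "(K p Gb21 b * K p Gb12 b :: 'k::field sp4_ring) = E (rev p @ B1 # B2 # b)"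
  "(K p Gb12 b * K p Gb21 b :: 'k::field sp4_ring) = E (rev p @ B2 # B1 # b)"
  "(K p Gd b * K p Gdb b :: 'k::field sp4_ring) = E (rev p @ B1 # B1 # b) - K p Gu1 b * K p Gc1 b - K p Gs b * K p Gm b"
  "(K p Gc1 b * K p Gs b :: 'k::field sp4_ring) = 0"
  "(K p Gm b * K p Gu1 b :: 'k::field sp4_ring) = 0"
  "(K p Gc1 b * K p Gd b :: 'k::field sp4_ring) = 0"
  "(K p Gdb b * K p Gu1 b :: 'k::field sp4_ring) = 0"
  "(K p Gd b * K p Gu2 b :: 'k::field sp4_ring) = 0"
  "(K p Gc2 b * K p Gdb b :: 'k::field sp4_ring) = 0"
  unfolding K_def rev.simps append_assoc append.simps
  by ((insert relations_ring[of "rev p" b], elim conjE, assumption)[1])+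

lemma sp4_rel_peak:
  "(K (B1 # p) Gt b * K p Gs (B2 # b) :: 'k::field sp4_ring) = K p Gu1 b * K p Gc2 b"
  "(K p Gm (B2 # b) * K (B1 # p) Gtb b :: 'k::field sp4_ring) = K p Gu2 b * K p Gc1 b"
  "(K (B1 # p) Gm b * K p Gs (B1 # b) :: 'k::field sp4_ring) = K p Gtb b * (K p Gt b * K p Gb21 b)"
  "(K p Gm (B1 # b) * K (B1 # p) Gs b :: 'k::field sp4_ring) = K p Gb12 b * (K p Gtb b * K p Gt b)"
  "(K (B1 # p) Gc1 b * K p Gs (B1 # b) :: 'k::field sp4_ring) = 0"
  "(K p Gm (B1 # b) * K (B1 # p) Gu1 b :: 'k::field sp4_ring) = 0"
  "(K (B1 # p) Gc2 b * K p Gtb (B2 # b) :: 'k::field sp4_ring) = 0"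
  "(K p Gt (B2 # b) * K (B1 # p) Gu2 b :: 'k::field sp4_ring) = 0"
  "(K p Gc1 (B1 # b) * K (B1 # p) Gs b :: 'k::field sp4_ring) = 0"
  "(K (B1 # p) Gm b * K p Gu1 (B1 # b) :: 'k::field sp4_ring) = 0"
  "(K (B2 # p) Gc2 b * K p Gu2 (B2 # b) :: 'k::field sp4_ring) = 0"
  "(K p Gc2 (B2 # b) * K (B2 # p) Gu2 b :: 'k::field sp4_ring) = 0"
  "(K (B1 # p) Gc1 b * K p Gu1 (B1 # b) :: 'k::field sp4_ring) = 0"
  "(K p Gc1 (B1 # b) * K (B1 # p) Gu1 b :: 'k::field sp4_ring) = 0"
  "(K (B2 # p) Gc2 b * K p Gdb (B2 # b) :: 'k::field sp4_ring) = 0"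
  "(K p Gd (B2 # b) * K (B2 # p) Gu2 b :: 'k::field sp4_ring) = 0"
  "(K p Gc2 (B2 # b) * K (B2 # p) Gdb b :: 'k::field sp4_ring) = 0"
  "(K (B2 # p) Gd b * K p Gu2 (B2 # b) :: 'k::field sp4_ring) = 0"
  "(K p Gt (B2 # b) * K (B1 # p) Gdb b :: 'k::field sp4_ring) = K p Gc1 (B1 # B2 # b) * K (B1 # B1 # p) Gtb b"
  "(K (B1 # p) Gd b * K p Gtb (B2 # b) :: 'k::field sp4_ring) = K p Gu1 (B1 # b) * K p Gt b"
  "(K p Gt (B1 # b) * K (B1 # p) Gb12 b :: 'k::field sp4_ring) = K p Gu1 b * (K p Gc2 b * K p Gm (B2 # b)) + K p Gd b * K p Gm (B2 # b) + K p Gc1 (B1 # B1 # b) * K (B1 # B1 # p) Gs b"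
  "(K (B1 # p) Gb21 b * K p Gtb (B1 # b) :: 'k::field sp4_ring) = K p Gs (B2 # b) * (K p Gu2 b * K p Gc1 b) + K p Gs (B2 # b) * K p Gdb b + K p Gu1 (B2 # b) * K p Gm b"
  "(K p Gm (B2 # b) * K (B1 # p) Gb21 b :: 'k::field sp4_ring) = K (B2 # p) Gm b * K p Gb12 (B1 # b) - K p Gdb b * ((K (B1 # p) Gt b * K (B1 # p) Gb21 b)) + K p Gdb b * K p Gt (B1 # b)"
  "(K (B1 # p) Gb12 b * K p Gs (B2 # b) :: 'k::field sp4_ring) = K p Gb21 (B1 # b) * K (B2 # p) Gs b - (K (B1 # p) Gb12 b * (K (B1 # p) Gtb b * K p Gd b)) + K p Gtb (B1 # b) * K p Gd b"
  "(K p Gm b * ((K (B1 # p) Gt b * K (B1 # p) Gb21 b)) :: 'k::field sp4_ring) = K (B2 # p) Gc1 b * K p Gb12 (B1 # b)"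
  "((K (B1 # p) Gb12 b * (K (B1 # p) Gtb b * K p Gs b)) :: 'k::field sp4_ring) = K p Gb21 (B1 # b) * K (B2 # p) Gu1 b"
  "(K p Gc2 (B1 # b) * K (B2 # p) Gb12 b :: 'k::field sp4_ring) = K p Gt b * (K p Gt (B2 # b) * K p Gb21 (B2 # b))"
  "(K (B2 # p) Gb21 b * K p Gu2 (B1 # b) :: 'k::field sp4_ring) = K p Gb12 (B2 # b) * (K p Gtb (B2 # b) * K p Gtb b)"
  "(K p Gd (B1 # b) * K (B2 # p) Gb12 b :: 'k::field sp4_ring) = (K (B1 # p) Gu1 b * (K (B1 # p) Gc2 b * K p Gb21 (B2 # b))) + K p Gs (B1 # b) * (K p Gb12 b * (K p Gtb b * (K (B1 # p) Gc2 b * K p Gb21 (B2 # b)))) - K p Gs (B1 # b) * K (B2 # p) Gt b + K (B1 # p) Gd b * K p Gb21 (B2 # b) + K p Gt (B1 # B1 # b) * (K p Gb21 (B1 # B1 # b) * K (B1 # B2 # p) Gs b) - K p Gs (B1 # b) * (K p Gb12 b * (K p Gtb b * (K p Gt b * (K p Gt (B2 # b) * K p Gb21 (B2 # b))))) - K p Gu1 (B1 # b) * (K p Gt b * (K p Gt (B2 # b) * K p Gb21 (B2 # b)))"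
  "(K (B2 # p) Gb21 b * K p Gdb (B1 # b) :: 'k::field sp4_ring) = K p Gb12 (B2 # b) * ((K (B1 # p) Gu2 b * K (B1 # p) Gc1 b)) + K p Gb12 (B2 # b) * (K (B1 # p) Gu2 b * (K p Gt b * (K p Gb21 b * K p Gm (B1 # b)))) - K p Gm (B1 # B2 # b) * K (B1 # B1 # p) Gtb b + K p Gb12 (B2 # b) * K (B1 # p) Gdb b + K p Gb12 (B2 # b) * (K p Gtb (B2 # b) * K (B1 # p) Gm b) - K p Gb12 (B2 # b) * (K p Gtb (B2 # b) * (K p Gtb b * (K p Gt b * (K p Gb21 b * K p Gm (B1 # b))))) - K p Gc1 (B2 # B1 # B2 # b) * (K (B1 # B1 # p) Gb12 (B2 # b) * (K (B1 # B1 # p) Gtb (B2 # b) * K (B1 # B1 # p) Gtb b))"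
  "(K p Gm (B1 # b) * K (B1 # p) Gd b :: 'k::field sp4_ring) = K (B2 # p) Gt b * K p Gb12 (B2 # b) - K p Gb12 b * (K p Gtb b * K (B1 # p) Gc2 b)"
  "(K (B1 # p) Gdb b * K p Gs (B1 # b) :: 'k::field sp4_ring) = K p Gb21 (B2 # b) * K (B2 # p) Gtb b - K p Gt (B2 # B2 # b) * (K p Gb21 (B2 # B2 # b) * K (B1 # B2 # p) Gu2 b)"
  unfolding K_def rev.simps append_assoc append.simps
  by ((insert relations_ring[of "rev p" b], elim conjE, assumption)[1])+

text \<open>Relations whose left side is not a single peak of two layers: products that only go down
  or only go up, and products of more than two layers.\<close>

lemma sp4_rel_more:
  "(K p Gc2 (B1 # b) * ((K (B2 # p) Gb12 b * K (B2 # p) Gtb b)) :: 'k::field sp4_ring) = 0"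
  "(K p Gt (B2 # b) * (K p Gb21 (B2 # b) * K (B2 # p) Gb21 b) :: 'k::field sp4_ring) = K p Gc2 (B1 # B2 # b) * K (B2 # B2 # p) Gtb b + K (B1 # p) Gm b * K p Gd (B1 # b)"
  "(K (B1 # p) Gs b * K p Gtb b :: 'k::field sp4_ring) = K p Gs (B1 # b) * (K p Gb12 b * K p Gtb b)"
  "(K p Gc1 b * K (B1 # p) Gt b :: 'k::field sp4_ring) = K p Gc2 b * K p Gm (B2 # b)"
  "(K (B1 # p) Gtb b * K p Gu1 b :: 'k::field sp4_ring) = K p Gs (B2 # b) * K p Gu2 b"
  "(K p Gc1 (B1 # b) * K (B1 # p) Gd b :: 'k::field sp4_ring) = K p Gt b * K p Gt (B2 # b)"
  "(K (B1 # p) Gdb b * K p Gu1 (B1 # b) :: 'k::field sp4_ring) = K p Gtb (B2 # b) * K p Gtb b"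
  "(K p Gt (B1 # b) * (K p Gb21 (B1 # b) * K (B2 # p) Gd b) :: 'k::field sp4_ring) = K (B1 # p) Gt b * K p Gd (B2 # b)"
  "(K (B2 # p) Gdb b * (K p Gb12 (B1 # b) * K p Gtb (B1 # b)) :: 'k::field sp4_ring) = K p Gdb (B2 # b) * K (B1 # p) Gtb b"
  "((K (B1 # p) Gt b * (K (B1 # p) Gb21 b * (K p Gb21 (B1 # b) * K (B2 # p) Gs b))) :: 'k::field sp4_ring) = K p Gd b + K p Gu1 b * K p Gc2 b"
  "(K (B2 # p) Gm b * (K p Gb12 (B1 # b) * ((K (B1 # p) Gb12 b * K (B1 # p) Gtb b))) :: 'k::field sp4_ring) = K p Gdb b + K p Gu2 b * K p Gc1 b"
  "(K p Gt b * K (B1 # p) Gm b :: 'k::field sp4_ring) = K p Gt b * (K p Gb21 b * K p Gm (B1 # b))"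
  unfolding K_def rev.simps append_assoc append.simps
  by ((insert relations_ring[of "rev p" b], elim conjE, assumption)[1])+

lemma K_E: "c = rev p @ gsrc g @ b \<Longrightarrow> K p g b * E c = K p g b"
  by (simp add: K_def W_E)

lemma E_K: "c = rev p @ gtgt g @ b \<Longrightarrow> E c * K p g b = K p g b"
  by (simp add: K_def E_W)

lemma W_interchange:
  assumes "sp4_wt s" "sp4_wt t"
  shows "W a s (m @ sp4_tgt t @ b) * W (a @ sp4_src s @ m) t b
    = W (a @ sp4_tgt s @ m) t b * W a s (m @ sp4_src t @ b)"
proof -
  have "W a s (m @ sp4_tgt t @ b) * W (a @ sp4_src s @ m) t b = W a (s \<boxdot> (Ide m \<boxdot> t)) b"
    by (subst W_tensor(1); simp add: assms W_ide_tensor)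
  also have "\<dots> = W (a @ sp4_tgt s @ m) t b * W a s (m @ sp4_src t @ b)"
    by (subst W_tensor(2); simp add: assms W_ide_tensor)
  finally show ?thesis .
qed

lemma K_interchange:
  "K p f (m @ gtgt g @ b) * K (rev (gsrc f @ m) @ p) g b
    = K (rev (gtgt f @ m) @ p) g b * K p f (m @ gsrc g @ b)"
  using W_interchange[of "Gen f" "Gen g" "rev p" m b] by (simp add: K_def)

text \<open>Layers on separate letters commute; gaps of zero, one and two letters are spelled out so
  that the equations work as rewrite rules. The side condition of the first keeps
  \<open>K p Gu1 b * K p Gc1 b\<close> from being turned into a peak.\<close>

lemma K_com:
  "q = rev (gsrc f) @ p \<Longrightarrow> c = gtgt g @ b \<Longrightarrow> gsrc f \<noteq> [] \<or> gtgt g \<noteq> [] \<Longrightarrow>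
    K p f c * K q g b = K (rev (gtgt f) @ p) g b * K p f (gsrc g @ b)"
  "q = rev (gsrc f) @ p \<Longrightarrow> c = gtgt g @ b \<Longrightarrow>
    K p f (x # c) * K (x # q) g b = K (x # rev (gtgt f) @ p) g b * K p f (x # gsrc g @ b)"
  "q = rev (gsrc f) @ p \<Longrightarrow> c = gtgt g @ b \<Longrightarrow>
    K p f (x # y # c) * K (y # x # q) g b = K (y # x # rev (gtgt f) @ p) g b * K p f (x # y # gsrc g @ b)"
  using K_interchange[of p f "[]" g b] K_interchange[of p f "[x]" g b] K_interchange[of p f "[x, y]" g b]
  by simp_all

lemmas K_coms = K_com K_com[THEN left_assoc]

section \<open>Derived identities between layers\<close>

lemma ring_diff_distribs: "(x - y) * z = x * z - y * z" "z * (x - y) = z * x - z * y"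
  "(x + y) * z = x * z + y * z" "z * (x + y) = z * x + z * y" for x y z :: "'r::ring"
  by (simp_all add: algebra_simps)

text \<open>The relation for \<open>Gt\<close> after \<open>Gdb\<close> on neighbouring letters
  yields \<open>Gc1\<close> next to \<open>Gtb\<close>, and the added \<open>Gu1\<close> closes the
  loop c1 u1 = 1. In this form the relations for \<open>Gt\<close> can be applied to
  \<open>Gtb\<close>.\<close>

lemma tb_factor: "K p Gt (B2 # b) * (K (B1 # p) Gdb b * K p Gu1 (B1 # b)) = K p Gtb b"
proof -
  have "K p Gt (B2 # b) * (K (B1 # p) Gdb b * K p Gu1 (B1 # b))
      = K p Gc1 (B1 # B2 # b) * (K (B1 # B1 # p) Gtb b * K p Gu1 (B1 # b))"
    by (simp only: left_assoc[OF sp4_rel_peak(19)] mult.assoc)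
  also have "K (B1 # B1 # p) Gtb b * K p Gu1 (B1 # b) = K p Gu1 (B1 # B2 # b) * K p Gtb b"
    using K_interchange[of p Gu1 "[]" Gtb b, THEN HOL.sym] by simp
  finally show ?thesis by (simp add: left_assoc[OF sp4_rel_full(1)] E_K)
qed

text \<open>Write \<open>Gtb\<close> as in \<open>tb_factor\<close>. Two layers \<open>Gt\<close>
  equal \<open>Gc1\<close> after \<open>Gd\<close>, so \<open>Gd\<close> meets \<open>Gdb\<close>;
  between \<open>Gc1\<close> and \<open>Gu1\<close> only the identity of that expansion survives,
  and the remaining loop is 1.\<close>

lemma t_tb: "K p Gt b * K p Gtb b = E (rev p @ B1 # b)"
proof -
  have "K p Gt b * K p Gtb b = K p Gt b * (K p Gt (B2 # b) * (K (B1 # p) Gdb b * K p Gu1 (B1 # b)))"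
    by (simp only: tb_factor)
  also have "\<dots> = K p Gc1 (B1 # b) * (K (B1 # p) Gd b * (K (B1 # p) Gdb b * K p Gu1 (B1 # b)))"
    by (simp only: left_assoc[OF sp4_rel_more(6)[symmetric]] mult.assoc)
  also have "\<dots> = K p Gc1 (B1 # b) * (E (rev p @ B1 # B1 # B1 # b) * K p Gu1 (B1 # b))"
    by (simp add: left_assoc[OF sp4_rel_full(6)] left_assoc[OF sp4_rel_peak(9)] left_assoc[OF sp4_rel_peak(14)]
       ring_diff_distribs mult.assoc)
  finally show ?thesis by (simp add: E_K sp4_rel_full(1))
qed

text \<open>\<open>Gd\<close> is solved from the relation in which it stands next to u1 c2. After
  \<open>Gm\<close> the two crossings cancel, and what remains contains c1 s or m u1, both
  zero.\<close>

lemma m_d: "K p Gm b * K p Gd b = 0"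
proof -
  have d: "K p Gd b = K (B1 # p) Gt b * (K (B1 # p) Gb21 b * (K p Gb21 (B1 # b) * K (B2 # p) Gs b)) - K p Gu1 b * K p Gc2 b"
    by (simp add: sp4_rel_more(10))
  have "K p Gm b * (K (B1 # p) Gt b * (K (B1 # p) Gb21 b * (K p Gb21 (B1 # b) * K (B2 # p) Gs b)))
    = K (B2 # p) Gc1 b * (K p Gb12 (B1 # b) * (K p Gb21 (B1 # b) * K (B2 # p) Gs b))"
    by (simp add: left_assoc2[OF sp4_rel_peak(25)] mult.assoc)
  also have "\<dots> = 0"
    by (simp add: left_assoc[OF sp4_rel_full(5)] E_K sp4_rel_full(7))
  finally show ?thesis
    by (simp add: d ring_diff_distribs left_assoc[OF sp4_rel_full(8)])
qed

lemma db_s: "K p Gdb b * K p Gs b = 0"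
  using W_mirror[of "gm \<bullet> gd" "[B2, B2]" "[B2]" "ZeroT [B2, B2] [B2]" "rev p" b] m_d[of "[]" "[]"]
  by (simp add: has_type_def W_simps K_def)

text \<open>After \<open>tb_factor\<close>, c1 on t becomes c2 on m. The layer \<open>Gm\<close>
  slides past the others, and \<open>Gc2\<close> meets \<open>Gdb\<close> in one letter, which gives
  zero.\<close>

lemma c1_tb: "K p Gc1 (B2 # b) * K (B1 # p) Gtb b = 0"
proof -
  have "K p Gc1 (B2 # b) * K (B1 # p) Gtb b
    = K p Gc1 (B2 # b) * (K (B1 # p) Gt (B2 # b) * (K (B1 # B1 # p) Gdb b * K (B1 # p) Gu1 (B1 # b)))"
    by (simp only: tb_factor)
  also have "\<dots> = K p Gc2 (B2 # b) * (K p Gm (B2 # B2 # b) * (K (B1 # B1 # p) Gdb b * K (B1 # p) Gu1 (B1 # b)))"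
    by (simp add: left_assoc[OF sp4_rel_more(4)] mult.assoc)
  also have "\<dots> = 0"
    by (simp add: K_coms left_assoc[OF sp4_rel_peak(17)] mult.assoc)
  finally show ?thesis .
qed

lemma t_u1: "K (B1 # p) Gt b * K p Gu1 (B2 # b) = 0"
  using W_mirror[of "(gc1 \<boxdot> i2) \<bullet> (i1 \<boxdot> gtb)" "[B1, B1]" "[B2]" "ZeroT [B1, B1] [B2]" "rev p" b] c1_tb[of "[]" "[]"]
  by (simp add: has_type_def W_simps K_def)

text \<open>Of the three summands of \<open>Gt\<close> after \<open>Gb12\<close>, the one with
  \<open>Gd\<close> dies on u2, the one with \<open>Gs\<close> dies by \<open>c1_tb\<close>, and in
  the first the loop c2 u2 = 1 appears.\<close>

lemma t_b12_tb: "K p Gt (B1 # b) * (K (B1 # p) Gb12 b * K (B1 # p) Gtb b) = K p Gu1 b * K p Gc1 b"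
  by (simp add: left_assoc[OF sp4_rel_peak(21)] ring_diff_distribs mult.assoc sp4_rel_peak(2) left_assoc[OF sp4_rel_full(2)]
    left_assoc[OF sp4_rel_full(11)] K_coms c1_tb E_K)

lemma t_b21_tb: "K (B1 # p) Gt b * (K (B1 # p) Gb21 b * K p Gtb (B1 # b)) = K p Gu1 b * K p Gc1 b"
  using W_mirror[of "(gt \<boxdot> i1) \<bullet> (i1 \<boxdot> gqb)" "[B1, B1]" "[B1, B1]" "gu1 \<bullet> gc1" "rev p" b] t_b12_tb[of "[]" "[]"]
  by (simp add: has_type_def W_simps K_def mult.assoc)

lemma b21_tb: "K p Gb21 (B2 # b) * K (B2 # p) Gtb b
    = K (B1 # p) Gdb b * K p Gs (B1 # b) + K (B1 # p) Gu2 b * (K p Gt b * K p Gb21 b)"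
  by (simp add: sp4_rel_peak(32) K_coms mult.assoc)

lemma q_tb: "K p Gt (B2 # b) * (K p Gb21 (B2 # b) * K (B2 # p) Gtb b) = 0"
  by (simp add: b21_tb ring_diff_distribs left_assoc[OF sp4_rel_peak(19)] left_assoc[OF sp4_rel_peak(8)]
      sp4_rel_full(7) K_coms mult.assoc)

lemma m_d_right: "K (B1 # p) Gm b * K p Gd (B1 # b)
    = K p Gt (B2 # b) * (K p Gb21 (B2 # b) * K (B2 # p) Gb21 b) - K p Gtb b * K p Gc2 (B1 # b)"
  by (simp add: sp4_rel_more(2) K_coms)

text \<open>Here \<open>gdb\<close> is expanded by the mirror image of (SP4.23) and then moved through \<open>gd\<close> by (SP4.14).\<close>

lemma d_db: "(K p Gd (B2 # b) * K (B2 # p) Gdb b :: 'k::field sp4_ring)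
    = K (B1 # p) Gtb b * (K p Gt (B1 # b) * K p Gb21 (B1 # b))
    - K (B1 # p) Gtb b * (K p Gu1 b * (K p Gc1 b * (K p Gt (B1 # b) * K p Gb21 (B1 # b))))"
proof -
  \<comment> \<open>The source is B2 B1 B1 between p and b: \<open>?r\<close> applies q to its first
    two letters, and \<open>?Q\<close> applies the reflection of q to the last.\<close>
  let ?Q = "K (B1 # B2 # p) Gb12 b * K (B1 # B2 # p) Gtb b :: 'k sp4_ring"
  let ?m = "K (B1 # B1 # p) Gm b :: 'k sp4_ring"
  let ?r = "K p Gt (B1 # b) * K p Gb21 (B1 # b) :: 'k sp4_ring"
  have db: "K (B2 # p) Gdb b = K (B2 # B2 # p) Gm b * (K (B2 # p) Gb12 (B1 # b) * ?Q) - K (B2 # p) Gu2 b * K (B2 # p) Gc1 b"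
    by (simp add: sp4_rel_more(11))
  have b21_Q: "K p Gb21 (B2 # B1 # b) * ?Q = K (B2 # B1 # p) Gb12 b * (K (B2 # B1 # p) Gtb b * K p Gb21 (B1 # b))"
    by (simp add: K_coms mult.assoc)
  have q_Q: "K p Gt (B2 # B1 # b) * (K p Gb21 (B2 # B1 # b) * ?Q) = K (B1 # p) Gb12 b * (K (B1 # p) Gtb b * ?r)"
    by (simp add: K_coms mult.assoc)
  have tq_Q: "K p Gt (B1 # b) * (K p Gt (B2 # B1 # b) * (K p Gb21 (B2 # B1 # b) * ?Q)) = K p Gu1 b * (K p Gc1 b * ?r)"
    by (simp only: q_Q left_assoc2[OF t_b12_tb] mult.assoc)
  have c2_Q: "K (B1 # p) Gc2 (B1 # b) * (K p Gb21 (B2 # B1 # b) * ?Q) = 0"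
    by (simp only: b21_Q left_assoc2[OF sp4_rel_more(1)] mult_zero_left)
  have m_u1: "?m * K p Gu1 (B1 # B1 # b) = K p Gu1 (B2 # b) * K p Gm b"
    using K_interchange[of p Gu1 "[]" Gm b, THEN HOL.sym] by simp
  have m_s: "?m * K p Gs (B1 # B1 # b) = K p Gs (B2 # b) * K (B2 # p) Gm b"
    using K_interchange[of p Gs "[]" Gm b, THEN HOL.sym] by simp
  have "K p Gd (B2 # b) * K (B2 # p) Gdb b = K p Gd (B2 # b) * (K (B2 # B2 # p) Gm b * (K (B2 # p) Gb12 (B1 # b) * ?Q))"
    by (simp add: db ring_diff_distribs left_assoc[OF sp4_rel_peak(16)])
  also have "\<dots> = ?m * ((K p Gd (B1 # B1 # b) * K (B2 # p) Gb12 (B1 # b)) * ?Q)"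
    by (simp add: K_coms mult.assoc)
  \<comment> \<open>Four of the seven summands of \<open>Gd\<close> after \<open>Gb12\<close> vanish
    here: those with \<open>Gc2\<close> die on \<open>?Q\<close>, the other two because
    \<open>Gm\<close> reaches a \<open>Gu1\<close>.\<close>
  also have "\<dots> = ?m * (K (B1 # p) Gd (B1 # b) * (K p Gb21 (B2 # B1 # b) * ?Q))
    + ?m * (K p Gt (B1 # B1 # B1 # b) * (K p Gb21 (B1 # B1 # B1 # b) * (K (B1 # B2 # p) Gs (B1 # b) * ?Q)))
    - ?m * (K p Gs (B1 # B1 # b) * (K p Gb12 (B1 # b) * (K p Gtb (B1 # b) * (K p Gu1 b * (K p Gc1 b * ?r)))))"
  proof -
    have "?m * (K (B1 # p) Gu1 (B1 # b) * x) = 0" for x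
      by (simp only: left_assoc[OF sp4_rel_peak(10)] mult_zero_left)
    moreover have "?m * (K p Gs (B1 # B1 # b) * (K (B2 # p) Gt (B1 # b) * ?Q)) = 0"
      by (simp only: left_assoc[OF m_s] t_b12_tb mult.assoc left_assoc[OF sp4_rel_full(8)] mult_zero_left mult_zero_right)
    moreover have "?m * (K p Gu1 (B1 # B1 # b) * (K p Gu1 b * x)) = 0" for x
      by (simp only: left_assoc[OF m_u1] mult.assoc left_assoc[OF sp4_rel_full(8)] mult_zero_left mult_zero_right)
    ultimately show ?thesis
      unfolding sp4_rel_peak(29) ring_diff_distribs mult.assoc tq_Q c2_Q by simp
  qed
  \<comment> \<open>By \<open>m_d_right\<close> one part, after a pair of crossings cancels,
    vanishes by \<open>q_tb\<close>; in the other \<open>Gc2\<close> meets the reflection of q,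
    which is zero as well.\<close>
  also have "?m * (K (B1 # p) Gd (B1 # b) * (K p Gb21 (B2 # B1 # b) * ?Q)) = 0"
    unfolding b21_Q left_assoc[OF m_d_right] ring_diff_distribs mult.assoc
    by (simp add: left_assoc[OF sp4_rel_full(4)] left_assoc[OF E_K] left_assoc2[OF q_tb] left_assoc2[OF sp4_rel_more(1)])
  also have "?m * (K p Gt (B1 # B1 # B1 # b) * (K p Gb21 (B1 # B1 # B1 # b) * (K (B1 # B2 # p) Gs (B1 # b) * ?Q)))
    = K (B1 # p) Gtb b * ?r"
  proof -
    have "K p Gt (B1 # B1 # B1 # b) * (K p Gb21 (B1 # B1 # B1 # b) * (K (B1 # B2 # p) Gs (B1 # b) * ?Q))
      = K (B1 # p) Gs (B1 # b) * (K (B1 # p) Gb12 b * (K (B1 # p) Gtb b * ?r))"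
      by (simp add: K_coms mult.assoc)
    then show ?thesis
      by (simp only: left_assoc[OF sp4_rel_peak(3)] mult.assoc left_assoc[OF sp4_rel_full(4)])
        (simp add: left_assoc[OF E_K] left_assoc[OF t_tb])
  qed
  also have "?m * (K p Gs (B1 # B1 # b) * (K p Gb12 (B1 # b) * (K p Gtb (B1 # b) * (K p Gu1 b * (K p Gc1 b * ?r)))))
    = K (B1 # p) Gtb b * (K p Gu1 b * (K p Gc1 b * ?r))"
    by (simp only: left_assoc2[OF sp4_rel_more(3)[symmetric]] mult.assoc left_assoc[OF sp4_rel_peak(3)]
        left_assoc2[OF t_b21_tb] left_assoc[OF sp4_rel_full(1)])
      (simp add: left_assoc[OF E_K])
  finally show ?thesis by simp
qed

lemma db_d: "K (B2 # p) Gd b * K p Gdb (B2 # b)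
    = K p Gb12 (B1 # b) * (K p Gtb (B1 # b) * K (B1 # p) Gt b)
    - K p Gb12 (B1 # b) * (K p Gtb (B1 # b) * (K p Gu1 b * (K p Gc1 b * K (B1 # p) Gt b)))"
  using W_mirror[of "(gd \<boxdot> i2) \<bullet> (i2 \<boxdot> gdb)" "[B2, B1, B1]" "[B1, B1, B2]"
      "(i1 \<boxdot> gtb) \<bullet> (gq \<boxdot> i1) \<boxminus> (i1 \<boxdot> gtb) \<bullet> (gu1 \<bullet> (gc1 \<bullet> (gq \<boxdot> i1)))" "rev p" b] d_db[of "[]" "[]"]
  by (simp add: has_type_def W_simps K_def mult.assoc)

section \<open>Straightening\<close>

fun is_down :: "sp4_gen \<Rightarrow> bool" where
  "is_down Gc1 = True" | "is_down Gc2 = True" | "is_down Gm = True"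
| "is_down Gt = True" | "is_down Gb21 = True" | "is_down Gd = True"
| "is_down _ = False"

inductive down_path :: "fund list \<Rightarrow> fund list \<Rightarrow> 'k::field sp4_ring \<Rightarrow> bool" where
  down_E: "down_path v v (E v)"
| down_K: "down_path v (rev p @ gsrc g @ b) x \<Longrightarrow> is_down g \<Longrightarrow> down_path v (rev p @ gtgt g @ b) (K p g b * x)"

inductive up_path :: "fund list \<Rightarrow> fund list \<Rightarrow> 'k::field sp4_ring \<Rightarrow> bool" where
  up_E: "up_path v v (E v)"
| up_K: "up_path v (rev p @ gsrc g @ b) x \<Longrightarrow> \<not> is_down g \<Longrightarrow> up_path v (rev p @ gtgt g @ b) (K p g b * x)"

inductive span :: "fund list \<Rightarrow> fund list \<Rightarrow> 'k::field sp4_ring \<Rightarrow> bool" for v w where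
  span_zero: "span v w 0"
| span_path: "down_path v z d \<Longrightarrow> up_path z w u \<Longrightarrow> span v w (scalar r * (u * d))"
| span_add: "span v w x \<Longrightarrow> span v w y \<Longrightarrow> span v w (x + y)"

lemma W_scalar: "W a t b * scalar r = scalar r * W a t b"
  by (simp add: W_def scalar_commute)

lemma K_scalar: "K p g b * (scalar r * x) = scalar r * (K p g b * x)"
  using W_scalar[of "rev p" "Gen g" b r] by (simp add: K_def mult.assoc[symmetric])

lemma E_scalar: "E c * (scalar r * x) = scalar r * (E c * x)"
  using scalar_commute[of r "Ide c"] by (simp add: E_def mult.assoc[symmetric])

lemma down_path_E: "down_path v w x \<Longrightarrow> E w * x = x \<and> x * E v = x"
  by (induction rule: down_path.induct) (auto simp: E_E mult.assoc left_assoc[OF E_K])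

lemma up_path_E: "up_path v w x \<Longrightarrow> E w * x = x \<and> x * E v = x"
  by (induction rule: up_path.induct) (auto simp: E_E mult.assoc left_assoc[OF E_K])

lemma down_path_comp: "down_path z w y \<Longrightarrow> down_path v z x \<Longrightarrow> down_path v w (y * x)"
  by (induction rule: down_path.induct) (auto simp: down_path_E mult.assoc intro: down_K)

lemma up_path_comp: "up_path z w y \<Longrightarrow> up_path v z x \<Longrightarrow> up_path v w (y * x)"
  by (induction rule: up_path.induct) (auto simp: up_path_E mult.assoc intro: up_K)

lemma up_path_scalar: "up_path z w u \<Longrightarrow> u * (scalar r * x) = scalar r * (u * x)"
  by (induction arbitrary: x rule: up_path.induct) (auto simp: E_scalar K_scalar mult.assoc)

lemma down_path_scalar: "down_path z w u \<Longrightarrow> u * (scalar r * x) = scalar r * (u * x)"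
  by (induction arbitrary: x rule: down_path.induct) (auto simp: E_scalar K_scalar mult.assoc)

lemma span_scalar: "span v w x \<Longrightarrow> span v w (scalar r * x)"
  by (induction rule: span.induct) (auto simp: scalar_simps distrib_left intro: span.intros)

lemma span_uminus: "span v w x \<Longrightarrow> span v w (- x)"
  using span_scalar[of v w x "- 1"] by (simp add: scalar_simps)

lemma span_diff: "span v w x \<Longrightarrow> span v w y \<Longrightarrow> span v w (x - y)"
  using span_add[OF _ span_uminus, of v w x y] by simp

text \<open>Prolonging by an upward path at the target, or by a downward path at the source, creates
  no peak. The opposite prolongations require \<open>straighten\<close>.\<close>

lemma span_up: "span v z x \<Longrightarrow> up_path z w u \<Longrightarrow> span v w (u * x)"
proof (induction rule: span.induct)
  case (span_path z' d u' r)
  from span.span_path[OF span_path(1) up_path_comp[OF span_path(3,2)], of r]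
  show ?case by (simp add: up_path_scalar[OF span_path(3)] mult.assoc)
qed (auto simp: distrib_left intro: span.intros)

lemma span_down: "span z w x \<Longrightarrow> down_path v z d \<Longrightarrow> span v w (x * d)"
proof (induction rule: span.induct)
  case (span_path z' d' u r)
  from span.span_path[OF down_path_comp[OF span_path(1,3)] span_path(2), of r]
  show ?case by (simp add: mult.assoc)
qed (auto simp: distrib_right intro: span.intros)

lemma span_down_path: "down_path v w d \<Longrightarrow> span v w d"
  using span_path[OF _ up_E, of v w d 1] by (simp add: scalar_simps down_path_E)

lemma span_up_path: "up_path v w u \<Longrightarrow> span v w u"
  using span_path[OF down_E, of v w u 1] by (simp add: scalar_simps up_path_E)

lemma span_K:
  "\<not> is_down g \<Longrightarrow> w = rev p @ gtgt g @ b \<Longrightarrow> span v (rev p @ gsrc g @ b) x \<Longrightarrow> span v w (K p g b * x)"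
  "\<not> is_down g \<Longrightarrow> w = rev p @ gtgt g @ b \<Longrightarrow> v = rev p @ gsrc g @ b \<Longrightarrow> span v w (K p g b)"
proof -
  assume g: "\<not> is_down g" and w: "w = rev p @ gtgt g @ b"
  have u: "up_path (rev p @ gsrc g @ b) w (K p g b)"
    using up_K[OF up_E g, of p b] by (simp add: w K_E)
  show "span v w (K p g b * x)" if "span v (rev p @ gsrc g @ b) x" by (rule span_up[OF that u])
  show "span v w (K p g b)" if "v = rev p @ gsrc g @ b" using span_up_path[OF u] that by simp
qed

lemma down_path_K:
  "is_down g \<Longrightarrow> w = rev p @ gtgt g @ b \<Longrightarrow> down_path v (rev p @ gsrc g @ b) x \<Longrightarrow> down_path v w (K p g b * x)"
  "is_down g \<Longrightarrow> w = rev p @ gtgt g @ b \<Longrightarrow> v = rev p @ gsrc g @ b \<Longrightarrow> down_path v w (K p g b)"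
  using down_K[of v p g b x] down_K[OF down_E, of g p b] by (auto simp: K_E)

lemma span_E: "v = x \<Longrightarrow> w = x \<Longrightarrow> span v w (E x)"
  using span_down_path[OF down_E] by simp

lemma down_up_com:
  "is_down f \<Longrightarrow> \<not> is_down g \<Longrightarrow> q = rev (gsrc f) @ p \<Longrightarrow> c = gtgt g @ b \<Longrightarrow>
    K p f c * K q g b = K (rev (gtgt f) @ p) g b * K p f (gsrc g @ b)"
  by (rule K_com) (cases f; simp)+

lemmas down_up_coms = down_up_com down_up_com[THEN left_assoc]

text \<open>A downward layer after its own reflection gives the identity, except \<open>Gd\<close>
  after \<open>Gdb\<close>, where two lower projections are subtracted; all other pairs
  vanish.\<close>

lemma same_peak:
  assumes "is_down g" "\<not> is_down h" "gsrc g = gtgt h"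
  shows "span (rev p @ gsrc h @ b) (rev p @ gtgt g @ b) (K p g b * K p h b :: 'k::field sp4_ring)"
  using assms
  apply (cases g; cases h; simp add: sp4_rel_full t_tb)
  apply ((rule span_zero | rule span_E, (simp; fail), (simp; fail) | rule span_diff | rule span_add | rule span_uminus
     | rule span_K(1), (simp; fail), (simp; fail), simp only: gsrc.simps append.simps | rule span_K(2), (simp; fail), (simp; fail), (simp; fail)
     | rule span_down_path | rule down_path_K(1), (simp; fail), (simp; fail), simp only: gsrc.simps append.simps
     | rule down_path_K(2), (simp; fail), (simp; fail), (simp; fail))+)
  done

text \<open>This and the next two equations are relations solved for the product that goes up and
  then down, the form in which the peaks are rewritten.\<close>

lemma b21_s: "K p Gb21 (B1 # b) * K (B2 # p) Gs b = K (B1 # p) Gb12 b * K p Gs (B2 # b)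
    + K (B1 # p) Gb12 b * (K (B1 # p) Gtb b * K p Gd b) - K p Gtb (B1 # b) * K p Gd b"
  by (simp add: sp4_rel_peak(24))

lemma m_b12: "K (B2 # p) Gm b * K p Gb12 (B1 # b) = K p Gm (B2 # b) * K (B1 # p) Gb21 b
    + K p Gdb b * (K (B1 # p) Gt b * K (B1 # p) Gb21 b) - K p Gdb b * K p Gt (B1 # b)"
  by (simp add: sp4_rel_peak(23))

lemma t_b12: "K (B2 # p) Gt b * K p Gb12 (B2 # b)
    = K p Gm (B1 # b) * K (B1 # p) Gd b + K p Gb12 b * (K p Gtb b * K (B1 # p) Gc2 b)"
  by (simp add: sp4_rel_peak(31))

text \<open>The layers share the letter y. Each such pair is replaced by means of a relation or a
  derived identity whose summands go down first, once layers on separate letters have been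
  exchanged.\<close>

lemma peak_right:
  assumes "is_down g" "\<not> is_down h" "gsrc g = [x, y]" "gtgt h = [y, z]"
  shows "span (rev p @ x # gsrc h @ c) (rev p @ gtgt g @ z # c) (K p g (z # c) * K (x # p) h c :: 'k::field sp4_ring)"
  using assms
  apply (cases g; cases h; clarsimp)
  apply (simp_all only: sp4_rel_peak(2,4,6,8,9,12,14,16,17,19,21,27,29) sp4_rel_peak(26)[symmetric]
    c1_tb b21_s b21_tb d_db)
  apply (simp_all add: down_up_coms span_zero)
  apply (simp_all only: mult.assoc down_up_coms(2) gsrc.simps gtgt.simps)
  apply ((rule span_zero | rule span_E, (simp; fail), (simp; fail) | rule span_diff | rule span_add | rule span_uminus
     | rule span_K(1), (simp; fail), (simp; fail), simp only: gsrc.simps append.simps | rule span_K(2), (simp; fail), (simp; fail), (simp; fail)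
     | rule span_down_path | rule down_path_K(1), (simp; fail), (simp; fail), simp only: gsrc.simps append.simps
     | rule down_path_K(2), (simp; fail), (simp; fail), (simp; fail))+)
  done

lemma peak_left:
  assumes "is_down g" "\<not> is_down h" "gsrc g = [y, z]" "gtgt h = [x, y]"
  shows "span (rev p @ gsrc h @ z # c) (rev p @ x # gtgt g @ c) (K (x # p) g c * K p h (z # c) :: 'k::field sp4_ring)"
  using assms
  apply (cases g; cases h; clarsimp)
  apply (simp_all only: sp4_rel_peak(1,3,5,7,10,11,13,15,18,20,22,28,30) sp4_rel_peak(25)[symmetric]
    t_u1 m_b12 t_b12 db_d)
  apply (simp_all add: down_up_coms span_zero)
  apply (simp_all only: mult.assoc)
  apply (simp_all add: down_up_coms)
  apply (simp_all only: mult.assoc)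
  apply (simp_all add: down_up_coms)
  apply ((rule span_zero | rule span_E, (simp; fail), (simp; fail) | rule span_diff | rule span_add | rule span_uminus
     | rule span_K(1), (simp; fail), (simp; fail), simp only: gsrc.simps append.simps | rule span_K(2), (simp; fail), (simp; fail), (simp; fail)
     | rule span_down_path | rule down_path_K(1), (simp; fail), (simp; fail), simp only: gsrc.simps append.simps
     | rule down_path_K(2), (simp; fail), (simp; fail), (simp; fail))+)
  done

section \<open>The order on words\<close>

fun word_weight :: "fund list \<Rightarrow> nat" where
  "word_weight [] = 0" | "word_weight (B1 # w) = 2 + word_weight w" | "word_weight (B2 # w) = 3 + word_weight w"

fun inversions :: "fund list \<Rightarrow> nat" where
  "inversions [] = 0" | "inversions (B1 # w) = inversions w"
| "inversions (B2 # w) = count_list w B1 + inversions w"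

text \<open>The weights must satisfy 0 < w1 < w2 < 2 w1, so that \<open>Gt\<close> and the caps,
  \<open>Gd\<close> and \<open>Gm\<close> lower the total; 2 and 3 are the least solution.
  \<open>Gb21\<close> alone keeps the weight, and it removes one inversion.\<close>

definition word_order :: "(fund list \<times> fund list) set" where
  "word_order = measures [word_weight, inversions]"

lemma wf_word_order: "wf word_order"
  by (simp add: word_order_def)

lemma word_weight_append: "word_weight (a @ b) = word_weight a + word_weight b"
  by (induction a rule: word_weight.induct) auto

lemma inversions_append: "inversions (a @ b) = inversions a + inversions b + count_list a B2 * count_list b B1"
  by (induction a rule: inversions.induct) (auto simp: algebra_simps)

lemma down_decreases: "is_down g \<Longrightarrow> (a @ gtgt g @ b, a @ gsrc g @ b) \<in> word_order"
  by (cases g) (auto simp: word_order_def word_weight_append inversions_append)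

lemma up_increases: "\<not> is_down g \<Longrightarrow> (a @ gsrc g @ b, a @ gtgt g @ b) \<in> word_order"
  by (cases g) (auto simp: word_order_def word_weight_append inversions_append)

lemma length_gsrc_down: "is_down g \<Longrightarrow> length (gsrc g) = 2"
  by (cases g) auto

lemma length_gtgt_up: "\<not> is_down g \<Longrightarrow> length (gtgt g) = 2"
  by (cases g) auto

lemma span_disjoint:
  assumes "is_down g" "\<not> is_down h"
  shows "span (rev p @ gsrc g @ m @ gsrc h @ c) (rev p @ gtgt g @ m @ gtgt h @ c)
      (K p g (m @ gtgt h @ c) * K (rev (gsrc g @ m) @ p) h c)"
    and "span (rev p @ gsrc h @ m @ gsrc g @ c) (rev p @ gtgt h @ m @ gtgt g @ c)
      (K (rev (gtgt h @ m) @ p) g c * K p h (m @ gsrc g @ c))"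
proof -
  show "span (rev p @ gsrc g @ m @ gsrc h @ c) (rev p @ gtgt g @ m @ gtgt h @ c)
      (K p g (m @ gtgt h @ c) * K (rev (gsrc g @ m) @ p) h c)"
    unfolding K_interchange
    by (rule span_K(1)[OF assms(2)], simp, rule span_down_path, rule down_path_K(2)[OF assms(1)]) simp_all
  show "span (rev p @ gsrc h @ m @ gsrc g @ c) (rev p @ gtgt h @ m @ gtgt g @ c)
      (K (rev (gtgt h @ m) @ p) g c * K p h (m @ gsrc g @ c))"
    unfolding K_interchange[of p h m g c, symmetric]
    by (rule span_K(1)[OF assms(2)], simp, rule span_down_path, rule down_path_K(2)[OF assms(1)]) simp_all
qed

lemma peak:
  assumes g: "is_down g" and h: "\<not> is_down h" and eq: "rev p @ gsrc g @ b = rev q @ gtgt h @ c"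
  shows "span (rev q @ gsrc h @ c) (rev p @ gtgt g @ b) (K p g b * K q h c :: 'k::field sp4_ring)"
proof -
  obtain x y where xy: "gsrc g = [x, y]" using length_gsrc_down[OF g] by (auto simp: length_Suc_conv numeral_2_eq_2)
  obtain x' y' where xy': "gtgt h = [x', y']" using length_gtgt_up[OF h] by (auto simp: length_Suc_conv numeral_2_eq_2)
  \<comment> \<open>\<open>us\<close> is the offset between the two layers. Each touches exactly two
    letters of the peak word, so an offset of 0 means both letters are shared, 1 means one letter,
    and a larger offset means none.\<close>
  from eq obtain us where "rev p = rev q @ us \<and> us @ gsrc g @ b = gtgt h @ c \<or> rev p @ us = rev q \<and> gsrc g @ b = us @ gtgt h @ c"
    unfolding append_eq_append_conv2 by blast
  then show ?thesis
  proof
    assume us: "rev p = rev q @ us \<and> us @ gsrc g @ b = gtgt h @ c"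
    then have p: "p = rev us @ q" by (metis rev_append rev_rev_ident)
    consider "us = []" | u where "us = [u]" | u u' m where "us = u # u' # m" by (metis list.exhaust)
    then show ?thesis
    proof cases
      case 1
      then show ?thesis using same_peak[OF g h, of p b] us xy xy' p by simp
    next
      case 2
      then show ?thesis using peak_left[OF g h, of x y x' q b] us xy xy' p by simp
    next
      case 3
      then show ?thesis using span_disjoint(2)[OF g h, of q m b] us xy xy' p by auto
    qed
  next
    assume us: "rev p @ us = rev q \<and> gsrc g @ b = us @ gtgt h @ c"
    then have q: "q = rev us @ p" by (metis rev_append rev_rev_ident)
    consider "us = []" | u where "us = [u]" | u u' m where "us = u # u' # m" by (metis list.exhaust)
    then show ?thesis
    proof cases
      case 1
      then show ?thesis using same_peak[OF g h, of p b] us xy xy' q by simp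
    next
      case 2
      then show ?thesis using peak_right[OF g h, of x y y' p c] us xy xy' q by simp
    next
      case 3
      then show ?thesis using span_disjoint(1)[OF g h, of p m c] us xy xy' q by auto
    qed
  qed
qed

text \<open>Paths are built by adding a last layer, but rewriting at a peak concerns the layer
  applied first, which is the rightmost factor.\<close>

lemma down_path_first:
  "down_path z w d \<Longrightarrow> (w = z \<and> d = E z) \<or>
    (\<exists>g p b d'. is_down g \<and> z = rev p @ gsrc g @ b \<and> down_path (rev p @ gtgt g @ b) w d' \<and> d = d' * K p g b)"
proof (induction rule: down_path.induct)
  case (down_K v p g b x)
  from down_K.IH show ?case
  proof (elim disjE exE conjE)
    assume "rev p @ gsrc g @ b = v" "x = E v"
    then show ?thesis using down_K.hyps down_E[of "rev p @ gtgt g @ b"]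
      by (intro disjI2 exI[of _ g] exI[of _ p] exI[of _ b] exI[of _ "E (rev p @ gtgt g @ b)"]) (auto simp: K_E E_K)
  next
    fix g' p' b' d' assume "is_down g'" "v = rev p' @ gsrc g' @ b'"
      "down_path (rev p' @ gtgt g' @ b') (rev p @ gsrc g @ b) d'" "x = d' * K p' g' b'"
    then show ?thesis using down_K.hyps down_path.down_K[of "rev p' @ gtgt g' @ b'" p g b d']
      by (intro disjI2 exI[of _ g'] exI[of _ p'] exI[of _ b'] exI[of _ "K p g b * d'"]) (auto simp: mult.assoc)
  qed
qed simp

text \<open>A path that goes up to the word \<open>z\<close> and then down is rewritten at its peak \<open>z\<close>; all new peaks are
  smaller than \<open>z\<close>.\<close>

lemma straighten: "down_path z w d \<Longrightarrow> up_path v z u \<Longrightarrow> span v w (d * u :: 'k::field sp4_ring)"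
proof (induction z arbitrary: v w d u rule: wf_induct_rule[OF wf_word_order])
  case (1 z)
  note IH = "1.IH"
  from down_path_first[OF "1.prems"(1)] show ?case
  proof (elim disjE exE conjE)
    assume "w = z" "d = E z"
    then show ?thesis using up_path_E[OF "1.prems"(2)] span_up_path[OF "1.prems"(2)] by simp
  next
    fix g p b d' assume g: "is_down g" and z: "z = rev p @ gsrc g @ b"
      and d': "down_path (rev p @ gtgt g @ b) w d'" and d: "d = d' * K p g b"
    from "1.prems"(2) show ?thesis
    proof cases
      case up_E
      then show ?thesis using down_path_E[OF "1.prems"(1)] span_down_path[OF "1.prems"(1)] by simp
    next
      case (up_K q h c x)
      let ?y = "rev q @ gsrc h @ c" and ?w = "rev p @ gtgt g @ b"
      have below: "(?y, z) \<in> word_order" "(?w, z) \<in> word_order"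
        using up_increases[OF up_K(4), of "rev q" c] down_decreases[OF g, of "rev p" b] up_K(1) z by simp_all
      \<comment> \<open>\<open>e\<close> is a combination of products u1 d1 replacing the peak.
        First d1 after x is straightened at the smaller word \<open>?y\<close>; then d' after the
        resulting upward path is straightened at the smaller word \<open>?w\<close>.\<close>
      have "span v w (d' * (e * x))" if "span ?y ?w e" for e
        using that
      proof (induction rule: span.induct)
        case span_zero then show ?case by (simp add: span.span_zero)
      next
        case (span_path z' d1 u1 r)
        have "span v w (d' * (u1 * f))" if "span v z' f" for f
          using that
        proof (induction rule: span.induct)
          case span_zero then show ?case by (simp add: span.span_zero)
        next
          case (span_path z'' d2 u2 r)
          from span_down[OF IH[OF below(2) d' up_path_comp[OF \<open>up_path z' ?w u1\<close> span_path(2)]] span_path(1)]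
          have "span v w (d' * (u1 * (u2 * d2)))" by (simp add: mult.assoc)
          from span_scalar[OF this, of r] show ?case
            by (simp add: up_path_scalar[OF \<open>up_path z' ?w u1\<close>] down_path_scalar[OF d'])
        next
          case (span_add f f') then show ?case by (simp add: distrib_left span.span_add)
        qed
        from span_scalar[OF this[OF IH[OF below(1) span_path(1) up_K(3)]], of r]
        show ?case by (simp add: down_path_scalar[OF d'] mult.assoc)
      next
        case (span_add e e') then show ?case by (simp add: distrib_left distrib_right span.span_add)
      qed
      from this[OF peak[OF g up_K(4)]] show ?thesis using up_K(1,2) z by (simp add: d mult.assoc)
    qed
  qed
qed

section \<open>Every morphism is a combination of straight paths\<close>

lemma span_down_left: "span v z x \<Longrightarrow> down_path z w d \<Longrightarrow> span v w (d * x :: 'k::field sp4_ring)"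
proof (induction rule: span.induct)
  case (span_path z' d' u r)
  from span_scalar[OF span_down[OF straighten[OF span_path(3,2)] span_path(1)], of r]
  show ?case by (simp add: down_path_scalar[OF span_path(3)] mult.assoc)
qed (auto simp: distrib_left intro: span.intros)

lemma span_comp: "span z w y \<Longrightarrow> span v z x \<Longrightarrow> span v w (y * x :: 'k::field sp4_ring)"
proof (induction rule: span.induct)
  case (span_path z' d u r)
  from span_scalar[OF span_up[OF span_down_left[OF span_path(3,1)] span_path(2)], of r]
  show ?case by (simp add: mult.assoc)
qed (auto simp: distrib_right intro: span.intros)

lemma span_W: "sp4_wt t \<Longrightarrow> span (a @ sp4_src t @ b) (a @ sp4_tgt t @ b) (W a t b :: 'k::field sp4_ring)"
proof (induction t arbitrary: a b)
  case (Gen g)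
  have K: "W a (Gen g) b = K (rev a) g b" by (simp add: K_def)
  show ?case unfolding K
    by (cases "is_down g") (rule span_down_path down_path_K(2) span_K(2); simp)+
next
  case (Comp s t)
  then show ?case using span_comp[of "a @ sp4_tgt t @ b" "a @ sp4_tgt s @ b" "W a s b" "a @ sp4_src t @ b" "W a t b"]
    by (simp add: W_comp)
next
  case (Tens s t)
  then show ?case
    using span_comp[OF Tens.IH(1)[of a "sp4_tgt t @ b"] , of "a @ sp4_src s @ sp4_src t @ b" "W (a @ sp4_src s) t b"]
      Tens.IH(2)[of "a @ sp4_src s" b]
    by (simp add: W_tensor(1))
qed (auto simp: W_ide W_zero W_add W_scale intro: span_E span_zero span_add span_scalar)

lemma span_act: "sp4_typed t v w \<Longrightarrow> span v w (act t :: 'k::field sp4_ring)"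
  using span_W[of t "[]" "[]"] by (auto simp: W_empty has_type_def)

section \<open>The idempotents of the sorted words\<close>

definition sorted_word :: "fund list \<Rightarrow> bool" where
  "sorted_word z \<longleftrightarrow> (\<forall>a b. z \<noteq> a @ [B2, B1] @ b)"

text \<open>The projection of a product of two fundamental crystals to its top component.\<close>

fun top_pair :: "fund \<Rightarrow> fund \<Rightarrow> 'k::field sp4_term" where
  "top_pair B1 B1 = (Ide [B1, B1] \<boxminus> gu1 \<bullet> gc1) \<boxminus> gs \<bullet> gm"
| "top_pair B1 B2 = Ide [B1, B2] \<boxminus> gtb \<bullet> gt"
| "top_pair B2 B2 = (Ide [B2, B2] \<boxminus> gu2 \<bullet> gc2) \<boxminus> gdb \<bullet> gd"
| "top_pair B2 B1 = Ide [B2, B1]"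

lemma top_pair_typed: "sp4_wt (top_pair x y)" "sp4_src (top_pair x y) = [x, y]" "sp4_tgt (top_pair x y) = [x, y]"
  by (cases x; cases y; simp)+

definition top_at :: "fund list \<Rightarrow> nat \<Rightarrow> 'k::field sp4_term" where
  "top_at z i = (Ide (take i z) \<boxdot> top_pair (z ! i) (z ! Suc i)) \<boxdot> Ide (drop (Suc (Suc i)) z)"

primrec top_term :: "fund list \<Rightarrow> nat \<Rightarrow> 'k::field sp4_term" where
  "top_term z 0 = Ide z"
| "top_term z (Suc n) = top_term z n \<bullet> top_at z n"

text \<open>A word of length l has l - 1 adjacent pairs; the truncated difference yields the
  identity for the empty word and for single letters.\<close>

definition top_word :: "fund list \<Rightarrow> 'k::field sp4_term" where
  "top_word z = top_term z (length z - Suc 0)"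

lemma split_pair: "Suc i < length z \<Longrightarrow> z = take i z @ z ! i # z ! Suc i # drop (Suc (Suc i)) z"
  by (metis Cons_nth_drop_Suc Suc_lessD append_take_drop_id)

lemma top_at_typed: "Suc i < length z \<Longrightarrow> sp4_typed (top_at z i) z z"
  using split_pair[of i z] by (simp add: top_at_def has_type_def top_pair_typed)

lemma top_term_typed: "n \<le> length z - Suc 0 \<Longrightarrow> sp4_typed (top_term z n :: 'k::field sp4_term) z z"
proof (induction n)
  case (Suc n)
  then have "sp4_typed (top_term z n :: 'k sp4_term) z z" "sp4_typed (top_at z n :: 'k sp4_term) z z"
    by (simp_all add: top_at_typed)
  then show ?case by (simp add: has_type_def)
qed (simp add: has_type_def)

lemma top_typed: "sp4_typed (top_word z) z z"
  by (simp add: top_word_def top_term_typed)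

abbreviation top_ring :: "fund list \<Rightarrow> nat \<Rightarrow> 'k::field sp4_ring" where
  "top_ring z i \<equiv> W (take i z) (top_pair (z ! i) (z ! Suc i)) (drop (Suc (Suc i)) z)"

lemma act_top_at: "act (top_at z i) = top_ring z i"
  by (simp add: top_at_def W_def)

lemma act_top_term_Suc:
  assumes "Suc n \<le> length z - Suc 0"
  shows "act (top_term z (Suc n)) = act (top_term z n) * (top_ring z n :: 'k::field sp4_ring)"
proof -
  have "sp4_typed (top_term z n :: 'k sp4_term) z z" "sp4_typed (top_at z n :: 'k sp4_term) z z"
    using assms by (simp_all add: top_at_typed top_term_typed)
  then show ?thesis by (simp add: act_comp has_type_def act_top_at)
qed

section \<open>Top projections kill layers and commute\<close>

lemma W_top_pair:
  "W (rev p) (top_pair B1 B1) b = (E (rev p @ B1 # B1 # b) - K p Gu1 b * K p Gc1 b - K p Gs b * K p Gm b :: 'k::field sp4_ring)"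
  "W (rev p) (top_pair B1 B2) b = (E (rev p @ B1 # B2 # b) - K p Gtb b * K p Gt b :: 'k::field sp4_ring)"
  "W (rev p) (top_pair B2 B2) b = (E (rev p @ B2 # B2 # b) - K p Gu2 b * K p Gc2 b - K p Gdb b * K p Gd b :: 'k::field sp4_ring)"
  "W (rev p) (top_pair B2 B1) b = (E (rev p @ B2 # B1 # b) :: 'k::field sp4_ring)"
  by (simp_all add: W_simps K_def)

declare top_pair.simps [simp del]

text \<open>A downward layer is reproduced by its own subtracted summand and killed by the others.
  For \<open>Gd\<close> the product with \<open>Gdb\<close> brings corrections, which disappear by
  c1 d = 0 and \<open>m_d\<close>.\<close>

lemma down_top_pair:
  assumes "is_down g" "gsrc g = [x, y]" "[x, y] \<noteq> [B2, B1]"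
  shows "K p g b * W (rev p) (top_pair x y) b = (0 :: 'k::field sp4_ring)"
  using assms
  by (cases g) (auto simp: W_top_pair ring_diff_distribs K_E E_K sp4_rel_full t_tb m_d
      left_assoc[OF sp4_rel_full(1)] left_assoc[OF sp4_rel_full(2)] left_assoc[OF sp4_rel_full(3)]
      left_assoc[OF sp4_rel_full(6)] left_assoc[OF sp4_rel_full(7)] left_assoc[OF sp4_rel_full(8)]
      left_assoc[OF sp4_rel_full(11)] left_assoc[OF sp4_rel_full(12)] left_assoc[OF t_tb] mult.assoc)

lemma up_top_pair:
  assumes "\<not> is_down g" "gtgt g = [x, y]" "[x, y] \<noteq> [B2, B1]"
  shows "W (rev p) (top_pair x y) b * K p g b = (0 :: 'k::field sp4_ring)"
  using assms
  by (cases g) (auto simp: W_top_pair ring_diff_distribs K_E E_K sp4_rel_full t_tb db_s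
      left_assoc[OF sp4_rel_full(1)] left_assoc[OF sp4_rel_full(2)] left_assoc[OF sp4_rel_full(3)]
      left_assoc[OF sp4_rel_full(10)] left_assoc[OF db_s] mult.assoc)

text \<open>Sorted triples leave four cases. Mixed products either vanish or agree in the two
  orders, by relations that carry a layer from one pair of letters to the overlapping pair.\<close>

lemma top_pair_commute:
  assumes "[x, y] \<noteq> [B2, B1]" "[y, z] \<noteq> [B2, B1]"
  shows "W (rev p) (top_pair x y) (z # b) * W (rev (x # p)) (top_pair y z) b
    = W (rev (x # p)) (top_pair y z) b * (W (rev p) (top_pair x y) (z # b) :: 'k::field sp4_ring)"
proof -
  consider "x = B1" "y = B1" "z = B1" | "x = B1" "y = B1" "z = B2" | "x = B1" "y = B2" "z = B2"
    | "x = B2" "y = B2" "z = B2"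
    using assms by (cases x; cases y; cases z) auto
  then show ?thesis
  proof cases
    case 1
    then show ?thesis
      by (simp only: 1 W_top_pair, simp add: ring_diff_distribs K_E E_K E_E left_assoc[OF K_E] left_assoc[OF E_K] mult.assoc
        left_assoc[OF sp4_rel_peak(14)] left_assoc[OF sp4_rel_peak(9)] left_assoc[OF sp4_rel_peak(6)] left_assoc[OF sp4_rel_peak(4)]
        left_assoc[OF sp4_rel_peak(13)] left_assoc[OF sp4_rel_peak(5)] left_assoc[OF sp4_rel_peak(10)] left_assoc[OF sp4_rel_peak(3)]
        left_assoc[OF sp4_rel_more(3)] sp4_rel_more(12))
  next
    case 2
    then show ?thesis
      by (simp only: 2 W_top_pair, simp add: ring_diff_distribs K_E E_K E_E left_assoc[OF K_E] left_assoc[OF E_K] mult.assoc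
        left_assoc[OF c1_tb] left_assoc[OF sp4_rel_peak(2)] left_assoc[OF t_u1] left_assoc[OF sp4_rel_peak(1)]
        left_assoc[OF sp4_rel_more(5)] sp4_rel_more(4))
  next
    case 3
    then show ?thesis
      by (simp only: 3 W_top_pair, simp add: ring_diff_distribs K_E E_K E_E left_assoc[OF K_E] left_assoc[OF E_K] mult.assoc
        left_assoc[OF sp4_rel_peak(8)] left_assoc[OF sp4_rel_peak(19)] left_assoc[OF sp4_rel_peak(7)] left_assoc[OF sp4_rel_peak(20)]
        left_assoc[OF down_up_com] down_up_com left_assoc[OF sp4_rel_more(7)] sp4_rel_more(6))
  next
    case 4
    then show ?thesis
      by (simp only: 4 W_top_pair, simp add: ring_diff_distribs K_E E_K E_E left_assoc[OF K_E] left_assoc[OF E_K] mult.assoc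
        left_assoc[OF sp4_rel_peak(12)] left_assoc[OF sp4_rel_peak(17)] left_assoc[OF sp4_rel_peak(16)] left_assoc[OF d_db]
        left_assoc[OF sp4_rel_peak(11)] left_assoc[OF sp4_rel_peak(15)] left_assoc[OF sp4_rel_peak(18)] left_assoc[OF db_d]
        sp4_rel_more(8) left_assoc2[OF sp4_rel_more(9)])
  qed
qed

lemma sorted_word_pair: "sorted_word z \<Longrightarrow> Suc i < length z \<Longrightarrow> [z ! i, z ! Suc i] \<noteq> [B2, B1]"
  using split_pair[of i z] by (auto simp: sorted_word_def)

lemma top_ring_commute:
  assumes z: "sorted_word z" and i: "Suc i < length z" and j: "Suc j < length z"
  shows "top_ring z i * top_ring z j = top_ring z j * (top_ring z i :: 'k::field sp4_ring)"
proof -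
  have lt: "top_ring z i * top_ring z j = top_ring z j * (top_ring z i :: 'k sp4_ring)"
    if "i < j" "Suc j < length z" for i j
  proof (cases "j = Suc i")
    case True
    have d: "drop (Suc (Suc i)) z = z ! Suc (Suc i) # drop (Suc (Suc (Suc i))) z" "take (Suc i) z = take i z @ [z ! i]"
      using that True by (simp_all add: Cons_nth_drop_Suc take_Suc_conv_app_nth)
    have "[z ! i, z ! Suc i] \<noteq> [B2, B1]" "[z ! Suc i, z ! Suc (Suc i)] \<noteq> [B2, B1]"
      using sorted_word_pair[OF z, of i] sorted_word_pair[OF z, of "Suc i"] that True by simp_all
    from top_pair_commute[OF this, of "rev (take i z)" "drop (Suc (Suc (Suc i))) z"]
    show ?thesis unfolding True d by simp
  next
    case False
    from that False have "Suc (Suc i) \<le> j" by simp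
    then obtain k where k: "j = Suc (Suc i) + k" using le_Suc_ex by blast
    \<comment> \<open>\<open>m\<close> is the word strictly between the two pairs, so that the
      interchange law applies.\<close>
    define m where "m = take k (drop (Suc (Suc i)) z)"
    have "take j z = take (Suc (Suc i)) z @ m" unfolding k take_add m_def ..
    then have t: "take j z = take i z @ [z ! i, z ! Suc i] @ m" using that by (simp add: take_Suc_conv_app_nth)
    have "drop (Suc (Suc i)) z = m @ drop j z"
      using append_take_drop_id[of k "drop (Suc (Suc i)) z", THEN HOL.sym]
      by (simp only: drop_drop k m_def add.commute)
    then have d: "drop (Suc (Suc i)) z = m @ [z ! j, z ! Suc j] @ drop (Suc (Suc j)) z"
      using that by (simp add: Cons_nth_drop_Suc)
    show ?thesis
      using W_interchange[of "top_pair (z ! i) (z ! Suc i)" "top_pair (z ! j) (z ! Suc j)" "take i z" m "drop (Suc (Suc j)) z"]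
      by (simp add: top_pair_typed t d)
  qed
  show ?thesis using lt[of i j] lt[of j i] i j by (cases i j rule: linorder_cases) auto
qed

lemma top_ring_commute_term:
  assumes "sorted_word z" "Suc i < length z" "n \<le> length z - Suc 0"
  shows "top_ring z i * act (top_term z n) = act (top_term z n) * (top_ring z i :: 'k::field sp4_ring)"
  using assms(3)
proof (induction n)
  case 0
  have z: "z = take i z @ sp4_src (top_pair (z ! i) (z ! Suc i) :: 'k sp4_term) @ drop (Suc (Suc i)) z"
    "z = take i z @ sp4_tgt (top_pair (z ! i) (z ! Suc i) :: 'k sp4_term) @ drop (Suc (Suc i)) z"
    using split_pair[OF assms(2)] by (simp_all add: top_pair_typed)
  show ?case using E_W[OF top_pair_typed(1) z(2)] W_E[OF top_pair_typed(1) z(1)]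
    by (simp add: E_def[symmetric])
next
  case (Suc n)
  have "top_ring z i * act (top_term z (Suc n)) = act (top_term z n) * (top_ring z i * (top_ring z n :: 'k sp4_ring))"
    using Suc by (simp add: act_top_term_Suc mult.assoc[symmetric] del: top_term.simps)
  also have "top_ring z i * top_ring z n = top_ring z n * (top_ring z i :: 'k sp4_ring)"
    using Suc.prems by (intro top_ring_commute[OF assms(1,2)]) auto
  finally show ?case using Suc.prems by (simp add: act_top_term_Suc mult.assoc del: top_term.simps)
qed

text \<open>Commutation brings the projection at the two letters on which g acts to the left end of
  the product, next to g, where \<open>down_top_pair\<close> applies.\<close>

lemma down_top:
  assumes z: "sorted_word z" and g: "is_down g" and eq: "z = rev p @ gsrc g @ b"
  shows "K p g b * act (top_word z) = (0 :: 'k::field sp4_ring)"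
proof -
  obtain x y where xy: "gsrc g = [x, y]" using length_gsrc_down[OF g] by (auto simp: length_Suc_conv numeral_2_eq_2)
  let ?i = "length p"
  have i: "Suc ?i < length z" by (simp add: eq xy)
  have t: "top_ring z ?i = (W (rev p) (top_pair x y) b :: 'k sp4_ring)" by (simp add: eq xy nth_append)
  have "[x, y] \<noteq> [B2, B1]" using sorted_word_pair[OF z i] by (simp add: eq xy nth_append)
  from down_top_pair[OF g xy this] have 0: "K p g b * top_ring z ?i = (0 :: 'k sp4_ring)" by (simp only: t)
  have "K p g b * act (top_term z n) = (0 :: 'k sp4_ring)" if "?i < n" "n \<le> length z - Suc 0" for n
    using that
  proof (induction n)
    case (Suc n)
    show ?case
    proof (cases "?i < n")
      case True
      then show ?thesis using Suc by (simp add: act_top_term_Suc mult.assoc[symmetric] del: top_term.simps)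
    next
      case False
      then have "n = ?i" using Suc.prems by simp
      moreover have "act (top_term z (Suc n)) = top_ring z n * (act (top_term z n) :: 'k sp4_ring)"
        using Suc.prems by (simp only: act_top_term_Suc) (rule top_ring_commute_term[OF z, THEN HOL.sym], auto)
      ultimately show ?thesis using 0 by (simp add: mult.assoc[symmetric] del: top_term.simps)
    qed
  qed simp
  then show ?thesis using i by (simp add: top_word_def)
qed

lemma up_top:
  assumes z: "sorted_word z" and g: "\<not> is_down g" and eq: "z = rev p @ gtgt g @ b"
  shows "act (top_word z) * K p g b = (0 :: 'k::field sp4_ring)"
proof -
  obtain x y where xy: "gtgt g = [x, y]" using length_gtgt_up[OF g] by (auto simp: length_Suc_conv numeral_2_eq_2)
  let ?i = "length p"
  have i: "Suc ?i < length z" by (simp add: eq xy)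
  have t: "top_ring z ?i = (W (rev p) (top_pair x y) b :: 'k sp4_ring)" by (simp add: eq xy nth_append)
  have "[x, y] \<noteq> [B2, B1]" using sorted_word_pair[OF z i] by (simp add: eq xy nth_append)
  from up_top_pair[OF g xy this] have 0: "top_ring z ?i * K p g b = (0 :: 'k sp4_ring)" by (simp only: t)
  have "act (top_term z n) * K p g b = (0 :: 'k sp4_ring)" if "?i < n" "n \<le> length z - Suc 0" for n
    using that
  proof (induction n)
    case (Suc n)
    show ?case
    proof (cases "?i < n")
      case True
      have "act (top_term z (Suc n)) * K p g b = top_ring z n * (act (top_term z n) * (K p g b :: 'k sp4_ring))"
        using Suc.prems by (simp only: act_top_term_Suc)
          (subst top_ring_commute_term[OF z, THEN HOL.sym], auto simp: mult.assoc)
      then show ?thesis using Suc True by (simp del: top_term.simps)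
    next
      case False
      then have "n = ?i" using Suc.prems by simp
      then show ?thesis using 0 Suc.prems by (simp only: act_top_term_Suc mult.assoc mult_zero_right)
    qed
  qed simp
  then show ?thesis using i by (simp add: top_word_def)
qed

lemma down_path_top:
  assumes "sorted_word z" "down_path z w d"
  shows "(w = z \<and> d = E z) \<or> d * act (top_word z) = 0"
  using down_path_first[OF assms(2)]
proof (elim disjE exE conjE)
  fix g p b d' assume "is_down g" "z = rev p @ gsrc g @ b" "d = d' * K p g b"
  then show ?thesis using down_top[OF assms(1), of g p b] by (metis mult.assoc mult_zero_right)
qed simp

lemma up_path_top:
  assumes "sorted_word z" "up_path v z u"
  shows "(v = z \<and> u = E z) \<or> act (top_word z) * u = 0"
  using assms(2)
proof cases
  case (up_K p g b x)
  then show ?thesis using up_top[OF assms(1), of g p b] by (metis mult.assoc mult_zero_left)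
qed simp

lemma E_act: "sp4_typed t v w \<Longrightarrow> E w * act t = act t" "sp4_typed t v w \<Longrightarrow> act t * E v = act t"
  using E_W[of t w "[]" "[]"] W_E[of t v "[]" "[]"] by (auto simp: W_empty has_type_def)

text \<open>A nontrivial path starts with a layer that goes down and ends with one that goes up, so it is killed by
  the idempotents at its ends.\<close>

lemma top_span_top:
  assumes z: "sorted_word z" and z': "sorted_word z'" and x: "span z z' (x :: 'k::field sp4_ring)"
  shows "\<exists>r. act (top_word z') * x * act (top_word z) = scalar r * (if z = z' then act (top_word z) * act (top_word z) else 0)"
  using x
proof (induction rule: span.induct)
  case span_zero
  show ?case by (rule exI[of _ 0]) (use scalar_simps(2)[of 0 0 "act (top_word z) * act (top_word z) :: 'k sp4_ring"] in auto)
next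
  case (span_path y d u r)
  have eq: "act (top_word z') * (scalar r * (u * d)) * act (top_word z) = scalar r * ((act (top_word z') * u) * (d * act (top_word z)))"
    by (simp add: mult.assoc scalar_commute[of r "top_word z'", THEN HOL.sym, THEN left_assoc])
  show ?case
  proof (cases "y = z' \<and> u = E z' \<and> y = z \<and> d = E z")
    case True
    then show ?thesis using eq E_act[OF top_typed[where ?'a = 'k], of z] by (intro exI[of _ r]) auto
  next
    case False
    then have "(act (top_word z') * u) * (d * act (top_word z)) = 0"
      using down_path_top[OF z span_path(1)] up_path_top[OF z' span_path(2)] by auto
    then show ?thesis
      using eq scalar_simps(2)[of 0 0 "act (top_word z) * act (top_word z) :: 'k sp4_ring"] by (intro exI[of _ 0]) auto
  qed
next
  case (span_add x y)
  then obtain r r' where "act (top_word z') * x * act (top_word z) = scalar r * (if z = z' then act (top_word z) * act (top_word z) else 0)"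
    "act (top_word z') * y * act (top_word z) = scalar r' * (if z = z' then act (top_word z) * act (top_word z) else 0)" by blast
  then show ?case by (intro exI[of _ "r + r'"]) (simp add: distrib_left distrib_right scalar_simps)
qed

text \<open>The two-sided ideal generated by the elements \<open>top_word z\<close>, described
  inside each hom space; scalars are absorbed into \<open>s\<close>.\<close>

inductive top_ideal :: "fund list \<Rightarrow> fund list \<Rightarrow> 'k::field sp4_ring \<Rightarrow> bool" for v w where
  ideal_zero: "top_ideal v w 0"
| ideal_top: "sorted_word z \<Longrightarrow> sp4_typed s z w \<Longrightarrow> sp4_typed t v z \<Longrightarrow> top_ideal v w (act s * act (top_word z) * act t)"
| ideal_add: "top_ideal v w x \<Longrightarrow> top_ideal v w y \<Longrightarrow> top_ideal v w (x + y)"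

lemma ideal_left: "top_ideal v z x \<Longrightarrow> sp4_typed s z w \<Longrightarrow> top_ideal v w (act s * x)"
proof (induction rule: top_ideal.induct)
  case (ideal_top y s' t)
  have "sp4_typed (s \<bullet> s') y w" "act (s \<bullet> s') = act s * act s'"
    using ideal_top(2,4) by (auto simp: has_type_def act_comp)
  then show ?case using top_ideal.ideal_top[OF ideal_top(1) _ ideal_top(3), of "s \<bullet> s'" w] by (simp add: mult.assoc)
qed (auto simp: distrib_left intro: top_ideal.intros)

lemma ideal_right: "top_ideal z w x \<Longrightarrow> sp4_typed s v z \<Longrightarrow> top_ideal v w (x * act s)"
proof (induction rule: top_ideal.induct)
  case (ideal_top y s' t)
  have "sp4_typed (t \<bullet> s) v y" "act (t \<bullet> s) = act t * act s"
    using ideal_top(3,4) by (auto simp: has_type_def act_comp)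
  then show ?case using top_ideal.ideal_top[OF ideal_top(1,2), of "t \<bullet> s" v] by (simp add: mult.assoc)
qed (auto simp: distrib_right intro: top_ideal.intros)

lemma K_term: "\<exists>t. sp4_typed t (rev p @ gsrc g @ b) (rev p @ gtgt g @ b) \<and> act t = (K p g b :: 'k::field sp4_ring)"
  by (rule exI[of _ "(Ide (rev p) \<boxdot> Gen g) \<boxdot> Ide b"]) (simp add: has_type_def K_def W_def)

text \<open>Modulo smaller words, the identity of a sorted word is its idempotent, and a word that is not sorted
  is isomorphic to a smaller one.\<close>

lemma identity_in_ideal: "top_ideal z z (E z :: 'k::field sp4_ring)"
proof (induction z rule: wf_induct_rule[OF wf_word_order])
  case (1 z)
  note IH = 1
  \<comment> \<open>A product that factors through a smaller word lies in the ideal, because the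
    identity of that word, in the ideal by induction, may be inserted in the middle.\<close>
  have through: "top_ideal z z (K p h b * K p g b :: 'k sp4_ring)"
    if "z = rev p @ gsrc g @ b" "gtgt h = gsrc g" "gsrc h = gtgt g" "(rev p @ gtgt g @ b, z) \<in> word_order" for p g h b
  proof -
    obtain s :: "'k sp4_term" where s: "sp4_typed s (rev p @ gsrc h @ b) (rev p @ gtgt h @ b)" "act s = K p h b"
      using K_term by blast
    obtain t :: "'k sp4_term" where t: "sp4_typed t (rev p @ gsrc g @ b) (rev p @ gtgt g @ b)" "act t = K p g b"
      using K_term by blast
    have "top_ideal z z (act s * E (rev p @ gtgt g @ b) * act t)"
      using IH[OF that(4)] s(1) t(1) that by (intro ideal_right[OF ideal_left]) auto
    then show ?thesis using E_act(1)[OF t(1)] by (simp add: mult.assoc s t)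
  qed
  show ?case
  proof (cases "sorted_word z")
    case False
    then obtain a b where z: "z = a @ [B2, B1] @ b" by (auto simp: sorted_word_def)
    have "E z = K (rev a) Gb12 b * (K (rev a) Gb21 b :: 'k sp4_ring)"
      using sp4_rel_full(5)[of "rev a" b, THEN HOL.sym] by (simp add: z)
    then show ?thesis using through[of "rev a" Gb21 b Gb12] down_decreases[of Gb21 a b] by (simp add: z)
  next
    case True
    \<comment> \<open>Telescoping: the difference for \<open>Suc n\<close> is the one for n plus
      \<open>act (top_term z n)\<close> times \<open>E z - top_ring z n\<close>, and the last factor
      is a sum of products through smaller words.\<close>
    have step: "top_ideal z z (E z - act (top_term z n) :: 'k sp4_ring)" if "n \<le> length z - Suc 0" for n
      using that
    proof (induction n)
      case 0
      then show ?case by (simp add: E_def ideal_zero)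
    next
      case (Suc n)
      have n: "Suc n < length z" using Suc.prems by simp
      let ?p = "rev (take n z)" and ?b = "drop (Suc (Suc n)) z"
      have z: "z = rev ?p @ [z ! n, z ! Suc n] @ ?b" using split_pair[OF n] by simp
      have "top_ideal z z (E z - top_ring z n :: 'k sp4_ring)"
      proof -
        have thr: "top_ideal z z (K ?p (greflect g) ?b * K ?p g ?b :: 'k sp4_ring)"
          if "is_down g" "gsrc g = [z ! n, z ! Suc n]" for g
        proof (rule through)
          show "z = rev ?p @ gsrc g @ ?b" using z that by simp
          show "(rev ?p @ gtgt g @ ?b, z) \<in> word_order"
            using down_decreases[OF that(1), of "rev ?p" ?b] z that by simp
        qed (cases g; simp)+
        have ez: "E z = (E (rev ?p @ z ! n # z ! Suc n # ?b) :: 'k sp4_ring)" using split_pair[OF n] by simp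
        note W_top = W_top_pair[where ?'k = 'k and p = ?p and b = ?b]
        show ?thesis
        proof (cases "z ! n"; cases "z ! Suc n")
          assume "z ! n = B1" "z ! Suc n = B1"
          then show ?thesis
            using ideal_add[OF thr[of Gc1] thr[of Gm]] W_top(1) ez by (simp add: add.commute)
        next
          assume "z ! n = B1" "z ! Suc n = B2"
          then show ?thesis using thr[of Gt] W_top(2) ez by simp
        next
          assume "z ! n = B2" "z ! Suc n = B2"
          then show ?thesis
            using ideal_add[OF thr[of Gc2] thr[of Gd]] W_top(3) ez by (simp add: add.commute)
        next
          assume "z ! n = B2" "z ! Suc n = B1"
          then show ?thesis using sorted_word_pair[OF True n] by simp
        qed
      qed
      from ideal_add[OF Suc.IH ideal_left[OF this top_term_typed[of n z]]] Suc.prems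
      have "top_ideal z z ((E z - act (top_term z n)) + act (top_term z n) * (E z - top_ring z n) :: 'k sp4_ring)" by simp
      then show ?case using E_act(2)[OF top_term_typed[where ?'k = 'k and n = n and z = z]] Suc.prems
        by (simp add: ring_diff_distribs act_top_term_Suc del: top_term.simps)
    qed
    have i: "sp4_typed (Ide z :: 'k sp4_term) z z" by (simp add: has_type_def)
    have "top_ideal z z (act (top_word z) :: 'k sp4_ring)"
      using ideal_top[OF True i i] E_act[OF top_typed[where ?'a = 'k], of z] by (simp add: E_def)
    from ideal_add[OF step[of "length z - Suc 0"] this] show ?thesis by (simp add: top_word_def)
  qed
qed

section \<open>The functor to crystals is full and faithful\<close>

lemma matrix_of_act_eq:
  assumes "sp4_typed s v w" "sp4_typed t v w" "act s = act t"
  shows "matrix_of s = matrix_of t"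
proof -
  have "sp4_eq v w s t" using assms act_eq_iff by blast
  from crys.interp_term_eq[OF crys_relations this] show ?thesis by (simp add: matrix_of_def)
qed

lemma matrix_of_comp:
  "sp4_typed t v w \<Longrightarrow> sp4_typed s w u \<Longrightarrow> matrix_of (s \<bullet> t) = matrix_comp w (matrix_of t) (matrix_of s)"
  by (auto simp: has_type_def matrix_of_simps)

lemma comp_typed: "sp4_typed t v w \<Longrightarrow> sp4_typed s w u \<Longrightarrow> sp4_typed (s \<bullet> t) v u"
  by (auto simp: has_type_def)

lemma act_comp_typed: "sp4_typed t v w \<Longrightarrow> sp4_typed s w u \<Longrightarrow> act (s \<bullet> t) = act s * act t"
  by (auto simp: has_type_def act_comp)

lemma matrix_comp_row:
  assumes "map letter_fund y = v" "\<And>u. M x u = (if u = y then c else 0)"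
  shows "matrix_comp v M N x z = c * N y z"
proof -
  have "matrix_comp v M N x z = (\<Sum>u\<in>word_elts v. if u = y then c * N y z else 0)"
    unfolding matrix_comp_def by (intro sum.cong) (auto simp: assms(2))
  also have "\<dots> = c * N y z" using assms(1) by (simp add: finite_word_elts)
  finally show ?thesis .
qed

lemma matrix_comp_zero_row: "(\<And>u. M x u = 0) \<Longrightarrow> matrix_comp v M N x z = 0"
  by (simp add: matrix_comp_def)

lemma matrix_comp_linear:
  "matrix_comp v (\<lambda>x y. 0) N = (\<lambda>x y. 0)" "matrix_comp v M (\<lambda>x y. 0) = (\<lambda>x y. 0)"
  "matrix_comp v (\<lambda>x y. M x y + M' x y) N = (\<lambda>x y. matrix_comp v M N x y + matrix_comp v M' N x y)"
  "matrix_comp v M (\<lambda>x y. N x y + N' x y) = (\<lambda>x y. matrix_comp v M N x y + matrix_comp v M N' x y)"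
  by (auto simp: matrix_comp_def fun_eq_iff algebra_simps sum.distrib)

section \<open>Sorted words and highest weight elements\<close>

lemma sorted_word_prefix: "sorted_word (w @ u) \<Longrightarrow> sorted_word w"
  unfolding sorted_word_def by (metis append.assoc)

lemma sorted_word_B1: "sorted_word (w @ [B1]) \<Longrightarrow> set w \<subseteq> {B1}"
proof (induction w rule: rev_induct)
  case (snoc c w)
  have "c = B1"
  proof (rule ccontr)
    assume "c \<noteq> B1"
    then have "(w @ [c]) @ [B1] = w @ [B2, B1] @ []" by (cases c) simp_all
    then show False using snoc.prems by (metis sorted_word_def)
  qed
  then show ?case using snoc sorted_word_prefix[of "w @ [B1]" "[B1]"] by simp
qed simp

lemma sorted_word_replicate: "sorted_word w \<Longrightarrow> \<exists>m n. w = replicate m B1 @ replicate n B2"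
proof (induction w rule: rev_induct)
  case Nil
  show ?case by (rule exI[of _ 0], rule exI[of _ 0]) simp
next
  case (snoc c w)
  show ?case
  proof (cases c)
    case B1
    then have "set w \<subseteq> {B1}" using sorted_word_B1 snoc.prems by simp
    then have "replicate (length w) B1 = w" by (intro replicate_length_same) blast
    then obtain n where w: "w = replicate n B1" by metis
    have "w @ [c] = replicate (Suc n) B1 @ replicate 0 B2" using B1 by (simp add: w replicate_append_same)
    then show ?thesis by blast
  next
    case B2
    from snoc.IH[OF sorted_word_prefix[OF snoc.prems]] obtain m n where "w = replicate m B1 @ replicate n B2" by blast
    then show ?thesis using B2
      by (intro exI[of _ m] exI[of _ "Suc n"]) (simp add: replicate_append_same)
  qed
qed

primrec top_letter :: "fund \<Rightarrow> letter" where
  "top_letter B1 = X1" | "top_letter B2 = Y1"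

abbreviation top_elt :: "fund list \<Rightarrow> letter list" where
  "top_elt \<equiv> map top_letter"

lemma letter_fund_top: "letter_fund (top_letter a) = a"
  by (cases a) simp_all

lemma letter_fund_top_comp [simp]: "letter_fund \<circ> top_letter = id"
  by (simp add: fun_eq_iff letter_fund_top)

lemma top_elt_word: "map letter_fund (top_elt z) = z"
  by simp

lemma matrix_comp_top_elt:
  assumes "\<And>u. M (top_elt z) u = (if u = top_elt z then 1 else 0)"
  shows "matrix_comp z M N (top_elt z) y = N (top_elt z) y"
  using matrix_comp_row[where M = M and y = "top_elt z" and x = "top_elt z" and c = 1, OF top_elt_word assms] by simp

text \<open>A sorted word is m letters \<open>B1\<close> followed by n letters \<open>B2\<close>,
  and its top element has weight (m, n); so sorted words correspond to dominant weights.\<close>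

lemma word_wt_top: "sorted_word z \<Longrightarrow> sorted_word z' \<Longrightarrow> word_wt (top_elt z) = word_wt (top_elt z') \<Longrightarrow> z = z'"
proof -
  have r: "word_wt (replicate m X1) = (int m, 0)" "word_wt (replicate m Y1) = (0, int m)" for m
    by (induction m) (auto simp: zero_prod_def)
  show "sorted_word z \<Longrightarrow> sorted_word z' \<Longrightarrow> word_wt (top_elt z) = word_wt (top_elt z') \<Longrightarrow> z = z'"
    by (auto dest!: sorted_word_replicate simp: word_wt_append r)
qed

lemma highest_weight_prefix: "highest_weight (a @ b) \<Longrightarrow> highest_weight a"
proof -
  assume "highest_weight (a @ b)"
  then have "word_eps i (a @ b) = 0" for i by (simp add: highest_weight_def word_raise_None)
  then show "highest_weight a" by (simp add: highest_weight_def word_raise_None word_eps_append)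
qed

text \<open>The first letter that is not a top letter forms with its predecessor an element of a lower component.\<close>

lemma highest_weight_down:
  assumes "highest_weight x" "sorted_word (map letter_fund x)"
  shows "x = top_elt (map letter_fund x) \<or>
    (\<exists>g a p c y. is_down g \<and> x = a @ p @ c \<and> map letter_fund p = gsrc g \<and> gen_map g p = Some y)"
  using assms
proof (induction x rule: rev_induct)
  case (snoc l x)
  from snoc.IH[OF highest_weight_prefix[OF snoc.prems(1)]] sorted_word_prefix[of "map letter_fund x"] snoc.prems(2)
  consider "x = top_elt (map letter_fund x)"
    | g a p c y where "is_down g" "x = a @ p @ c" "map letter_fund p = gsrc g" "gen_map g p = Some y"
    by auto
  then show ?case
  proof cases
    case 1
    \<comment> \<open>For x followed by l to admit no raising, l must not be raisable more often
      than x can be lowered.\<close>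
    have eps: "word_eps i [l] \<le> word_phi i x" for i
      using snoc.prems(1) by (simp add: highest_weight_def word_raise_None word_eps_append)
    show ?thesis
    proof (cases x rule: rev_cases)
      case Nil
      then have "letter_eps i l = 0" for i using eps[of i] by simp
      from this[of N1] this[of N2] have "l = X1 \<or> l = Y1" by (cases l) simp_all
      then show ?thesis using Nil by auto
    next
      case (snoc x' k)
      have k: "k = top_letter (letter_fund k)" using 1 snoc by simp
      have down: ?thesis if "is_down g" "map letter_fund [k, l] = gsrc g" "gen_map g [k, l] \<noteq> None" for g
      proof -
        have "is_down g \<and> x @ [l] = x' @ [k, l] @ [] \<and> map letter_fund [k, l] = gsrc g" using that snoc by simp
        with that(3) show ?thesis by blast
      qed
      show ?thesis
      proof (cases "letter_fund k")
        case B1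
        with k have k: "k = X1" by simp
        have "set (map letter_fund x') \<subseteq> {B1}"
          using sorted_word_B1[of "map letter_fund x'"] sorted_word_prefix[of "map letter_fund x" "[letter_fund l]"]
            snoc.prems(2) snoc k by simp
        moreover have "map (\<lambda>y. top_letter (letter_fund y)) x' = map (\<lambda>y. y) x'" using 1 snoc by (simp add: comp_def)
        ultimately have "set x' \<subseteq> {X1}" unfolding map_eq_conv by fastforce
        \<comment> \<open>Copies of \<open>X1\<close> have no lowering arrow for \<open>N2\<close>,
          which rules out \<open>X3\<close>, \<open>Y2\<close> and \<open>Y5\<close>. The pair found
          below need not be of highest weight itself, as \<open>[X1, Y4]\<close> shows.\<close>
        then have "word_phi N2 x' = 0" by (induction x') auto
        then have "letter_eps N2 l = 0" using eps[of N2] snoc k by (simp add: word_phi_append)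
        then consider "l = X1" | "l = X2" | "l = X4" | "l = Y1" | "l = Y3" | "l = Y4" by (cases l) simp_all
        then show ?thesis
        proof cases
          case 2 then show ?thesis using down[of Gm] k by (simp add: gen_map_simps)
        next
          case 3 then show ?thesis using down[of Gc1] k by (simp add: gen_map_simps)
        next
          case 5 then show ?thesis using down[of Gt] k by (simp add: gen_map_simps)
        next
          case 6 then show ?thesis using down[of Gt] k by (simp add: gen_map_simps)
        qed (use 1 in auto)
      next
        case B2
        with k have k: "k = Y1" by simp
        have "map letter_fund (x @ [l]) = map letter_fund x' @ [B2, letter_fund l] @ []" using snoc k by simp
        then have "letter_fund l \<noteq> B1" using snoc.prems(2) by (metis sorted_word_def)
        then consider "l = Y1" | "l = Y2" | "l = Y3" | "l = Y4" | "l = Y5" by (cases l) simp_all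
        then show ?thesis
        proof cases
          case 2 then show ?thesis using down[of Gd] k by (simp add: gen_map_simps)
        next
          case 3 then show ?thesis using down[of Gd] k by (simp add: gen_map_simps)
        next
          case 4 then show ?thesis using down[of Gd] k by (simp add: gen_map_simps)
        next
          case 5 then show ?thesis using down[of Gc2] k by (simp add: gen_map_simps)
        qed (use 1 in auto)
      qed
    qed
  next
    case 2
    then have "x @ [l] = a @ p @ (c @ [l])" by simp
    with 2(1,3,4) show ?thesis by blast
  qed
qed simp

lemma matrix_of_whisker:
  "matrix_of ((Ide a \<boxdot> Gen g) \<boxdot> Ide c :: 'k::field sp4_term)
    = word_matrix (a @ gsrc g @ c) (tensor_map (length (a @ gsrc g)) (tensor_map (length a) Some (gen_map g)) Some)"
  using matrix_tensor_word_matrix[OF word_morphism_tensor[OF word_morphism_id[of a] gen_map_morphism[of g]], of c Some]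
  by (simp add: matrix_of_simps matrix_tensor_word_matrix[OF word_morphism_id])

text \<open>Such an x contains a pair on which some downward generator is nonzero, so x is the image
  of an element under the reflected upward layer. \<open>up_top\<close> annihilates that layer, and
  the identity carries over to matrices.\<close>

lemma matrix_of_top_zero:
  assumes z: "sorted_word z" and x: "map letter_fund x = z" "highest_weight x" "x \<noteq> top_elt z"
  shows "matrix_of (top_word z :: 'k::field sp4_term) x y = 0"
proof -
  obtain g a p c r where g: "is_down g" "x = a @ p @ c" "map letter_fund p = gsrc g" "gen_map g p = Some r"
    using highest_weight_down[of x] assms by auto
  let ?a = "map letter_fund a" and ?c = "map letter_fund c" and ?h = "greflect g"
  have h: "\<not> is_down ?h" "gtgt ?h = gsrc g" "gsrc ?h = gtgt g" using g(1) by (cases g; simp)+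
  have r: "map letter_fund r = gtgt g" using word_morphismD(1)[OF gen_map_morphism g(3,4)] .
  let ?u = "(Ide ?a \<boxdot> Gen ?h) \<boxdot> Ide ?c :: 'k sp4_term"
  have zeq: "z = rev (rev ?a) @ gtgt ?h @ ?c" using x(1) g(2,3) h by simp
  have u: "sp4_typed ?u (?a @ gtgt g @ ?c) z" using zeq h by (simp add: has_type_def)
  have "act (top_word z \<bullet> ?u) = act (ZeroT (?a @ gtgt g @ ?c) z :: 'k sp4_term)"
    using up_top[OF z h(1) zeq] by (simp add: act_comp_typed[OF u top_typed] act_zero K_def W_def)
  then have "matrix_of (top_word z \<bullet> ?u) = matrix_of (ZeroT (?a @ gtgt g @ ?c) z :: 'k sp4_term)"
    by (rule matrix_of_act_eq[OF comp_typed[OF u top_typed] sp4_typed_zero])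
  then have 0: "matrix_comp z (matrix_of ?u) (matrix_of (top_word z :: 'k sp4_term)) (a @ r @ c) y = 0"
    by (simp add: matrix_of_comp[OF u top_typed] matrix_of_simps)
  have l: "length r = length (gtgt g)" using r by (metis length_map)
  have "matrix_of ?u (a @ r @ c) u = (if u = x then 1 else 0)" for u
    unfolding matrix_of_whisker
    using g(2,4) l by (auto simp: word_matrix_eq tensor_map_def h r gen_map_reflect[THEN iffD2])
  from matrix_comp_row[OF x(1), of "matrix_of ?u" "a @ r @ c" 1, OF this] 0 show ?thesis by simp
qed

lemma matrix_of_top_pair:
  "[a, b] \<noteq> [B2, B1] \<Longrightarrow> matrix_of (top_pair a b :: 'k::field sp4_term) (top_elt [a, b]) y = (if y = top_elt [a, b] then 1 else 0)"
  by (cases a; cases b) (auto simp: matrix_of_apply_term top_pair.simps gen_map_simps)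

lemma matrix_of_whisker_top:
  assumes "[x, y] \<noteq> [B2, B1]"
  shows "matrix_of ((Ide a \<boxdot> top_pair x y) \<boxdot> Ide c :: 'k::field sp4_term) (top_elt (a @ [x, y] @ c)) u
    = (if u = top_elt (a @ [x, y] @ c) then 1 else 0)"
proof -
  define n where "n = length a"
  have l: "length (top_elt a) = n" "length (top_elt [x, y]) = 2" by (simp_all add: n_def)
  have key: "u = top_elt (a @ [x, y] @ c)
    \<longleftrightarrow> take n u = top_elt a \<and> drop n (take (n + 2) u) = top_elt [x, y] \<and> drop (n + 2) u = top_elt c"
    using append_eq_conv_conj[of "top_elt a" "top_elt [x, y] @ top_elt c" u]
      append_eq_conv_conj[of "top_elt [x, y]" "top_elt c" "drop n u"]
    unfolding l take_drop drop_drop map_append by (metis add.commute)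
  show ?thesis
    unfolding key
    by (simp add: matrix_of_simps top_pair_typed matrix_tensor_def word_matrix_eq matrix_of_top_pair[OF assms, simplified] n_def[symmetric] eq_commute[of "top_elt _"] min_def)
qed

lemma matrix_of_top_at:
  assumes "sorted_word z" "Suc i < length z"
  shows "matrix_of (top_at z i :: 'k::field sp4_term) (top_elt z) y = (if y = top_elt z then 1 else 0)"
proof -
  have z: "take i z @ [z ! i, z ! Suc i] @ drop (Suc (Suc i)) z = z" using split_pair[OF assms(2)] by simp
  show ?thesis
    using matrix_of_whisker_top[OF sorted_word_pair[OF assms], of "take i z" "drop (Suc (Suc i)) z" y]
    unfolding z top_at_def .
qed

text \<open>The components subtracted in \<open>top_pair\<close> do not contain the pair of top
  letters, so every factor fixes \<open>top_elt z\<close>. Together with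
  \<open>matrix_of_top_zero\<close> this makes the matrix the projection to the component of
  \<open>top_elt z\<close>.\<close>

lemma matrix_of_top:
  assumes "sorted_word z"
  shows "matrix_of (top_word z :: 'k::field sp4_term) (top_elt z) y = (if y = top_elt z then 1 else 0)"
proof -
  have "matrix_of (top_term z n :: 'k sp4_term) (top_elt z) y = (if y = top_elt z then 1 else 0)"
    if "n \<le> length z - Suc 0" for n
    using that
  proof (induction n)
    case 0
    then show ?case by (auto simp: matrix_of_simps word_matrix_eq top_elt_word)
  next
    case (Suc n)
    then have n: "Suc n < length z" by simp
    have "matrix_of (top_term z (Suc n) :: 'k sp4_term) = matrix_comp z (matrix_of (top_at z n)) (matrix_of (top_term z n))"
      using Suc.prems n by (simp add: matrix_of_comp[OF top_at_typed top_term_typed])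
    with Suc show ?case
      by (simp add: matrix_comp_top_elt[where M = "matrix_of (top_at z n)", OF matrix_of_top_at[OF assms n]] del: top_term.simps)
  qed
  then show ?thesis by (simp add: top_word_def)
qed

section \<open>Schur's lemma and fullness\<close>

lemma word_homs_highest_weight:
  assumes "M \<in> word_homs v w" "map letter_fund x = v" "highest_weight x"
  shows "M x y \<noteq> 0 \<Longrightarrow> map letter_fund y = w \<and> highest_weight y \<and> word_wt y = word_wt x"
  using assms(1)
proof (induction rule: word_homs_induct)
  case (add M \<psi> c)
  show ?case
  proof (cases "M x y = 0")
    case True
    then have y: "\<psi> x = Some y" using add.prems by (simp add: word_matrix_eq split: if_splits)
    note D = word_morphismD[OF add.hyps(2) assms(2)]
    have "word_raise i y = None" for i using D(3)[of i] y assms(3) by (simp add: highest_weight_def)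
    then show ?thesis using D(1,2)[OF y] by (simp add: highest_weight_def)
  qed (use add.IH in blast)
qed simp

text \<open>The first cut leaves only \<open>top_elt z\<close> among the highest weight words.
  \<open>M\<close> sends it to highest weight words of the same weight, of which the second cut
  keeps only \<open>top_elt z'\<close>, and equal weights force z = z'.\<close>

lemma matrix_top_top:
  assumes z: "sorted_word z" and z': "sorted_word z'" and M: "M \<in> word_homs z z'"
  shows "\<exists>t. sp4_typed t z z' \<and> matrix_of t
    = matrix_comp z (matrix_of (top_word z)) (matrix_comp z' M (matrix_of (top_word z' :: 'k::field sp4_term)))"
proof -
  let ?N = "matrix_comp z (matrix_of (top_word z)) (matrix_comp z' M (matrix_of (top_word z' :: 'k sp4_term)))"
  let ?r = "M (top_elt z) (top_elt z')"
  let ?t = "if z = z' then ScaleT ?r (top_word z) else ZeroT z z'"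
  have N: "?N \<in> word_homs z z'" by (intro word_homs_comp matrix_of_hom top_typed M)
  have t: "sp4_typed ?t z z'" using top_typed[of z, where ?'a = 'k] by (auto simp: has_type_def)
  have mt: "matrix_of ?t x y = (if z = z' then ?r * matrix_of (top_word z) x y else 0)" for x y
    using top_typed[of z, where ?'a = 'k] by (cases "z = z'") (simp_all add: matrix_of_simps has_type_def)
  have hw: "highest_weight (top_elt z)"
  proof -
    have "word_eps i (top_elt w) = 0" for i w
    proof (induction w)
      case (Cons a w)
      then show ?case by (cases a; cases i) simp_all
    qed simp
    then show ?thesis by (simp add: highest_weight_def word_raise_None)
  qed
  have "matrix_of ?t = ?N"
  proof (rule word_homs_eqI[OF matrix_of_hom[OF t] N])
    fix x y assume x: "map letter_fund x = z" "highest_weight x"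
    show "matrix_of ?t x y = ?N x y"
    proof (cases "x = top_elt z")
      case False
      note 0 = matrix_of_top_zero[OF z x False, where ?'k = 'k]
      have "?N x y = 0" by (rule matrix_comp_zero_row, rule 0)
      then show ?thesis by (simp only: mt 0 mult_zero_right if_cancel)
    next
      case True
      have row: "M x u * matrix_of (top_word z') u y = (if u = top_elt z' then ?r * (if y = top_elt z' then 1 else 0) else 0)" for u
        using word_homs_highest_weight[OF M top_elt_word hw, of u] matrix_of_top_zero[OF z', of u y]
          matrix_of_top[OF z', of y] True by auto
      have "?N x y = (\<Sum>u\<in>word_elts z'. M x u * matrix_of (top_word z') u y)"
        unfolding True matrix_comp_top_elt[where M = "matrix_of (top_word z)", OF matrix_of_top[OF z]]
        by (simp add: matrix_comp_def)
      also have "\<dots> = ?r * (if y = top_elt z' then 1 else 0)"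
        unfolding row using top_elt_word by (simp add: finite_word_elts)
      also have "\<dots> = matrix_of ?t x y"
        using word_homs_highest_weight[OF M top_elt_word hw, of "top_elt z'"] word_wt_top[OF z' z]
          matrix_of_top[OF z, of y, where ?'k = 'k] True by (auto simp: mt)
      finally show ?thesis by (rule HOL.sym)
    qed
  qed
  with t show ?thesis by blast
qed

text \<open>Here the cut at the target is removed. Matrices belong to terms and not to ring
  elements, so a term \<open>X\<close> representing x is carried along; for a generator of the
  ideal, \<open>matrix_top_top\<close> handles the morphism between the two idempotents.\<close>

lemma ideal_matrix_right:
  assumes z: "sorted_word z" and N: "N \<in> word_homs z w"
    and "top_ideal w w (x :: 'k::field sp4_ring)"
  shows "\<exists>X t. sp4_typed X w w \<and> act X = x \<and> sp4_typed t z w \<and>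
    matrix_of t = matrix_comp z (matrix_of (top_word z)) (matrix_comp w N (matrix_of X))"
  using assms(3)
proof (induction rule: top_ideal.induct)
  case ideal_zero
  show ?case
    by (rule exI[of _ "ZeroT w w"], rule exI[of _ "ZeroT z w"])
      (simp add: sp4_typed_zero act_zero matrix_of_simps matrix_comp_linear)
next
  case (ideal_top z' s t)
  have T: "sp4_typed (top_word z') z' z'" by (rule top_typed)
  have M: "matrix_comp w N (matrix_of t) \<in> word_homs z z'" by (intro word_homs_comp N matrix_of_hom ideal_top)
  from matrix_top_top[OF z ideal_top(1) M] obtain r where r: "sp4_typed r z z'" "matrix_of r
    = matrix_comp z (matrix_of (top_word z)) (matrix_comp z' (matrix_comp w N (matrix_of t)) (matrix_of (top_word z')))" by blast
  note ty = comp_typed[OF ideal_top(3) comp_typed[OF T ideal_top(2)]]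
  have "act ((s \<bullet> top_word z') \<bullet> t) = act s * act (top_word z') * act t"
    using ideal_top T by (simp add: act_comp_typed[OF ideal_top(3) comp_typed[OF T ideal_top(2)]] act_comp_typed[OF T ideal_top(2)])
  moreover have "matrix_of (s \<bullet> r) = matrix_comp z (matrix_of (top_word z)) (matrix_comp w N (matrix_of ((s \<bullet> top_word z') \<bullet> t)))"
    by (simp add: matrix_of_comp[OF r(1) ideal_top(2)] r(2) matrix_of_comp[OF ideal_top(3) comp_typed[OF T ideal_top(2)]]
      matrix_of_comp[OF T ideal_top(2)] matrix_comp_assoc)
  ultimately show ?case using ty comp_typed[OF r(1) ideal_top(2)] by blast
next
  case (ideal_add x y)
  then obtain X s Y t where
    X: "sp4_typed X w w" "act X = x" "sp4_typed s z w" "matrix_of s = matrix_comp z (matrix_of (top_word z)) (matrix_comp w N (matrix_of X))"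
    and Y: "sp4_typed Y w w" "act Y = y" "sp4_typed t z w" "matrix_of t = matrix_comp z (matrix_of (top_word z)) (matrix_comp w N (matrix_of Y))"
    by blast
  show ?case
    by (rule exI[of _ "X \<boxplus> Y"], rule exI[of _ "s \<boxplus> t"])
      (use X Y in \<open>auto simp: has_type_def act_add matrix_of_simps matrix_comp_linear\<close>)
qed

lemma matrix_top_full:
  assumes z: "sorted_word z" and N: "N \<in> word_homs z w"
  shows "\<exists>t. sp4_typed t z w \<and> matrix_of t = matrix_comp z (matrix_of (top_word z)) (N :: _ \<Rightarrow> _ \<Rightarrow> 'k::field)"
proof -
  obtain X t where X: "sp4_typed X w w" "act X = (E w :: 'k sp4_ring)" and t: "sp4_typed t z w"
    "matrix_of t = matrix_comp z (matrix_of (top_word z)) (matrix_comp w N (matrix_of X))"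
    using ideal_matrix_right[OF z N identity_in_ideal] by blast
  have "matrix_of X = matrix_of (Ide w)"
    using X by (intro matrix_of_act_eq[of _ w w]) (simp_all add: has_type_def E_def)
  then show ?thesis using t matrix_comp_id_right[OF N] by (auto simp: matrix_of_simps)
qed

lemma ideal_matrix_left:
  assumes M: "M \<in> word_homs v w" and "top_ideal v v (x :: 'k::field sp4_ring)"
  shows "\<exists>X t. sp4_typed X v v \<and> act X = x \<and> sp4_typed t v w \<and> matrix_of t = matrix_comp v (matrix_of X) M"
  using assms(2)
proof (induction rule: top_ideal.induct)
  case ideal_zero
  show ?case
    by (rule exI[of _ "ZeroT v v"], rule exI[of _ "ZeroT v w"])
      (simp add: sp4_typed_zero act_zero matrix_of_simps matrix_comp_linear)
next
  case (ideal_top z s t)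
  have T: "sp4_typed (top_word z) z z" by (rule top_typed)
  have N: "matrix_comp v (matrix_of s) M \<in> word_homs z w" by (intro word_homs_comp M matrix_of_hom ideal_top)
  from matrix_top_full[OF ideal_top(1) N] obtain r where r: "sp4_typed r z w"
    "matrix_of r = matrix_comp z (matrix_of (top_word z)) (matrix_comp v (matrix_of s) M)" by blast
  note ty = comp_typed[OF ideal_top(3) comp_typed[OF T ideal_top(2)]]
  have "act ((s \<bullet> top_word z) \<bullet> t) = act s * act (top_word z) * act t"
    by (simp add: act_comp_typed[OF ideal_top(3) comp_typed[OF T ideal_top(2)]] act_comp_typed[OF T ideal_top(2)])
  moreover have "matrix_of (r \<bullet> t) = matrix_comp v (matrix_of ((s \<bullet> top_word z) \<bullet> t)) M"
    by (simp add: matrix_of_comp[OF ideal_top(3) r(1)] r(2) matrix_of_comp[OF ideal_top(3) comp_typed[OF T ideal_top(2)]]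
      matrix_of_comp[OF T ideal_top(2)] matrix_comp_assoc)
  ultimately show ?case using ty comp_typed[OF ideal_top(3) r(1)] by blast
next
  case (ideal_add x y)
  then obtain X s Y t where
    X: "sp4_typed X v v" "act X = x" "sp4_typed s v w" "matrix_of s = matrix_comp v (matrix_of X) M"
    and Y: "sp4_typed Y v v" "act Y = y" "sp4_typed t v w" "matrix_of t = matrix_comp v (matrix_of Y) M"
    by blast
  show ?case
    by (rule exI[of _ "X \<boxplus> Y"], rule exI[of _ "s \<boxplus> t"])
      (use X Y in \<open>auto simp: has_type_def act_add matrix_of_simps matrix_comp_linear\<close>)
qed

text \<open>For the identity of v in place of x, the term \<open>X\<close> of
  \<open>ideal_matrix_left\<close> represents an identity, and the factorisation becomes
  \<open>M\<close> itself.\<close>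

theorem matrix_of_full:
  assumes M: "M \<in> word_homs v w"
  shows "\<exists>t. sp4_typed t v w \<and> matrix_of t = (M :: _ \<Rightarrow> _ \<Rightarrow> 'k::field)"
proof -
  obtain X t where X: "sp4_typed X v v" "act X = (E v :: 'k sp4_ring)" and t: "sp4_typed t v w"
    "matrix_of t = matrix_comp v (matrix_of X) M"
    using ideal_matrix_left[OF M identity_in_ideal] by blast
  have "matrix_of X = matrix_of (Ide v)"
    using X by (intro matrix_of_act_eq[of _ v v]) (simp_all add: has_type_def E_def)
  then show ?thesis using t matrix_comp_id_left[OF M] by (auto simp: matrix_of_simps)
qed

section \<open>Faithfulness\<close>

lemma matrix_zero_comp:
  assumes "sp4_typed t v w" "matrix_of t = (\<lambda>x y. 0)"
  shows "sp4_typed s u v \<Longrightarrow> matrix_of (t \<bullet> s) = (\<lambda>x y. 0)" "sp4_typed s w u \<Longrightarrow> matrix_of (s \<bullet> t) = (\<lambda>x y. 0)"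
  using assms by (simp_all add: matrix_of_comp matrix_comp_linear)

text \<open>The cut-down morphism is a multiple of the square of \<open>top_word z\<close>, or zero.
  In crystals that square has entry 1 at \<open>top_elt z\<close>, so a vanishing matrix forces the
  scalar to be 0.\<close>

lemma faithful_top_top:
  assumes z: "sorted_word z" and z': "sorted_word z'"
    and t: "sp4_typed t z z'" "matrix_of t = (\<lambda>x y. 0 :: 'k::field)"
  shows "act (top_word z') * act t * act (top_word z) = (0 :: 'k sp4_ring)"
proof -
  obtain r where r: "act (top_word z') * act t * act (top_word z)
    = scalar r * (if z = z' then act (top_word z) * act (top_word z) else 0 :: 'k sp4_ring)"
    using top_span_top[OF z z' span_act[OF t(1)]] by blast
  show ?thesis
  proof (cases "z = z'")
    case True
    have T: "sp4_typed (top_word z :: 'k sp4_term) z z" by (rule top_typed)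
    note t' = t(1)[folded True]
    let ?l = "top_word z \<bullet> (t \<bullet> top_word z)" and ?r = "ScaleT r (top_word z \<bullet> top_word z) :: 'k sp4_term"
    have ty: "sp4_typed ?l z z" "sp4_typed ?r z z"
      using comp_typed[OF comp_typed[OF T t'] T] comp_typed[OF T T] by (auto simp: has_type_def)
    have "act ?l = act (top_word z) * act t * act (top_word z)"
      by (simp add: act_comp_typed[OF comp_typed[OF T t'] T] act_comp_typed[OF T t'] mult.assoc)
    also have "\<dots> = scalar r * (act (top_word z) * act (top_word z))" using r by (simp add: True)
    also have "\<dots> = act ?r" using ty(2) by (simp add: act_scale has_type_def act_comp_typed[OF T T, THEN HOL.sym] del: mult.assoc)
    finally have "act ?l = act ?r" .
    then have "matrix_of ?l = matrix_of ?r" by (rule matrix_of_act_eq[OF ty])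
    moreover have "matrix_of ?l = (\<lambda>x y. 0)"
      using matrix_zero_comp(2)[OF comp_typed[OF T t'] matrix_zero_comp(1)[OF t' t(2) T] T] .
    moreover have "matrix_of ?r (top_elt z) (top_elt z) = r"
    proof -
      have "sp4_wt (top_word z \<bullet> top_word z :: 'k sp4_term)" using comp_typed[OF T T] unfolding has_type_def by blast
      then show ?thesis
        by (simp add: matrix_of_simps(7) matrix_of_comp[OF T T] matrix_of_top[OF z]
            matrix_comp_top_elt[where M = "matrix_of (top_word z)", OF matrix_of_top[OF z]] del: well_typed.simps)
    qed
    ultimately have "r = 0" by (metis (full_types))
    then show ?thesis using r scalar_simps(2)[of 0 0 "act (top_word z) * act (top_word z) :: 'k sp4_ring"] True by simp
  qed (use r in simp)
qed

text \<open>Multiplication by the identity of w, written as a sum through sorted words, reduces the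
  claim to \<open>faithful_top_top\<close>; \<open>faithful\<close> repeats this at the
  source.\<close>

lemma faithful_top:
  assumes z: "sorted_word z" and t: "sp4_typed t z w" "matrix_of t = (\<lambda>x y. 0 :: 'k::field)"
  shows "act t * act (top_word z) = (0 :: 'k sp4_ring)"
proof -
  have "y * act t * act (top_word z) = 0" if "top_ideal w w y" for y :: "'k sp4_ring"
    using that
  proof (induction rule: top_ideal.induct)
    case (ideal_top z' s r)
    have "act (top_word z') * act (r \<bullet> t) * act (top_word z) = 0"
      by (rule faithful_top_top[OF z ideal_top(1) comp_typed[OF t(1) ideal_top(3)] matrix_zero_comp(2)[OF t ideal_top(3)]])
    then show ?case by (simp add: act_comp_typed[OF t(1) ideal_top(3)] mult.assoc)
  qed (simp_all add: distrib_right)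
  from this[OF identity_in_ideal] show ?thesis by (simp add: E_act(1)[OF t(1)])
qed

lemma faithful:
  assumes t: "sp4_typed t v w" "matrix_of t = (\<lambda>x y. 0 :: 'k::field)"
  shows "act t = (0 :: 'k sp4_ring)"
proof -
  have "act t * y = 0" if "top_ideal v v y" for y :: "'k sp4_ring"
    using that
  proof (induction rule: top_ideal.induct)
    case (ideal_top z s r)
    have "act (t \<bullet> s) * act (top_word z) = 0"
      by (rule faithful_top[OF ideal_top(1) comp_typed[OF ideal_top(2) t(1)] matrix_zero_comp(1)[OF t ideal_top(2)]])
    then show ?case by (simp add: act_comp_typed[OF ideal_top(2) t(1)] mult.assoc[symmetric])
  qed (simp_all add: distrib_left)
  from this[OF identity_in_ideal] show ?thesis by (simp add: E_act(2)[OF t(1)])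
qed

theorem matrix_of_eq_iff:
  assumes s: "sp4_typed s v w" and t: "sp4_typed t v w"
  shows "matrix_of s = matrix_of t \<longleftrightarrow> sp4_eq v w s (t :: 'k::field sp4_term)"
proof
  assume m: "matrix_of s = matrix_of t"
  have "sp4_typed (s \<boxminus> t) v w" "matrix_of (s \<boxminus> t) = (\<lambda>x y. 0)"
    using s t m by (auto simp: has_type_def matrix_of_simps)
  from faithful[OF this] have "act s + scalar (- 1) * act t = 0"
    using s t by (simp add: has_type_def act_add act_scale)
  then have "act s = act t" by (simp add: scalar_simps)
  then show "sp4_eq v w s t" using act_eq_iff[OF s t] by simp
next
  assume "sp4_eq v w s t"
  then show "matrix_of s = matrix_of t" using matrix_of_act_eq[OF s t] act_eq_iff[OF s t] by simp
qed

section \<open>The isomorphism of categories\<close>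

abbreviation crys_functor :: "'k::field sp4_term set \<Rightarrow> 'k crystal_arrow" where
  "crys_functor \<equiv> class_map crys"

lemma crys_functor_class:
  "sp4_typed t v w \<Longrightarrow> crys_functor (sp4_class t) = (v, matrix_of t, w)"
  unfolding sp4_class_def
  by (simp add: class_map_term_class[OF crys.interp_term_eq[OF crys_relations]] crys_matrix_of)

lemma crys_isomorphism:
  "linear_monoidal_isomorphism (sp4_category :: (_, 'k::field sp4_term set, _) lin_mon_cat) fund_sp4_crys id crys_functor"
proof -
  interpret F: linear_monoidal_functor "sp4_category :: (_, 'k sp4_term set, _) lin_mon_cat" fund_sp4_crys id crys_functor
    unfolding sp4_category_def by (rule crys.presented_functor[OF crys_relations])
  show ?thesis
  proof
    show "bij_betw id (obj (sp4_category :: (_, 'k sp4_term set, _) lin_mon_cat)) (obj (fund_sp4_crys :: (_, 'k crystal_arrow, _) lin_mon_cat))"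
      by (simp add: sp4_obj fund_sp4_crys_simps)
    fix v w
    have hom: "hom (sp4_category :: (_, 'k sp4_term set, _) lin_mon_cat) v w = sp4_class ` {t. sp4_typed t v w}"
      by (simp add: sp4_category_def sp4_class_def[abs_def] presented_simps has_type_def)
    have "inj_on crys_functor (sp4_class ` {t. sp4_typed t v w})"
      by (auto simp: inj_on_def crys_functor_class matrix_of_eq_iff sp4_eq_class)
    moreover have "crys_functor ` sp4_class ` {t. sp4_typed t v w} = (hom fund_sp4_crys v w :: 'k crystal_arrow set)"
    proof -
      have "(v, M, w) \<in> crys_functor ` sp4_class ` {t. sp4_typed t v w}" if M: "M \<in> word_homs v w" for M :: "letter list \<Rightarrow> letter list \<Rightarrow> 'k"
      proof -
        obtain t where t: "sp4_typed t v w" "matrix_of t = M" using matrix_of_full[OF M] by blast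
        then have "(v, M, w) = crys_functor (sp4_class t)" by (simp add: crys_functor_class)
        with t(1) show ?thesis by blast
      qed
      then show ?thesis by (auto simp: fund_sp4_crys_simps crys_functor_class matrix_of_hom)
    qed
    ultimately show "bij_betw crys_functor (hom (sp4_category :: (_, 'k sp4_term set, _) lin_mon_cat) v w) (hom fund_sp4_crys (id v) (id w))"
      unfolding hom by (simp add: bij_betw_def)
  qed
qed

section \<open>The images of the generators\<close>

lemma crystal_edges_word:
  "(x, y) \<in> crystal_edges (word_crystal w) \<longleftrightarrow> map letter_fund x = w \<and> (\<exists>i. word_lower i x = Some y)"
proof -
  have "map letter_fund y = map letter_fund x" if "word_lower i x = Some y" for i
    using that word_raise_lower_iff word_raise_Some by metis
  then show ?thesis by (auto simp: crystal_edges_def word_crystal_simps(1) word_crystal_at)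
qed

lemma component_induct [consumes 1, case_names base raise lower]:
  assumes "y \<in> component (word_crystal w) x"
    and "P x"
    and "\<And>y z i. y \<in> component (word_crystal w) x \<Longrightarrow> P y \<Longrightarrow> word_raise i y = Some z \<Longrightarrow> P z"
    and "\<And>y z i. y \<in> component (word_crystal w) x \<Longrightarrow> P y \<Longrightarrow> word_lower i y = Some z \<Longrightarrow> P z"
  shows "P y"
proof -
  have "(x, y) \<in> (crystal_edges (word_crystal w) \<union> (crystal_edges (word_crystal w))\<inverse>)\<^sup>*"
    using assms(1) by (simp add: component_def)
  then show ?thesis
  proof (induction rule: rtrancl_induct)
    case (step y z)
    have "y \<in> component (word_crystal w) x" using step(1) by (simp add: component_def)
    note c = assms(3)[OF this step.IH] assms(4)[OF this step.IH]
    from step(2) show ?case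
      using c by (auto simp: crystal_edges_word word_raise_lower_iff[symmetric])
  qed (rule assms(2))
qed

lemma component_self: "x \<in> component (word_crystal w) x"
  by (simp add: component_def)

lemma component_sym: "y \<in> component (word_crystal w) x \<Longrightarrow> x \<in> component (word_crystal w) y"
proof -
  let ?R = "crystal_edges (word_crystal w) \<union> (crystal_edges (word_crystal w))\<inverse>"
  have "sym (?R\<^sup>*)" by (rule sym_rtrancl) (auto simp: sym_def)
  then show "y \<in> component (word_crystal w) x \<Longrightarrow> x \<in> component (word_crystal w) y"
    by (auto simp: component_def dest: symD)
qed

lemma component_trans:
  "y \<in> component (word_crystal w) x \<Longrightarrow> z \<in> component (word_crystal w) y \<Longrightarrow> z \<in> component (word_crystal w) x"
  unfolding component_def by (auto intro: rtrancl_trans)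

lemma component_word:
  assumes "map letter_fund x = w" "y \<in> component (word_crystal w) x"
  shows "map letter_fund y = w"
  using assms(2,1)
  by (induction rule: component_induct) (auto simp: word_raise_lower_iff[symmetric] dest: word_raise_Some)

lemma component_step:
  assumes "map letter_fund y = w" "y \<in> component (word_crystal w) x"
  shows "word_raise i y = Some z \<Longrightarrow> z \<in> component (word_crystal w) x"
    "word_lower i y = Some z \<Longrightarrow> z \<in> component (word_crystal w) x"
proof -
  assume z: "word_raise i y = Some z"
  then have "(z, y) \<in> crystal_edges (word_crystal w)"
    using assms(1) word_raise_Some[OF z] by (auto simp: crystal_edges_word)
  then show "z \<in> component (word_crystal w) x"
    using assms(2) by (auto simp: component_def intro: rtrancl_into_rtrancl)
next
  assume "word_lower i y = Some z"
  then have "(y, z) \<in> crystal_edges (word_crystal w)"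
    using assms(1) by (auto simp: crystal_edges_word)
  then show "z \<in> component (word_crystal w) x"
    using assms(2) by (auto simp: component_def intro: rtrancl_into_rtrancl)
qed

lemma component_highest_weight:
  "map letter_fund x = w \<Longrightarrow> \<exists>y. y \<in> component (word_crystal w) x \<and> map letter_fund y = w \<and> highest_weight y"
proof (induction "sum_list (map letter_rank x)" arbitrary: x rule: less_induct)
  case less
  show ?case
  proof (cases "highest_weight x")
    case False
    then obtain i z where z: "word_raise i x = Some z" by (auto simp: highest_weight_def)
    have "z \<in> component (word_crystal w) x" by (rule component_step(1)[OF less.prems component_self z])
    moreover obtain y where "y \<in> component (word_crystal w) z" "map letter_fund y = w" "highest_weight y"
      using less.hyps[OF word_raise_rank[OF z]] word_raise_Some[OF z] less.prems by auto
    ultimately show ?thesis using component_trans by blast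
  qed (use less.prems component_self in blast)
qed

text \<open>Morphisms preserve \<open>word_eps\<close> and \<open>word_phi\<close> where they are
  nonzero, so each step in the component of x can be copied at the image. A morphism that is nonzero
  at one element is therefore nonzero on its whole component.\<close>

lemma component_image:
  assumes \<psi>: "word_morphism v w \<psi>" and x: "map letter_fund x = v" "\<psi> x = Some x'"
    and "y \<in> component (word_crystal v) x"
  shows "\<exists>y'. \<psi> y = Some y' \<and> y' \<in> component (word_crystal w) x'"
  using assms(4)
proof (induction rule: component_induct)
  case base
  then show ?case using x component_self by blast
next
  case (raise y z i)
  then obtain y' where y': "\<psi> y = Some y'" "y' \<in> component (word_crystal w) x'" by blast
  note y = component_word[OF x(1) raise.hyps(1)]
  have "word_eps i y' \<noteq> 0" using word_morphism_eps[OF \<psi> y y'(1)] word_raise_Some[OF raise.hyps(2)] by simp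
  then obtain z' where z': "word_raise i y' = Some z'" using word_raise_None by (cases "word_raise i y'") auto
  have "\<psi> z = Some z'" using word_morphismD(3)[OF \<psi> y, of i] y'(1) raise.hyps(2) z' by simp
  then show ?case using component_step(1)[OF word_morphismD(1)[OF \<psi> y y'(1)] y'(2) z'] by blast
next
  case (lower y z i)
  then obtain y' where y': "\<psi> y = Some y'" "y' \<in> component (word_crystal w) x'" by blast
  note y = component_word[OF x(1) lower.hyps(1)]
  have "word_phi i y' \<noteq> 0" using word_morphism_phi[OF \<psi> y y'(1)] lower.hyps(2) word_lower_None[of i y] by auto
  then obtain z' where z': "word_lower i y' = Some z'" using word_lower_None by (cases "word_lower i y'") auto
  have "\<psi> z = Some z'" using word_morphismD(4)[OF \<psi> y, of i] y'(1) lower.hyps(2) z' by simp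
  then show ?case using component_step(2)[OF word_morphismD(1)[OF \<psi> y y'(1)] y'(2) z'] by blast
qed

lemma strict_subcrystal:
  assumes \<psi>: "word_morphism v w \<psi>" and A: "A \<subseteq> word_elts v"
    and r: "\<And>x y i. x \<in> A \<Longrightarrow> word_raise i x = Some y \<Longrightarrow> y \<in> A"
    and l: "\<And>x y i. x \<in> A \<Longrightarrow> word_lower i x = Some y \<Longrightarrow> y \<in> A"
    and g: "\<And>x. x \<in> A \<Longrightarrow> \<psi> x = Some (g x) \<and> g x \<in> L"
  shows "strict_morphism (subcrystal (word_crystal v) A) (subcrystal (word_crystal w) L) (\<lambda>x. Some (g x))"
  unfolding strict_morphism_def
proof (intro conjI ballI allI impI)
  fix x i assume "x \<in> elts (subcrystal (word_crystal v) A)"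
  then have xA: "x \<in> A" by simp
  then have x: "map letter_fund x = v" using A by blast
  note D = word_morphismD[OF \<psi> x]
  have gx: "\<psi> x = Some (g x)" "g x \<in> L" using g[OF xA] by auto
  have gw: "map letter_fund (g x) = w" using D(1)[OF gx(1)] .
  { fix c assume "Some (g x) = Some c"
    then show "c \<in> elts (subcrystal (word_crystal w) L)"
      "wt (subcrystal (word_crystal w) L) c = wt (subcrystal (word_crystal v) A) x"
      using gx D(2)[OF gx(1)] gw x by (auto simp: word_crystal_at) }
  have "Option.bind (word_raise i x) (\<lambda>x. Some (g x)) = Option.bind (word_raise i x) \<psi>"
    using r[OF xA] g by (auto intro!: bind_option_cong)
  then show "Option.bind (raise (subcrystal (word_crystal v) A) i x) (\<lambda>x. Some (g x))
      = Option.bind (Some (g x)) (raise (subcrystal (word_crystal w) L) i)"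
    using D(3)[of i] gx(1) gw x by (simp add: word_crystal_at)
  have "Option.bind (word_lower i x) (\<lambda>x. Some (g x)) = Option.bind (word_lower i x) \<psi>"
    using l[OF xA] g by (auto intro!: bind_option_cong)
  then show "Option.bind (lower (subcrystal (word_crystal v) A) i x) (\<lambda>x. Some (g x))
      = Option.bind (Some (g x)) (lower (subcrystal (word_crystal w) L) i)"
    using D(4)[of i] gx(1) gw x by (simp add: word_crystal_at)
qed

section \<open>Existence and uniqueness of the described morphisms\<close>

lemma crystal_arrow_eqI:
  assumes "word_morphism v w \<psi>" "word_morphism v w \<chi>"
    and "\<And>x. map letter_fund x = v \<Longrightarrow> highest_weight x \<Longrightarrow> \<psi> x = \<chi> x"
  shows "(crystal_arrow v w \<psi> :: 'k::field crystal_arrow) = crystal_arrow v w \<chi>"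
proof -
  have "(word_matrix v \<psi> :: _ \<Rightarrow> _ \<Rightarrow> 'k) = word_matrix v \<chi>"
    by (rule word_homs_eqI[OF word_homs_matrix[OF assms(1)] word_homs_matrix[OF assms(2)]])
      (simp add: word_matrix_eq assms(3))
  then show ?thesis by (simp add: crystal_arrow_def)
qed

lemma highest_weight_image:
  "word_morphism v w \<psi> \<Longrightarrow> map letter_fund x = v \<Longrightarrow> highest_weight x \<Longrightarrow> \<psi> x = Some y \<Longrightarrow> highest_weight y"
  using word_morphismD(3)[of v w \<psi> x] by (simp add: highest_weight_def)

text \<open>Existence: the inverse \<open>\<chi>\<close> makes \<open>\<psi>\<close> a bijection
  from the component of b onto L, and elsewhere \<open>\<psi>\<close> vanishes because every
  component contains a highest weight element. Uniqueness: a competitor sends a highest weight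
  element of its component to b', the only one in L, and the weight leaves b as the only
  candidate.\<close>

lemma component_arrow:
  assumes \<psi>: "word_morphism v w \<psi>" and \<chi>: "word_morphism w v \<chi>"
    and inv: "\<And>x y. \<chi> y = Some x \<longleftrightarrow> \<psi> x = Some y"
    and b: "map letter_fund b = v" "\<psi> b = Some b'" "highest_weight b"
    and hw: "\<And>x. map letter_fund x = v \<Longrightarrow> highest_weight x \<Longrightarrow> x \<noteq> b \<Longrightarrow> \<psi> x = None \<and> word_wt x \<noteq> word_wt b'"
    and L: "L = component (word_crystal w) b'"
    and hwL: "\<And>y. y \<in> L \<Longrightarrow> highest_weight y \<Longrightarrow> y = b'"
  shows "is_component_arrow v (subcrystal (word_crystal w) L) w L (crystal_arrow v w \<psi> :: 'k::field crystal_arrow)"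
proof -
  let ?K = "component (word_crystal v) b" and ?g = "\<lambda>x. the (\<psi> x)"
  have b': "map letter_fund b' = w" by (rule word_morphismD(1)[OF \<psi> b(1,2)])
  have K: "\<exists>y. \<psi> x = Some y \<and> y \<in> L" if "x \<in> ?K" for x
    using component_image[OF \<psi> b(1,2) that] L by blast
  have K': "\<exists>x. \<chi> y = Some x \<and> x \<in> ?K" if "y \<in> L" for y
    using component_image[OF \<chi> b' _ that[unfolded L]] b(2) inv by blast
  have g: "\<psi> x = Some (?g x) \<and> ?g x \<in> L \<and> \<chi> (?g x) = Some x" if x: "x \<in> ?K" for x
  proof -
    obtain y where "\<psi> x = Some y" "y \<in> L" using K[OF x] by blast
    moreover from this have "\<chi> y = Some x" using inv by blast
    ultimately show ?thesis by simp
  qed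
  have h: "\<psi> (the (\<chi> y)) = Some y \<and> the (\<chi> y) \<in> ?K" if y: "y \<in> L" for y
  proof -
    obtain x where "\<chi> y = Some x" "x \<in> ?K" using K'[OF y] by blast
    moreover from this have "\<psi> x = Some y" using inv by blast
    ultimately show ?thesis by simp
  qed
  have "bij_betw ?g ?K L"
    by (rule bij_betw_byWitness[where f' = "\<lambda>y. the (\<chi> y)"]) (use g h in auto)
  moreover have "strict_morphism (subcrystal (word_crystal v) ?K) (subcrystal (word_crystal w) L) (\<lambda>x. Some (?g x))"
    using component_word[OF b(1)] component_step[OF component_word[OF b(1)]] g
    by (intro strict_subcrystal[OF \<psi>]) blast+
  ultimately have iso: "crystal_iso (subcrystal (word_crystal v) ?K) (subcrystal (word_crystal w) L) ?g"
    by (simp add: crystal_iso_def)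
  have out: "\<psi> x = None" if x: "map letter_fund x = v" "x \<notin> ?K" for x
  proof (cases "\<psi> x")
    case (Some y)
    obtain z where z: "z \<in> component (word_crystal v) x" "map letter_fund z = v" "highest_weight z"
      using component_highest_weight[OF x(1)] by blast
    obtain z' where "\<psi> z = Some z'" using component_image[OF \<psi> x(1) Some z(1)] by metis
    then have "z = b" using hw[OF z(2,3)] by force
    then show ?thesis using component_sym[OF z(1)] x(2) by simp
  qed
  have "component_morphism (word_crystal v) (subcrystal (word_crystal w) L) (word_crystal w) L \<psi>"
    unfolding component_morphism_def strict_morphism_word
  proof (intro conjI bexI[of _ ?K] exI[of _ ?g] \<psi> iso ballI)
    show "?K \<in> component (word_crystal v) ` elts (word_crystal v)"
      using b(1) by (simp add: word_crystal_simps(1))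
  qed (use K out in \<open>fastforce simp: word_crystal_simps(1)\<close>)+
  moreover have "crystal_arrow v w \<psi> = (crystal_arrow v w \<psi>' :: 'k crystal_arrow)"
    if "component_morphism (word_crystal v) (subcrystal (word_crystal w) L) (word_crystal w) L \<psi>'" for \<psi>'
  proof -
    from that obtain a K' g where \<psi>': "word_morphism v w \<psi>'" and a: "map letter_fund a = v" "K' = component (word_crystal v) a"
      and g: "crystal_iso (subcrystal (word_crystal v) K') (subcrystal (word_crystal w) L) g" "\<forall>x\<in>K'. \<psi>' x = Some (g x)"
      and o: "\<forall>x\<in>elts (word_crystal v) - K'. \<psi>' x = None"
      unfolding component_morphism_def strict_morphism_word by (auto simp: word_crystal_simps(1))
    have img: "x = b \<and> \<psi>' x = Some b'" if x: "x \<in> K'" "map letter_fund x = v" "highest_weight x" for x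
    proof -
      have gx: "\<psi>' x = Some (g x)" "g x \<in> L" using g x(1) by (auto simp: crystal_iso_def bij_betw_def)
      have "g x = b'" by (rule hwL[OF gx(2) highest_weight_image[OF \<psi>' x(2,3) gx(1)]])
      then show ?thesis using word_morphismD(2)[OF \<psi>' x(2) gx(1)] hw[OF x(2,3)] gx(1) by auto
    qed
    obtain z where z: "z \<in> K'" "map letter_fund z = v" "highest_weight z"
      using component_highest_weight[OF a(1)] a(2) by blast
    show ?thesis
    proof (rule crystal_arrow_eqI[OF \<psi> \<psi>'])
      fix x assume x: "map letter_fund x = v" "highest_weight x"
      show "\<psi> x = \<psi>' x"
      proof (cases "x = b")
        case True
        then show ?thesis using img[OF z] z(1) b(2) by metis
      next
        case False
        then have "x \<notin> K'" using img x by blast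
        then have "\<psi>' x = None" using o x(1) by (simp add: word_crystal_simps(1))
        then show ?thesis using hw[OF x False] by simp
      qed
    qed
  qed
  ultimately show ?thesis unfolding is_component_arrow_def by blast
qed

text \<open>An isomorphism preserves weights and maps highest weight elements to such elements.
  Where these are separated by their weights none can be permuted, and this gives
  uniqueness.\<close>

lemma unique_iso_arrow:
  assumes \<psi>: "word_morphism v w \<psi>" and \<chi>: "word_morphism w v \<chi>"
    and inv: "\<And>x y. \<chi> y = Some x \<longleftrightarrow> \<psi> x = Some y"
    and hwv: "\<And>x. map letter_fund x = v \<Longrightarrow> highest_weight x \<Longrightarrow> \<psi> x \<noteq> None"
    and hww: "\<And>y. map letter_fund y = w \<Longrightarrow> highest_weight y \<Longrightarrow> \<chi> y \<noteq> None"
    and mult: "\<And>y z. map letter_fund y = w \<Longrightarrow> highest_weight y \<Longrightarrow> map letter_fund z = w \<Longrightarrow> highest_weight z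
      \<Longrightarrow> word_wt y = word_wt z \<Longrightarrow> y = z"
  shows "is_unique_iso_arrow v w (crystal_arrow v w \<psi> :: 'k::field crystal_arrow)"
proof -
  have total: "\<phi> x \<noteq> None"
    if \<phi>: "word_morphism u u' \<phi>" "map letter_fund x = u" "\<And>x. map letter_fund x = u \<Longrightarrow> highest_weight x \<Longrightarrow> \<phi> x \<noteq> None" for u u' \<phi> x
  proof -
    obtain z where z: "z \<in> component (word_crystal u) x" "map letter_fund z = u" "highest_weight z"
      using component_highest_weight[OF \<phi>(2)] by blast
    then obtain z' where "\<phi> z = Some z'" using \<phi>(3) by blast
    from component_image[OF \<phi>(1) z(2) this component_sym[OF z(1)]] show ?thesis by blast
  qed
  let ?g = "\<lambda>x. the (\<psi> x)"
  have g: "\<psi> x = Some (?g x) \<and> ?g x \<in> word_elts w" if "map letter_fund x = v" for x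
    using total[OF \<psi> that hwv] word_morphismD(1)[OF \<psi> that] by auto
  have g': "\<chi> y = Some (the (\<chi> y)) \<and> the (\<chi> y) \<in> word_elts v" if "map letter_fund y = w" for y
    using total[OF \<chi> that hww] word_morphismD(1)[OF \<chi> that] by auto
  have i: "\<chi> (?g x) = Some x" if "map letter_fund x = v" for x
    using g[OF that] inv[of "?g x" x] by simp
  have i': "\<psi> (the (\<chi> y)) = Some y" if "map letter_fund y = w" for y
    using g'[OF that] inv[of y "the (\<chi> y)"] by simp
  have "bij_betw ?g (word_elts v) (word_elts w)"
    by (rule bij_betw_byWitness[where f' = "\<lambda>y. the (\<chi> y)"]) (use g g' i i' in auto)
  moreover have "strict_morphism (subcrystal (word_crystal v) (word_elts v)) (subcrystal (word_crystal w) (word_elts w)) (\<lambda>x. Some (?g x))"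
    using g by (intro strict_subcrystal[OF \<psi>]) (auto simp: word_raise_lower_iff[symmetric] dest: word_raise_Some)
  moreover have "subcrystal (word_crystal u) (word_elts u) = word_crystal u" for u
    by (simp add: word_crystal_simps(1)[symmetric])
  ultimately have "crystal_iso (word_crystal v) (word_crystal w) ?g"
    by (simp add: crystal_iso_def word_crystal_simps(1))
  moreover have "crystal_arrow v w \<psi> = (crystal_arrow v w (\<lambda>x. Some (h x)) :: 'k crystal_arrow)"
    if "crystal_iso (word_crystal v) (word_crystal w) h" for h
  proof -
    have h: "word_morphism v w (\<lambda>x. Some (h x))" using that by (simp add: crystal_iso_def strict_morphism_word)
    show ?thesis
    proof (rule crystal_arrow_eqI[OF \<psi> h])
      fix x assume x: "map letter_fund x = v" "highest_weight x"
      obtain y where y: "\<psi> x = Some y" using hwv[OF x] by blast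
      have "y = h x"
        using word_morphismD(1,2)[OF \<psi> x(1) y] highest_weight_image[OF \<psi> x y]
          word_morphismD(1,2)[OF h x(1) HOL.refl] highest_weight_image[OF h x HOL.refl]
        by (intro mult) simp_all
      then show "\<psi> x = Some (h x)" using y by simp
    qed
  qed
  ultimately show ?thesis unfolding is_unique_iso_arrow_def by blast
qed

lemma component_single_highest_weight:
  assumes "\<And>y. map letter_fund y = w \<Longrightarrow> highest_weight y \<Longrightarrow> y = b" "map letter_fund b = w"
  shows "component (word_crystal w) b = word_elts w"
proof
  show "component (word_crystal w) b \<subseteq> word_elts w" using component_word[OF assms(2)] by blast
  show "word_elts w \<subseteq> component (word_crystal w) b"
    using component_highest_weight[of _ w] assms(1) component_sym by blast
qed

lemma highest_weight_cases:
  "map letter_fund x = w \<Longrightarrow> highest_weight x \<Longrightarrow> x \<in> set (highest_weight_words w)"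
  by (simp add: highest_weight_words)

lemma gen_component_arrow:
  assumes b: "b \<in> set (highest_weight_words (gsrc g))" "gen_map g b = Some b'"
    and hw: "\<forall>x\<in>set (highest_weight_words (gsrc g)). x \<noteq> b \<longrightarrow> gen_map g x = None \<and> word_wt x \<noteq> word_wt b'"
    and L: "L = component (word_crystal (gtgt g)) b'"
    and hwL: "\<forall>y\<in>set (highest_weight_words (gtgt g)). y \<noteq> b' \<longrightarrow> y \<notin> component (word_crystal (gtgt g)) b'"
  shows "is_component_arrow (gsrc g) (subcrystal (word_crystal (gtgt g)) L) (gtgt g) L (crys_functor (sp4_class (Gen g :: 'k::field sp4_term)))"
proof -
  have r: "gsrc (greflect g) = gtgt g" "gtgt (greflect g) = gsrc g" by (cases g; simp)+
  have bv: "map letter_fund b = gsrc g" "highest_weight b" using b(1) by (auto simp: highest_weight_words)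
  have "crys_functor (sp4_class (Gen g :: 'k sp4_term)) = crystal_arrow (gsrc g) (gtgt g) (gen_map g)"
    by (subst crys_functor_class) (auto simp: has_type_def matrix_of_simps crystal_arrow_def)
  moreover have "is_component_arrow (gsrc g) (subcrystal (word_crystal (gtgt g)) L) (gtgt g) L (crystal_arrow (gsrc g) (gtgt g) (gen_map g) :: 'k crystal_arrow)"
  proof (rule component_arrow[OF gen_map_morphism gen_map_morphism[of "greflect g", unfolded r] gen_map_reflect bv(1) b(2) bv(2) _ L])
    show "gen_map g x = None \<and> word_wt x \<noteq> word_wt b'" if "map letter_fund x = gsrc g" "highest_weight x" "x \<noteq> b" for x
      using hw that by (simp add: highest_weight_words)
    show "y = b'" if "y \<in> L" "highest_weight y" for y
      using hwL that component_word[OF word_morphismD(1)[OF gen_map_morphism bv(1) b(2)], of y]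
      by (auto simp: highest_weight_words L)
  qed
  ultimately show ?thesis by simp
qed

lemma gen_iso_arrow:
  assumes "\<forall>x\<in>set (highest_weight_words (gsrc g)). gen_map g x \<noteq> None"
    and "\<forall>x\<in>set (highest_weight_words (gtgt g)). gen_map (greflect g) x \<noteq> None"
    and "inj_on word_wt (set (highest_weight_words (gtgt g)))"
  shows "is_unique_iso_arrow (gsrc g) (gtgt g) (crys_functor (sp4_class (Gen g :: 'k::field sp4_term)))"
proof -
  have r: "gsrc (greflect g) = gtgt g" "gtgt (greflect g) = gsrc g" by (cases g; simp)+
  have "crys_functor (sp4_class (Gen g :: 'k sp4_term)) = crystal_arrow (gsrc g) (gtgt g) (gen_map g)"
    by (subst crys_functor_class) (auto simp: has_type_def matrix_of_simps crystal_arrow_def)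
  moreover have "is_unique_iso_arrow (gsrc g) (gtgt g) (crystal_arrow (gsrc g) (gtgt g) (gen_map g) :: 'k crystal_arrow)"
    by (rule unique_iso_arrow[OF gen_map_morphism gen_map_morphism[of "greflect g", unfolded r] gen_map_reflect])
      (use assms in \<open>auto simp: highest_weight_words inj_on_def\<close>)
  ultimately show ?thesis by simp
qed

lemma component_letters:
  "component (word_crystal []) [] = {[]}"
  "component (word_crystal [B1]) [X1] = elts (word_crystal [B1])"
  "component (word_crystal [B2]) [Y1] = elts (word_crystal [B2])"
  using component_single_highest_weight[of "[]" "[]"] component_single_highest_weight[of "[B1]" "[X1]"]
    component_single_highest_weight[of "[B2]" "[Y1]"] highest_weight_cases[of _ "[B1]"] highest_weight_cases[of _ "[B2]"]
  by (simp_all add: word_crystal_simps(1) highest_weight_words_simps)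

text \<open>The target of \<open>Gd\<close> is not connected, so its components have to be told
  apart. A morphism that vanishes at one element vanishes on its component: both \<open>Gm\<close>
  and \<open>Gc1\<close> vanish at \<open>[X1, X1]\<close>, while \<open>Gm\<close> is nonzero at
  \<open>[X1, X2]\<close> and \<open>Gc1\<close> at \<open>[X1, X4]\<close>.\<close>

lemma component_X1_X1:
  "[X1, X2] \<notin> component (word_crystal [B1, B1]) [X1, X1]" "[X1, X4] \<notin> component (word_crystal [B1, B1]) [X1, X1]"
proof -
  have no: "y \<notin> component (word_crystal [B1, B1]) [X1, X1]"
    if "gsrc g = [B1, B1]" "gen_map g y = Some z" "map letter_fund y = [B1, B1]" "gen_map g [X1, X1] = None" for g y z
    using component_image[OF gen_map_morphism[of g] _ that(2) component_sym] that by fastforce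
  show "[X1, X2] \<notin> component (word_crystal [B1, B1]) [X1, X1]" by (rule no[of Gm]) (simp_all add: gen_map_simps)
  show "[X1, X4] \<notin> component (word_crystal [B1, B1]) [X1, X1]" by (rule no[of Gc1]) (simp_all add: gen_map_simps)
qed

lemma hw_crystal_small:
  "hw_crystal 0 0 = subcrystal (word_crystal []) (component (word_crystal []) [])"
  "hw_crystal 0 1 = subcrystal (word_crystal [B2]) (component (word_crystal [B2]) [Y1])"
  "hw_crystal 1 0 = subcrystal (word_crystal [B1]) (component (word_crystal [B1]) [X1])"
  "hw_crystal 2 0 = subcrystal (word_crystal [B1, B1]) (component (word_crystal [B1, B1]) [X1, X1])"
  by (simp_all add: hw_crystal_def Let_def numeral_2_eq_2)

lemmas arrow_simps = highest_weight_words_simps gen_map_simps component_X1_X1 zero_prod_def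

theorem proposition4p2p1:
  shows "\<exists>(Fo :: fund list \<Rightarrow> fund list) (Fm :: 'k::field sp4_term set \<Rightarrow> 'k crystal_arrow).
    linear_monoidal_isomorphism sp4_category fund_sp4_crys Fo Fm \<and>
    Fo [B1] = [B1] \<and> Fo [B2] = [B2] \<and>
    is_component_arrow [B1, B1] (hw_crystal 0 0) [] {[]} (Fm (sp4_class gc1)) \<and>
    is_component_arrow [B2, B2] (hw_crystal 0 0) [] {[]} (Fm (sp4_class gc2)) \<and>
    is_component_arrow [B1, B1] (hw_crystal 0 1) [B2] (elts (word_crystal [B2])) (Fm (sp4_class gm)) \<and>
    is_component_arrow [B1, B2] (hw_crystal 1 0) [B1] (elts (word_crystal [B1])) (Fm (sp4_class gt)) \<and>
    is_component_arrow [B2, B2] (hw_crystal 2 0) [B1, B1]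
      (component (word_crystal [B1, B1]) [X1, X1]) (Fm (sp4_class gd)) \<and>
    is_unique_iso_arrow [B1, B2] [B2, B1] (Fm (sp4_class gb12)) \<and>
    is_unique_iso_arrow [B2, B1] [B1, B2] (Fm (sp4_class gb21))"
proof (intro exI conjI)
  show "linear_monoidal_isomorphism (sp4_category :: (_, 'k sp4_term set, _) lin_mon_cat) fund_sp4_crys id crys_functor"
    by (rule crys_isomorphism)
  show "is_component_arrow [B1, B1] (hw_crystal 0 0) [] {[]} (crys_functor (sp4_class (gc1 :: 'k sp4_term)))"
    using gen_component_arrow[of "[X1, X4]" Gc1 "[]" "{[]}", where ?'k = 'k] unfolding hw_crystal_small
    by (simp add: arrow_simps component_letters)
  show "is_component_arrow [B2, B2] (hw_crystal 0 0) [] {[]} (crys_functor (sp4_class (gc2 :: 'k sp4_term)))"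
    using gen_component_arrow[of "[Y1, Y5]" Gc2 "[]" "{[]}", where ?'k = 'k] unfolding hw_crystal_small
    by (simp add: arrow_simps component_letters)
  show "is_component_arrow [B1, B1] (hw_crystal 0 1) [B2] (elts (word_crystal [B2])) (crys_functor (sp4_class (gm :: 'k sp4_term)))"
    using gen_component_arrow[of "[X1, X2]" Gm "[Y1]" "elts (word_crystal [B2])", where ?'k = 'k] unfolding hw_crystal_small
    by (simp add: arrow_simps component_letters)
  show "is_component_arrow [B1, B2] (hw_crystal 1 0) [B1] (elts (word_crystal [B1])) (crys_functor (sp4_class (gt :: 'k sp4_term)))"
    using gen_component_arrow[of "[X1, Y3]" Gt "[X1]" "elts (word_crystal [B1])", where ?'k = 'k] unfolding hw_crystal_small
    by (simp add: arrow_simps component_letters)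
  show "is_component_arrow [B2, B2] (hw_crystal 2 0) [B1, B1]
      (component (word_crystal [B1, B1]) [X1, X1]) (crys_functor (sp4_class (gd :: 'k sp4_term)))"
    using gen_component_arrow[of "[Y1, Y2]" Gd "[X1, X1]" "component (word_crystal [B1, B1]) [X1, X1]", where ?'k = 'k]
    unfolding hw_crystal_small by (auto simp: arrow_simps)
  show "is_unique_iso_arrow [B1, B2] [B2, B1] (crys_functor (sp4_class (gb12 :: 'k sp4_term)))"
    using gen_iso_arrow[of Gb12, where ?'k = 'k] by (auto simp: arrow_simps)
  show "is_unique_iso_arrow [B2, B1] [B1, B2] (crys_functor (sp4_class (gb21 :: 'k sp4_term)))"
    using gen_iso_arrow[of Gb21, where ?'k = 'k] by (auto simp: arrow_simps)
qed simp_all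

end
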